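(* Let $n\ge 1$, $0\le \ell\le n-1$, and $\mu = (n-\ell, 1^\ell)$. Then $$\langle \tilde{J}_\mu^{(\alpha)}(X),s_\mu \rangle = \sum_{k=0}^n \bigl(\ell \cdot \ell!\, h_k(B(c_1,\ldots,c_n)) + \ell!\, h_k(B(d_1,\ldots,d_n))\bigr) \binom{\alpha + k}{n}$$ $$= \sum_{k=0}^n \bigl(\ell \cdot \ell!\, r_{n-k}(B(c_1,\ldots,c_n)) + \ell!\, r_{n-k}(B(d_1,\ldots,d_n))\bigr) \binom{\alpha}{k}k!,$$ where $c_1 = c_2 = \cdots = c_{n-\ell-1} = n-\ell-2$ and $c_{n-\ell+i} = n-\ell-1+i$ for $0 \le i \le \ell$, and $d_1 = d_2 = \cdots = d_{n-\ell} = n-\ell-1$ and $d_{n-\ell+i} = n-\ell-1+i$ for $1 \le i \le \ell$.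
   Context: Jack polynomials: over $\mathbb{Q}(\alpha)$, with $\alpha$ an indeterminate, let $\langle p_\lambda,p_\nu\rangle_\alpha=\delta_{\lambda\nu}z_\lambda\alpha^{\ell(\lambda)}$, where $z_\lambda=\prod_i i^{m_i}m_i!$ and $m_i$ is the number of parts of $\lambda$ equal to $i$. The integral form Jack symmetric functions $J_\mu^{(\alpha)}(X)$ are the unique family, indexed by partitions $\mu$, of symmetric functions that are pairwise orthogonal for $\langle\cdot,\cdot\rangle_\alpha$, are triangular (only monomial symmetric functions $m_\lambda$ with $\lambda\le\mu$ in dominance order appear in $J_\mu^{(\alpha)}$), and are normalized so that the coefficient of $m_{1^n}$ in $J_\mu^{(\alpha)}$ is $n!$ where $n=|\mu|$. For $\mu$ a partition of $n$, define $\tilde J_\mu^{(\alpha)}(X)=\alpha^nJ_\mu^{(1/\alpha)}(X)$. The bracket $\langle\cdot,\cdot\rangle$ (without subscript) is the Hall scalar product, for which Schur functions are orthonormal (extended linearly over $\mathbb{Q}(\alpha)$). Binomial coefficients $\binom{\alpha+k}{n}$ and $\binom{\alpha}{k}$ are polynomials in $\alpha$. Rook theory: for $0\le c_1\le\cdots\le c_n\le n$ integers, $B(c_1,\ldots,c_n)$ is the Ferrers board in the $n\times n$ grid consisting of the bottom $c_i$ cells of column $i$, for each $i$. For a board $B$ (a subset of the $n\times n$ grid), $r_k(B)$ is the number of ways to place $k$ nonattacking rooks (no two in the same row or column) on $B$, and $h_k(B)$ is the number of ways to place $n$ nonattacking rooks on the $n\times n$ grid with exactly $k$ of them on $B$.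 *)

theory Defs
  imports
    "HOL-Library.Multiset"
    "HOL-Library.FuncSet"
    "HOL-Computational_Algebra.Computational_Algebra"
begin

section \<open>Power series in countably many variables\<close>

text \<open>
  A monomial in the commuting variables \<open>x\<^sub>0, x\<^sub>1, \<dots>\<close> is the finite multiset of the
  indices of its variables, so that products of monomials are sums of multisets.
\<close>

typedef 'a mps = "UNIV :: (nat multiset \<Rightarrow> 'a) set"
  morphisms mps_coeff Abs_mps ..

setup_lifting type_definition_mps

lemma mps_eqI: "(\<And>M. mps_coeff f M = mps_coeff g M) \<Longrightarrow> f = g"
  by transfer auto

lemma finite_submultisets: "finite {N. N \<subseteq># (M :: 'b multiset)}"
proof (induction M)
  case (add x M)
  have "{N. N \<subseteq># add_mset x M} \<subseteq> {N. N \<subseteq># M} \<union> add_mset x ` {N. N \<subseteq># M}"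
  proof
    fix N assume N: "N \<in> {N. N \<subseteq># add_mset x M}"
    show "N \<in> {N. N \<subseteq># M} \<union> add_mset x ` {N. N \<subseteq># M}"
    proof (cases "x \<in># N")
      case True
      then obtain N' where "N = add_mset x N'"
        by (blast dest: multi_member_split)
      with N show ?thesis by auto
    next
      case False
      with N have "N \<subseteq># M"
        by (metis diff_single_trivial diff_union_single_conv mem_Collect_eq
            add_mset_add_single subset_eq_diff_conv)
      then show ?thesis by simp
    qed
  qed
  with add show ?case
    by (meson finite_UnI finite_imageI finite_subset)
qed simp

instantiation mps :: (comm_ring_1) comm_ring_1
begin

lift_definition zero_mps :: "'a mps" is "\<lambda>_. 0" .
lift_definition one_mps :: "'a mps" is "\<lambda>M. if M = {#} then 1 else 0" .
lift_definition plus_mps :: "'a mps \<Rightarrow> 'a mps \<Rightarrow> 'a mps" is "\<lambda>f g M. f M + g M" .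
lift_definition minus_mps :: "'a mps \<Rightarrow> 'a mps \<Rightarrow> 'a mps" is "\<lambda>f g M. f M - g M" .
lift_definition uminus_mps :: "'a mps \<Rightarrow> 'a mps" is "\<lambda>f M. - f M" .
lift_definition times_mps :: "'a mps \<Rightarrow> 'a mps \<Rightarrow> 'a mps"
  is "\<lambda>f g M. \<Sum>N | N \<subseteq># M. f N * g (M - N)" .

instance
proof
  fix f g h :: "'a mps"
  show "f * g * h = f * (g * h)"
  proof (transfer, rule ext)
    fix f g h :: "nat multiset \<Rightarrow> 'a" and M
    have "(\<Sum>N | N \<subseteq># M. (\<Sum>K | K \<subseteq># N. f K * g (N - K)) * h (M - N)) =
      (\<Sum>(N, K) \<in> (SIGMA N:{N. N \<subseteq># M}. {K. K \<subseteq># N}). f K * g (N - K) * h (M - N))"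
      by (subst sum.Sigma[symmetric]) (auto simp: finite_submultisets sum_distrib_right)
    also have "\<dots> = (\<Sum>(K, L) \<in> (SIGMA K:{K. K \<subseteq># M}. {L. L \<subseteq># M - K}).
        f K * (g L * h (M - K - L)))"
    proof (rule sum.reindex_bij_witness[where i = "\<lambda>(K, L). (K + L, K)"
            and j = "\<lambda>(N, K). (K, N - K)"], goal_cases)
      case (2 a)
      then show ?case
        by (auto simp: subseteq_mset_def diff_le_mono intro: le_trans)
    next
      case (4 b)
      then show ?case
        by (auto simp: subset_mset.le_diff_conv2 add.commute)
    next
      case (5 a)
      then show ?case
        by (auto simp: mult.assoc subset_mset.add_diff_inverse)
    qed (auto simp: subset_mset.add_diff_inverse)
    also have "\<dots> = (\<Sum>K | K \<subseteq># M. f K * (\<Sum>L | L \<subseteq># M - K. g L * h (M - K - L)))"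
      by (subst sum.Sigma[symmetric]) (auto simp: finite_submultisets sum_distrib_left)
    finally show "(\<Sum>N | N \<subseteq># M. (\<Sum>K | K \<subseteq># N. f K * g (N - K)) * h (M - N)) =
      (\<Sum>K | K \<subseteq># M. f K * (\<Sum>L | L \<subseteq># M - K. g L * h (M - K - L)))" .
  qed
  show "f * g = g * f"
  proof (transfer, rule ext)
    fix f g :: "nat multiset \<Rightarrow> 'a" and M :: "nat multiset"
    have *: "M - (M - N) = N" if "N \<subseteq># M" for N :: "nat multiset"
      using that by (simp add: multiset_eq_iff subseteq_mset_def)
    show "(\<Sum>N | N \<subseteq># M. f N * g (M - N)) = (\<Sum>N | N \<subseteq># M. g N * f (M - N))"
      by (rule sum.reindex_bij_witness[where i = "\<lambda>N. M - N" and j = "\<lambda>N. M - N"])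
         (auto simp: * mult.commute)
  qed
  show "1 * f = f"
  proof (transfer, rule ext)
    fix f :: "nat multiset \<Rightarrow> 'a" and M
    have "(\<Sum>N | N \<subseteq># M. (if N = {#} then 1 else 0) * f (M - N)) =
      (\<Sum>N | N \<subseteq># M. if N = {#} then f M else 0)"
      by (rule sum.cong) auto
    also have "\<dots> = f M"
      by (subst sum.delta) (auto simp: finite_submultisets)
    finally show "(\<Sum>N | N \<subseteq># M. (if N = {#} then 1 else 0) * f (M - N)) = f M" .
  qed
  show "(f + g) * h = f * h + g * h"
    by transfer (auto simp: fun_eq_iff ring_distribs sum.distrib)
  show "f + g + h = f + (g + h)" "f + g = g + f" "0 + f = f" "- f + f = 0" "f - g = f + - g"
    by (transfer; simp add: fun_eq_iff algebra_simps)+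
  show "(0 :: 'a mps) \<noteq> 1"
    by transfer (auto simp: fun_eq_iff)
qed

end

lift_definition mps_scale :: "'a::comm_ring_1 \<Rightarrow> 'a mps \<Rightarrow> 'a mps" is "\<lambda>c f M. c * f M" .

global_interpretation mps: vector_space "mps_scale :: 'a::field \<Rightarrow> 'a mps \<Rightarrow> 'a mps"
  by unfold_locales (transfer; simp add: fun_eq_iff algebra_simps)+


section \<open>Symmetric functions\<close>

definition symmetric_functions :: "'a::comm_ring_1 mps set" where
  "symmetric_functions = {f.
     (\<forall>\<pi> M. bij \<pi> \<longrightarrow> mps_coeff f (image_mset \<pi> M) = mps_coeff f M) \<and>
     (\<exists>d. \<forall>M. size M > d \<longrightarrow> mps_coeff f M = 0)}"

definition is_partition :: "nat list \<Rightarrow> bool" where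
  "is_partition \<nu> \<longleftrightarrow> sorted_wrt (\<ge>) \<nu> \<and> 0 \<notin> set \<nu>"

definition dominated_by :: "nat list \<Rightarrow> nat list \<Rightarrow> bool" where
  "dominated_by \<nu> \<mu> \<longleftrightarrow> sum_list \<nu> = sum_list \<mu> \<and> (\<forall>i. sum_list (take i \<nu>) \<le> sum_list (take i \<mu>))"

definition exponents :: "nat multiset \<Rightarrow> nat multiset" where
  "exponents M = image_mset (count M) (mset_set (set_mset M))"

definition monomial_sym :: "nat list \<Rightarrow> 'a::comm_ring_1 mps" where
  "monomial_sym \<nu> = Abs_mps (\<lambda>M. if exponents M = mset \<nu> then 1 else 0)"

definition power_sum :: "nat \<Rightarrow> 'a::comm_ring_1 mps" where
  "power_sum k = Abs_mps (\<lambda>M. if \<exists>i. M = replicate_mset k i then 1 else 0)"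

definition power_sum_sym :: "nat list \<Rightarrow> 'a::comm_ring_1 mps" where
  "power_sum_sym \<nu> = prod_list (map power_sum \<nu>)"

text \<open>
  Young diagrams and tableaux are indexed from 0; a tableau is undefined outside its diagram,
  so that there are finitely many tableaux with a given content.
\<close>

definition young_diagram :: "nat list \<Rightarrow> (nat \<times> nat) set" where
  "young_diagram \<nu> = {(i, j). i < length \<nu> \<and> j < \<nu> ! i}"

definition ssyt :: "nat list \<Rightarrow> (nat \<times> nat \<Rightarrow> nat) set" where
  "ssyt \<nu> = {T \<in> extensional (young_diagram \<nu>).
     (\<forall>i j. (i, Suc j) \<in> young_diagram \<nu> \<longrightarrow> T (i, j) \<le> T (i, Suc j)) \<and>
     (\<forall>i j. (Suc i, j) \<in> young_diagram \<nu> \<longrightarrow> T (i, j) < T (Suc i, j))}"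

definition schur :: "nat list \<Rightarrow> 'a::comm_ring_1 mps" where
  "schur \<nu> = Abs_mps (\<lambda>M.
     of_nat (card {T \<in> ssyt \<nu>. image_mset T (mset_set (young_diagram \<nu>)) = M}))"


section \<open>Scalar products and Jack symmetric functions\<close>

definition basis_coeff :: "(nat list \<Rightarrow> 'a mps) \<Rightarrow> 'a::field mps \<Rightarrow> nat list \<Rightarrow> 'a" where
  "basis_coeff b f \<nu> = mps.representation (b ` Collect is_partition) f (b \<nu>)"

text \<open>
  The bilinear form on the span of the vectors \<open>b \<nu>\<close>, for \<open>\<nu>\<close> a partition, for which these are
  pairwise orthogonal with \<open>\<langle>b \<nu>, b \<nu>\<rangle> = w \<nu>\<close>.
\<close>

definition orthogonal_form ::
  "(nat list \<Rightarrow> 'a mps) \<Rightarrow> (nat list \<Rightarrow> 'a) \<Rightarrow> 'a mps \<Rightarrow> 'a mps \<Rightarrow> 'a::field" where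
  "orthogonal_form b w f g =
     (\<Sum>\<nu> | is_partition \<nu> \<and> basis_coeff b f \<nu> \<noteq> 0. basis_coeff b f \<nu> * basis_coeff b g \<nu> * w \<nu>)"

definition hall_inner :: "'a mps \<Rightarrow> 'a mps \<Rightarrow> 'a::field" where
  "hall_inner = orthogonal_form schur (\<lambda>_. 1)"

definition z_part :: "nat list \<Rightarrow> nat" where
  "z_part \<nu> = (\<Prod>i\<in>set \<nu>. i ^ count_list \<nu> i * fact (count_list \<nu> i))"

definition jack_inner :: "'a \<Rightarrow> 'a mps \<Rightarrow> 'a mps \<Rightarrow> 'a::field" where
  "jack_inner \<beta> = orthogonal_form power_sum_sym (\<lambda>\<nu>. of_nat (z_part \<nu>) * \<beta> ^ length \<nu>)"

text \<open>
  \<open>jack_family \<beta> J\<close> says that \<open>J\<close> is the family of integral form Jack functions with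
  parameter \<open>\<beta>\<close>. Only the values of \<open>J\<close> at partitions matter.
\<close>

definition jack_family :: "'a::field_char_0 \<Rightarrow> (nat list \<Rightarrow> 'a mps) \<Rightarrow> bool" where
  "jack_family \<beta> J \<longleftrightarrow>
     (\<forall>\<mu>. is_partition \<mu> \<longrightarrow> J \<mu> \<in> symmetric_functions) \<and>
     (\<forall>\<mu> \<nu>. is_partition \<mu> \<longrightarrow> is_partition \<nu> \<longrightarrow> \<mu> \<noteq> \<nu> \<longrightarrow> jack_inner \<beta> (J \<mu>) (J \<nu>) = 0) \<and>
     (\<forall>\<mu> \<nu>. is_partition \<mu> \<longrightarrow> is_partition \<nu> \<longrightarrow>
        basis_coeff monomial_sym (J \<mu>) \<nu> \<noteq> 0 \<longrightarrow> dominated_by \<nu> \<mu>) \<and>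
     (\<forall>\<mu>. is_partition \<mu> \<longrightarrow>
        basis_coeff monomial_sym (J \<mu>) (replicate (sum_list \<mu>) 1) = fact (sum_list \<mu>))"

text \<open>
  The field \<open>\<rat>(\<alpha>)\<close> is \<^typ>\<open>rat poly fract\<close>. The substitution of \<open>1/\<alpha>\<close> for \<open>\<alpha>\<close> is an
  automorphism of this field, and it takes the characterization of the family with parameter \<open>\<alpha>\<close>
  to that of the family with parameter \<open>1/\<alpha>\<close>. Hence \<open>J\<^sup>(\<^sup>1\<^sup>/\<^sup>\<alpha>\<^sup>)\<close> is the family with
  parameter \<open>1/\<alpha>\<close> over the same field.
\<close>

definition alpha :: "rat poly fract" where
  "alpha = to_fract [:0, 1:]"

definition jack_tilde :: "(nat list \<Rightarrow> rat poly fract mps) \<Rightarrow> nat list \<Rightarrow> rat poly fract mps" where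
  "jack_tilde J \<mu> = mps_scale (alpha ^ sum_list \<mu>) (J \<mu>)"


section \<open>Rook placements\<close>

text \<open>The cell \<open>(i, j)\<close> is in column \<open>i\<close> and in row \<open>j\<close>, counted from the bottom.\<close>

definition grid :: "nat \<Rightarrow> (nat \<times> nat) set" where
  "grid n = {1..n} \<times> {1..n}"

definition ferrers_board :: "nat \<Rightarrow> (nat \<Rightarrow> nat) \<Rightarrow> (nat \<times> nat) set" where
  "ferrers_board n c = {(i, j) \<in> grid n. j \<le> c i}"

definition nonattacking :: "(nat \<times> nat) set \<Rightarrow> bool" where
  "nonattacking S \<longleftrightarrow> (\<forall>s\<in>S. \<forall>t\<in>S. s \<noteq> t \<longrightarrow> fst s \<noteq> fst t \<and> snd s \<noteq> snd t)"

definition rook_number :: "nat \<Rightarrow> (nat \<times> nat) set \<Rightarrow> nat" where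
  "rook_number k B = card {S. S \<subseteq> B \<and> nonattacking S \<and> card S = k}"

definition hit_number :: "nat \<Rightarrow> nat \<Rightarrow> (nat \<times> nat) set \<Rightarrow> nat" where
  "hit_number n k B = card {S. S \<subseteq> grid n \<and> nonattacking S \<and> card S = n \<and> card (S \<inter> B) = k}"

end

theory Submission
  imports Defs "HOL-Combinatorics.Transposition"
begin

text \<open>
  Schur functions are unitriangular over the monomial symmetric functions (their symmetry comes from
  the Bender-Knuth involutions), so the scalar product in question is the coefficient of \<open>m\<^sub>\<mu>\<close> in
  \<open>J\<^sub>\<mu>\<close>, up to the power of \<open>\<alpha>\<close>.

  Let \<open>G\<^sub>k\<close> and \<open>(-1)\<^sup>r e\<^sub>r\<close> be the coefficients of \<open>t\<^sup>k\<close> in \<open>\<Prod> (1 - x\<^sub>i t)\<^sup>-\<^sup>\<alpha>\<close> and of \<open>t\<^sup>r\<close> in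
  \<open>\<Prod> (1 - x\<^sub>i t)\<close>, and let \<open>F\<close> be the sum over \<open>r \<le> l\<close> of \<open>(n + (\<alpha> - 1) r) (-1)\<^sup>r e\<^sub>r G\<^sub>n\<^sub>-\<^sub>r\<close>. The sum over
  all \<open>r \<le> n\<close> vanishes, and \<open>e\<^sub>r\<close> needs \<open>r\<close> variables, so \<open>F\<close> only involves \<open>m\<^sub>\<lambda>\<close> with more than \<open>l\<close>
  parts, that is, \<open>\<lambda>\<close> below the hook \<open>\<mu>\<close>. The adjoint of multiplication by \<open>G\<^sub>s\<close> for the
  scalar product with parameter \<open>1/\<alpha>\<close> extracts the coefficient of \<open>x\<^sub>0\<^sup>s\<close>, and among these \<open>\<lambda>\<close> only
  \<open>\<mu>\<close> has a part of size at least \<open>n - l\<close>; hence \<open>F\<close> is orthogonal to every \<open>m\<^sub>\<lambda>\<close> with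
  \<open>\<lambda>\<close> strictly below \<open>\<mu>\<close>. The form is positive definite over the ordered field \<open>\<rat>(\<alpha>)\<close>, so \<open>F\<close> is a multiple of
  \<open>J\<^sub>\<mu>\<close>, and the coefficient of \<open>m\<close> at \<open>1\<^sup>n\<close> fixes the factor. The result is a product of
  constants and linear factors in \<open>\<alpha>\<close>, as are the two rook polynomials by the factorization theorem for Ferrers
  boards.
\<close>

section \<open>Symmetric functions and triangular bases\<close>

text \<open>Each product \<open>g_series a (n - r) * g_series (- 1) r\<close> with r \<le> l is by
  itself orthogonal to the space below the hook, so orthogonality leaves the weights free; n + (a -
  1) r = (n - r) + a r is the choice that comes from differentiating the two factors. Hooks are
  special because a partition of n is dominated by (n - l, 1^l) exactly when it has more than l
  parts, so that dominance becomes a count of variables. The brackets are defined through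
  \<open>representation\<close> in a basis, so nothing can be computed before independence and
  spanning are known. Both come from one notion of triangularity with an integer height; spanning is
  obtained by comparing cardinalities instead of inverting matrices. The linear order serves twice:
  it makes the form definite, and it excludes cancellation in the coefficients of products of power
  sums.\<close>

lemmas mps_coeff_simps = zero_mps.rep_eq one_mps.rep_eq plus_mps.rep_eq minus_mps.rep_eq
  uminus_mps.rep_eq mps_scale.rep_eq

lemma mps_coeff_Abs [simp]: "mps_coeff (Abs_mps f) = f"
  by (simp add: Abs_mps_inverse)

lemma mps_coeff_sum: "mps_coeff (sum f S) M = (\<Sum>i\<in>S. mps_coeff (f i) M)"
  by (induction S rule: infinite_finite_induct) (auto simp: mps_coeff_simps)

lemma mps_scale_mult_left: "mps_scale c f * g = mps_scale c (f * g)"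
  by (rule mps_eqI) (simp add: mps_coeff_simps times_mps.rep_eq sum_distrib_left mult.assoc)

lemma mps_scale_mult_right: "f * mps_scale c g = mps_scale c (f * g)"
  by (metis mps_scale_mult_left mult.commute)

definition partitions :: "nat \<Rightarrow> nat list set" where
  "partitions n = {\<nu>. is_partition \<nu> \<and> sum_list \<nu> = n}"

lemma length_le_sum_list: "0 \<notin> set \<nu> \<Longrightarrow> length \<nu> \<le> sum_list (\<nu> :: nat list)"
  by (induction \<nu>) auto

lemma finite_partitions: "finite (partitions n)"
proof (rule finite_subset)
  show "partitions n \<subseteq> {\<nu>. set \<nu> \<subseteq> {..n} \<and> length \<nu> \<le> n}"
    by (auto simp: partitions_def is_partition_def length_le_sum_list member_le_sum_list)
qed (simp add: finite_lists_length_le)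

lemma partition_mset_inj:
  assumes "is_partition \<nu>" "is_partition \<kappa>" "mset \<nu> = mset \<kappa>"
  shows "\<nu> = \<kappa>"
proof -
  have "sorted (rev \<nu>)" "sorted (rev \<kappa>)"
    using assms(1,2) by (auto simp: is_partition_def sorted_wrt_rev)
  then show ?thesis
    using assms(3) by (metis mset_rev properties_for_sort rev_rev_ident)
qed

lemma partition_of_mset:
  assumes "0 \<notin># A"
  obtains \<nu> where "is_partition \<nu>" "mset \<nu> = A"
proof
  show "is_partition (rev (sorted_list_of_multiset A))"
    using assms by (simp add: is_partition_def sorted_wrt_rev)
qed simp

section \<open>Monomials with weakly decreasing exponents\<close>

definition partition_monomial :: "nat list \<Rightarrow> nat multiset" where
  "partition_monomial \<nu> = (\<Sum>i<length \<nu>. replicate_mset (\<nu> ! i) i)"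

lemma count_partition_monomial:
  "count (partition_monomial \<nu>) i = (if i < length \<nu> then \<nu> ! i else 0)"
  by (simp add: partition_monomial_def count_sum if_distrib cong: if_cong)

lemma set_partition_monomial:
  "0 \<notin> set \<nu> \<Longrightarrow> set_mset (partition_monomial \<nu>) = {..<length \<nu>}"
  by (auto simp: set_eq_iff count_greater_zero_iff[symmetric] count_partition_monomial
      simp del: count_greater_zero_iff) (metis gr0I nth_mem)

lemma exponents_partition_monomial:
  assumes "0 \<notin> set \<nu>"
  shows "exponents (partition_monomial \<nu>) = mset \<nu>"
proof -
  have "exponents (partition_monomial \<nu>) = image_mset ((!) \<nu>) (mset_set {..<length \<nu>})"
    unfolding exponents_def set_partition_monomial[OF assms]
    by (intro image_mset_cong) (simp add: count_partition_monomial)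
  also have "\<dots> = mset (map ((!) \<nu>) [0..<length \<nu>])"
    by (simp add: lessThan_atLeast0)
  finally show ?thesis by (simp add: map_nth)
qed

lemma size_exponents: "sum_mset (exponents M) = size M"
  by (simp add: exponents_def size_multiset_overloaded_eq sum_unfold_sum_mset)

lemma exponents_image_mset:
  assumes "inj \<pi>"
  shows "exponents (image_mset \<pi> M) = exponents M"
proof -
  have "mset_set (\<pi> ` set_mset M) = image_mset \<pi> (mset_set (set_mset M))"
    by (rule image_mset_mset_set[symmetric]) (meson assms inj_on_subset subset_UNIV)
  moreover have "count (image_mset \<pi> M) (\<pi> x) = count M x" for x
    using assms by (induction M) (auto simp: inj_eq)
  ultimately show ?thesis
    by (simp add: exponents_def image_mset.compositionality comp_def)
qed

text \<open>Adjacent swaps suffice to sort the exponents of a monomial, and they are exactly the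
  symmetries that the Bender-Knuth involutions provide.\<close>

definition swap_invariant :: "'a mps \<Rightarrow> bool" where
  "swap_invariant f \<longleftrightarrow>
     (\<forall>i M. mps_coeff f (image_mset (transpose i (Suc i)) M) = mps_coeff f M)"

lemma antimono_multiset_partition:
  assumes "\<And>i. count M (Suc i) \<le> count M i"
  shows "\<exists>\<nu>. is_partition \<nu> \<and> partition_monomial \<nu> = M"
proof -
  have dec: "count M j \<le> count M i" if "i \<le> j" for i j
    using lift_Suc_antimono_le[of "count M"] assms that by blast
  \<comment> \<open>\<open>L\<close> is the number of parts: exponents decrease, so beyond the first
    missing variable they all vanish.\<close>
  define L where "L = (LEAST i. count M i = 0)"
  have "\<exists>i. count M i = 0"
    using ex_new_if_finite[of "set_mset M"] by (auto simp: not_in_iff)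
  then have L0: "count M L = 0" unfolding L_def by (rule LeastI_ex)
  have Lpos: "count M i > 0" if "i < L" for i
    using not_less_Least[of i "\<lambda>i. count M i = 0"] that by (auto simp: L_def)
  let ?\<nu> = "map (count M) [0..<L]"
  have "sorted_wrt (\<ge>) ?\<nu>" using dec by (simp add: sorted_wrt_iff_nth_less)
  moreover have "0 \<notin> set ?\<nu>" using Lpos less_not_refl2 by (fastforce simp del: count_greater_zero_iff)
  ultimately have "is_partition ?\<nu>" by (simp add: is_partition_def)
  moreover have "partition_monomial ?\<nu> = M"
  proof (rule multiset_eqI)
    fix i
    show "count (partition_monomial ?\<nu>) i = count M i"
      using dec[of L i] L0 by (auto simp: count_partition_monomial)
  qed
  ultimately show ?thesis by blast
qed

text \<open>Swapping adjacent variables until the exponents decrease lowers the sum of the indices.\<close>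

lemma sorted_monomial:
  "\<exists>\<nu>. is_partition \<nu> \<and> mset \<nu> = exponents M \<and>
     (\<forall>f :: 'a mps. swap_invariant f \<longrightarrow> mps_coeff f M = mps_coeff f (partition_monomial \<nu>))"
proof (induction "sum_mset M" arbitrary: M rule: less_induct)
  case less
  show ?case
  proof (cases "\<exists>i. count M i < count M (Suc i)")
    case True
    then obtain i where i: "count M i < count M (Suc i)" by blast
    define R where "R = filter_mset (\<lambda>x. x \<noteq> i \<and> x \<noteq> Suc i) M"
    let ?\<tau> = "transpose i (Suc i)"
    have M: "M = replicate_mset (count M i) i + replicate_mset (count M (Suc i)) (Suc i) + R"
      by (rule multiset_eqI) (simp add: R_def)
    have "image_mset ?\<tau> R = R"
      unfolding R_def by (rule trans[OF image_mset_cong[of _ _ id]]) (auto simp: transpose_def)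
    then have "image_mset ?\<tau> M =
        replicate_mset (count M i) (Suc i) + replicate_mset (count M (Suc i)) i + R"
      by (subst M) simp
    then have "sum_mset (image_mset ?\<tau> M) < sum_mset M"
      using i arg_cong[OF M, of sum_mset] by simp
    from less(1)[OF this] obtain \<nu> where \<nu>: "is_partition \<nu>"
      "mset \<nu> = exponents (image_mset ?\<tau> M)"
      "\<forall>f::'a mps. swap_invariant f \<longrightarrow> mps_coeff f (image_mset ?\<tau> M) = mps_coeff f (partition_monomial \<nu>)"
      by blast
    have "mset \<nu> = exponents M"
      using \<nu>(2) by (simp add: exponents_image_mset)
    moreover have "mps_coeff f (image_mset ?\<tau> M) = mps_coeff f M" if "swap_invariant f" for f :: "'a mps"
      using that by (simp add: swap_invariant_def)
    ultimately show ?thesis using \<nu> by auto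
  next
    case False
    then obtain \<nu> where "is_partition \<nu>" and M: "M = partition_monomial \<nu>"
      using antimono_multiset_partition[of M] by (auto simp: not_less)
    then show ?thesis
      by (auto intro!: exI[of _ \<nu>] simp: exponents_partition_monomial is_partition_def)
  qed
qed

definition sym_homog :: "nat \<Rightarrow> 'a::comm_ring_1 mps set" where
  "sym_homog n = {f. swap_invariant f \<and> (\<forall>M. mps_coeff f M \<noteq> 0 \<longrightarrow> size M = n)}"

lemma coeff_monomial_sym:
  "mps_coeff (monomial_sym \<nu>) M = (if exponents M = mset \<nu> then 1 else 0)"
  by (simp add: monomial_sym_def)

lemma coeff_monomial_sym_partition:
  assumes "is_partition \<nu>" "is_partition \<kappa>"
  shows "mps_coeff (monomial_sym \<nu>) (partition_monomial \<kappa>) = (if \<kappa> = \<nu> then 1 else 0)"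
  using assms partition_mset_inj[of \<kappa> \<nu>]
  by (auto simp: coeff_monomial_sym exponents_partition_monomial is_partition_def)

text \<open>A swap-invariant series is determined by its values at the partition monomials. The
  finite set \<open>S\<close> is left open so that homogeneous series and symmetric functions of
  bounded degree are both covered.\<close>

lemma swap_invariant_expansion:
  assumes "swap_invariant f" "finite S" "S \<subseteq> Collect is_partition"
    and "\<And>\<nu>. is_partition \<nu> \<Longrightarrow> mps_coeff f (partition_monomial \<nu>) \<noteq> 0 \<Longrightarrow> \<nu> \<in> S"
  shows "f = (\<Sum>\<nu>\<in>S. mps_scale (mps_coeff f (partition_monomial \<nu>)) (monomial_sym \<nu>))"
proof (rule mps_eqI)
  fix M
  obtain \<kappa> where \<kappa>: "is_partition \<kappa>" "mset \<kappa> = exponents M"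
    "mps_coeff f M = mps_coeff f (partition_monomial \<kappa>)"
    using sorted_monomial[of M] assms(1) by blast
  have "mps_coeff (\<Sum>\<nu>\<in>S. mps_scale (mps_coeff f (partition_monomial \<nu>)) (monomial_sym \<nu>)) M =
      (\<Sum>\<nu>\<in>S. if \<nu> = \<kappa> then mps_coeff f (partition_monomial \<kappa>) else 0)"
    using assms(3) \<kappa> partition_mset_inj
    by (auto simp: mps_coeff_sum mps_coeff_simps coeff_monomial_sym intro!: sum.cong)
  also have "\<dots> = mps_coeff f M"
    using assms(2) assms(4)[OF \<kappa>(1)] \<kappa>(3) by auto
  finally show "mps_coeff f M =
      mps_coeff (\<Sum>\<nu>\<in>S. mps_scale (mps_coeff f (partition_monomial \<nu>)) (monomial_sym \<nu>)) M" by simp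
qed

lemma size_partition_monomial: "0 \<notin> set \<nu> \<Longrightarrow> size (partition_monomial \<nu>) = sum_list \<nu>"
  by (metis exponents_partition_monomial size_exponents sum_mset_sum_list)

lemma sym_homog_expansion:
  assumes "f \<in> sym_homog n"
  shows "f = (\<Sum>\<nu>\<in>partitions n. mps_scale (mps_coeff f (partition_monomial \<nu>)) (monomial_sym \<nu>))"
proof (rule swap_invariant_expansion)
  show "\<nu> \<in> partitions n"
    if "is_partition \<nu>" "mps_coeff f (partition_monomial \<nu>) \<noteq> 0" for \<nu>
  proof -
    from that(1) have "0 \<notin> set \<nu>" by (simp add: is_partition_def)
    with that assms show ?thesis
      by (auto simp: sym_homog_def partitions_def size_partition_monomial)
  qed
  show "partitions n \<subseteq> Collect is_partition" by (auto simp: partitions_def)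
qed (use assms in \<open>auto simp: sym_homog_def finite_partitions\<close>)

lemma swap_invariant_lin:
  shows "swap_invariant f \<Longrightarrow> swap_invariant g \<Longrightarrow> swap_invariant (f + g)"
    and "swap_invariant f \<Longrightarrow> swap_invariant (mps_scale c f)"
  by (auto simp: swap_invariant_def mps_coeff_simps)

lemma sym_homog_subspace: "mps.subspace (sym_homog n :: 'a::field mps set)"
  unfolding mps.subspace_def
proof (intro conjI ballI allI)
  show "0 \<in> (sym_homog n :: 'a mps set)"
    by (simp add: sym_homog_def swap_invariant_def mps_coeff_simps)
  fix f :: "'a mps" and c :: 'a
  assume "f \<in> sym_homog n"
  then show "mps_scale c f \<in> sym_homog n"
    by (auto simp: sym_homog_def swap_invariant_lin mps_coeff_simps)
next
  fix f g :: "'a mps"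
  assume "f \<in> sym_homog n" "g \<in> sym_homog n"
  then show "f + g \<in> sym_homog n"
    unfolding sym_homog_def mem_Collect_eq
    by (metis add.right_neutral plus_mps.rep_eq swap_invariant_lin(1))
qed

text \<open>An integer height \<open>h\<close> stands in for a partial order, and the diagonal
  entries need only be nonzero. A constant height makes the family diagonal, as for monomial
  symmetric functions; Schur functions and power sums come with heights of their own.\<close>

definition triangular :: "(nat list \<Rightarrow> 'a::field mps) \<Rightarrow> (nat list \<Rightarrow> int) \<Rightarrow> bool" where
  "triangular b h \<longleftrightarrow> (\<forall>\<nu>. is_partition \<nu> \<longrightarrow>
     b \<nu> \<in> sym_homog (sum_list \<nu>) \<and> mps_coeff (b \<nu>) (partition_monomial \<nu>) \<noteq> 0 \<and>
     (\<forall>\<kappa>. is_partition \<kappa> \<longrightarrow> mps_coeff (b \<nu>) (partition_monomial \<kappa>) \<noteq> 0 \<longrightarrow> \<kappa> = \<nu> \<or> h \<kappa> < h \<nu>))"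

text \<open>Another member can reach the partition \<nu> only if its height is larger than that of
  \<nu>, and such members have coefficient 0 here.\<close>

lemma triangular_leading:
  assumes "triangular b h" "finite S" "S \<subseteq> Collect is_partition" "\<nu> \<in> S"
    and "\<And>\<kappa>. \<kappa> \<in> S \<Longrightarrow> x \<kappa> \<noteq> 0 \<Longrightarrow> h \<kappa> \<le> h \<nu>"
  shows "mps_coeff (\<Sum>\<kappa>\<in>S. mps_scale (x \<kappa>) (b \<kappa>)) (partition_monomial \<nu>) =
     x \<nu> * mps_coeff (b \<nu>) (partition_monomial \<nu>)"
proof -
  have "mps_coeff (\<Sum>\<kappa>\<in>S. mps_scale (x \<kappa>) (b \<kappa>)) (partition_monomial \<nu>) =
      (\<Sum>\<kappa>\<in>S. if \<kappa> = \<nu> then x \<nu> * mps_coeff (b \<nu>) (partition_monomial \<nu>) else 0)"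
    unfolding mps_coeff_sum mps_coeff_simps
  proof (rule sum.cong)
    fix \<kappa> assume \<kappa>: "\<kappa> \<in> S"
    show "x \<kappa> * mps_coeff (b \<kappa>) (partition_monomial \<nu>) =
        (if \<kappa> = \<nu> then x \<nu> * mps_coeff (b \<nu>) (partition_monomial \<nu>) else 0)"
    proof (cases "\<kappa> = \<nu>")
      case False
      have "is_partition \<kappa>" "is_partition \<nu>" using assms(3,4) \<kappa> by auto
      then have "mps_coeff (b \<kappa>) (partition_monomial \<nu>) \<noteq> 0 \<longrightarrow> h \<nu> < h \<kappa>"
        using assms(1) False by (auto simp: triangular_def)
      then show ?thesis using assms(5)[OF \<kappa>] False by (metis mult_eq_0_iff not_less)
    qed simp
  qed simp
  then show ?thesis using assms(2,4) by simp
qed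

text \<open>A nonzero coefficient of maximal height would survive as the leading coefficient of the
  vanishing sum.\<close>

lemma triangular_zero:
  assumes "triangular b h" "finite S" "S \<subseteq> Collect is_partition"
    and "(\<Sum>\<kappa>\<in>S. mps_scale (x \<kappa>) (b \<kappa>)) = 0" "\<nu> \<in> S"
  shows "x \<nu> = 0"
proof (rule ccontr)
  assume "x \<nu> \<noteq> 0"
  let ?T = "{\<kappa>\<in>S. x \<kappa> \<noteq> 0}"
  have "finite ?T" "?T \<noteq> {}" using assms \<open>x \<nu> \<noteq> 0\<close> by auto
  then have "Max (h ` ?T) \<in> h ` ?T" by (intro Max_in) auto
  then obtain \<kappa> where \<kappa>: "\<kappa> \<in> ?T" "h \<kappa> = Max (h ` ?T)" by auto
  have max: "h \<eta> \<le> h \<kappa>" if "\<eta> \<in> ?T" for \<eta>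
    unfolding \<kappa>(2) using \<open>finite ?T\<close> that by (intro Max_ge) auto
  have "x \<kappa> * mps_coeff (b \<kappa>) (partition_monomial \<kappa>) = 0"
    using triangular_leading[OF assms(1-3), of \<kappa> x] \<kappa>(1) max assms(4)
    by (simp add: mps_coeff_simps)
  then show False using \<kappa>(1) assms(1,3) by (auto simp: triangular_def)
qed

text \<open>\<open>basis_coeff\<close> reads coefficients at vectors, not at indices, so distinct
  partitions must give distinct vectors.\<close>

lemma triangular_inj:
  assumes "triangular b h"
  shows "inj_on b (Collect is_partition)"
proof (rule inj_onI, rule ccontr)
  fix \<nu> \<kappa> assume *: "\<nu> \<in> Collect is_partition" "\<kappa> \<in> Collect is_partition" "b \<nu> = b \<kappa>" "\<nu> \<noteq> \<kappa>"
  have "(\<Sum>\<eta>\<in>{\<nu>, \<kappa>}. mps_scale (if \<eta> = \<nu> then 1 else - 1) (b \<eta>)) = 0"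
    using *(3,4) by (intro mps_eqI) (simp add: mps_coeff_simps)
  from triangular_zero[OF assms _ _ this, of \<nu>] *(1,2) show False by simp
qed

lemma triangular_independent:
  assumes "triangular b h"
  shows "mps.independent (b ` Collect is_partition)"
  unfolding mps.dependent_explicit
proof safe
  fix T u v assume T: "finite T" "T \<subseteq> b ` Collect is_partition" "(\<Sum>v\<in>T. mps_scale (u v) v) = 0"
    "v \<in> T" "u v \<noteq> 0"
  define S where "S = {\<nu>. is_partition \<nu> \<and> b \<nu> \<in> T}"
  have S: "S \<subseteq> Collect is_partition" by (auto simp: S_def)
  then have inj: "inj_on b S" using triangular_inj[OF assms] by (rule inj_on_subset[rotated])
  have im: "b ` S = T" using T(2) unfolding S_def by blast
  have fin: "finite S" using inj im T(1) by (metis finite_imageD)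
  have "(\<Sum>\<nu>\<in>S. mps_scale (u (b \<nu>)) (b \<nu>)) = (\<Sum>v\<in>b ` S. mps_scale (u v) v)"
    by (simp add: sum.reindex[OF inj] comp_def)
  then have "(\<Sum>\<nu>\<in>S. mps_scale (u (b \<nu>)) (b \<nu>)) = 0" unfolding im T(3) .
  moreover obtain \<nu> where "\<nu> \<in> S" "v = b \<nu>" using T(4) im by (metis imageE)
  ultimately have "u v = 0"
    using triangular_zero[OF assms fin S, of "\<lambda>\<nu>. u (b \<nu>)" \<nu>] by simp
  then show False using T(5) by simp
qed

text \<open>The bridge from \<open>representation\<close> to explicit coefficients; both scalar
  products are evaluated through it.\<close>

lemma basis_coeff_sum:
  assumes "triangular b h" "finite S" "S \<subseteq> Collect is_partition" "is_partition \<nu>"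
  shows "basis_coeff b (\<Sum>\<kappa>\<in>S. mps_scale (x \<kappa>) (b \<kappa>)) \<nu> = (if \<nu> \<in> S then x \<nu> else 0)"
proof -
  let ?B = "b ` Collect is_partition"
  note ind = triangular_independent[OF assms(1)]
  have sp: "b \<kappa> \<in> mps.span ?B" if "\<kappa> \<in> S" for \<kappa>
    using that assms(3) by (auto intro: mps.span_base)
  have "basis_coeff b (\<Sum>\<kappa>\<in>S. mps_scale (x \<kappa>) (b \<kappa>)) \<nu> =
      (\<Sum>\<kappa>\<in>S. x \<kappa> * mps.representation ?B (b \<kappa>) (b \<nu>))"
    unfolding basis_coeff_def
    by (subst mps.representation_sum[OF ind])
       (auto simp: mps.representation_scale[OF ind] sp mps.span_scale intro!: sum.cong)
  also have "\<dots> = (\<Sum>\<kappa>\<in>S. if \<kappa> = \<nu> then x \<nu> else 0)"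
  proof (rule sum.cong)
    fix \<kappa> assume "\<kappa> \<in> S"
    then have "b \<kappa> \<in> ?B" using assms(3) by auto
    from mps.representation_basis[OF ind this]
    show "x \<kappa> * mps.representation ?B (b \<kappa>) (b \<nu>) = (if \<kappa> = \<nu> then x \<nu> else 0)"
      using inj_onD[OF triangular_inj[OF assms(1)], of \<nu> \<kappa>] assms(3,4) \<open>\<kappa> \<in> S\<close> by auto
  qed simp
  finally show ?thesis using assms(2) by simp
qed

text \<open>A vector of \<open>T\<close> outside the span of \<open>S\<close> would extend
  \<open>S\<close> to an independent set of more than \<open>card T\<close> vectors inside the span
  of \<open>T\<close>.\<close>

lemma (in vector_space) span_eq_of_card:
  assumes "finite T" "independent S" "S \<subseteq> span T" "card S = card T"
  shows "span S = span T"
proof -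
  have S: "finite S" using independent_span_bound[OF assms(1-3)] by simp
  have "t \<in> span S" if "t \<in> T" for t
  proof (rule ccontr)
    assume t: "t \<notin> span S"
    then have "independent (insert t S)" using assms(2) by (simp add: independent_insert)
    moreover have "insert t S \<subseteq> span T" using that assms(3) span_base by auto
    ultimately have "card (insert t S) \<le> card T"
      using independent_span_bound[OF assms(1)] by blast
    moreover have "t \<notin> S" using t span_base by blast
    ultimately show False using S assms(4) by simp
  qed
  then have "span T \<subseteq> span S" by (intro span_minimal) auto
  moreover have "span S \<subseteq> span T" using assms(3) by (intro span_minimal) auto
  ultimately show ?thesis by blast
qed

lemma triangular_monomial_sym: "triangular monomial_sym (\<lambda>_. 0)"
  unfolding triangular_def
proof (intro allI impI conjI)
  fix \<nu> assume \<nu>: "is_partition \<nu>"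
  show "monomial_sym \<nu> \<in> sym_homog (sum_list \<nu>)"
    by (auto simp: sym_homog_def swap_invariant_def coeff_monomial_sym exponents_image_mset
        size_exponents[symmetric] sum_mset_sum_list split: if_splits)
qed (auto simp: coeff_monomial_sym_partition split: if_splits)

text \<open>In degree n there are as many vectors \<open>b \<nu>\<close> as monomial symmetric
  functions, and they are independent, so they span the same space.\<close>

lemma triangular_span:
  assumes "triangular b h" "f \<in> sym_homog n"
  shows "\<exists>x. f = (\<Sum>\<nu>\<in>partitions n. mps_scale (x \<nu>) (b \<nu>))"
proof -
  let ?M = "monomial_sym ` partitions n :: 'a mps set" and ?B = "b ` partitions n"
  have sub: "partitions n \<subseteq> Collect is_partition" by (auto simp: partitions_def)
  have injM: "inj_on (monomial_sym :: _ \<Rightarrow> 'a mps) (partitions n)"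
    and injB: "inj_on b (partitions n)"
    using triangular_inj[OF triangular_monomial_sym] triangular_inj[OF assms(1)] sub
    by (auto intro: inj_on_subset)
  have spM: "g \<in> mps.span ?M" if "g \<in> sym_homog n" for g
    by (subst sym_homog_expansion[OF that])
       (intro mps.span_sum mps.span_scale mps.span_base imageI)
  have "mps.span ?B = mps.span ?M"
  proof (rule mps.span_eq_of_card)
    show "mps.independent ?B"
      using triangular_independent[OF assms(1)] sub by (meson image_mono mps.independent_mono)
    show "?B \<subseteq> mps.span ?M"
    proof safe
      fix \<nu> assume "\<nu> \<in> partitions n"
      then show "b \<nu> \<in> mps.span ?M"
        using assms(1) by (intro spM) (auto simp: triangular_def partitions_def)
    qed
    show "card ?B = card ?M" using injM injB by (simp add: card_image)
  qed (simp add: finite_partitions)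
  then have "f \<in> mps.span ?B" using spM assms(2) by simp
  then obtain u where "f = (\<Sum>v\<in>?B. mps_scale (u v) v)"
    by (auto simp: mps.span_finite finite_partitions)
  then have "f = (\<Sum>\<nu>\<in>partitions n. mps_scale (u (b \<nu>)) (b \<nu>))"
    using sum.reindex[OF injB, of "\<lambda>v. mps_scale (u v) v"] by (simp add: comp_def)
  then show ?thesis by (rule exI[of _ "\<lambda>\<nu>. u (b \<nu>)"])
qed

section \<open>Schur functions\<close>

text \<open>Rows beyond the last have length 0, so that the pattern inequalities can be stated for
  all row indices.\<close>

definition row_length :: "nat list \<Rightarrow> nat \<Rightarrow> nat" where
  "row_length \<nu> r = (if r < length \<nu> then \<nu> ! r else 0)"

lemma young_diagram_Sigma: "young_diagram \<nu> = (SIGMA r:{..<length \<nu>}. {..<row_length \<nu> r})"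
  by (auto simp: young_diagram_def row_length_def)

lemma mem_young_diagram: "(r, j) \<in> young_diagram \<nu> \<longleftrightarrow> j < row_length \<nu> r"
  by (auto simp: young_diagram_def row_length_def)

lemma finite_young_diagram: "finite (young_diagram \<nu>)"
  by (simp add: young_diagram_Sigma)

lemma row_length_antimono:
  assumes "is_partition \<nu>"
  shows "row_length \<nu> (Suc r) \<le> row_length \<nu> r"
  using assms by (auto simp: row_length_def is_partition_def sorted_wrt_iff_nth_less)

definition tableau_content :: "nat list \<Rightarrow> (nat \<times> nat \<Rightarrow> nat) \<Rightarrow> nat multiset" where
  "tableau_content \<nu> T = image_mset T (mset_set (young_diagram \<nu>))"

lemma coeff_schur: "mps_coeff (schur \<nu>) M = of_nat (card {T \<in> ssyt \<nu>. tableau_content \<nu> T = M})"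
  by (simp add: schur_def tableau_content_def)

text \<open>
  A semistandard tableau is encoded by its Gelfand-Tsetlin pattern: \<open>A k r\<close> is the number of
  entries smaller than \<open>k\<close> in row \<open>r\<close>.
\<close>

definition gt_pattern :: "nat list \<Rightarrow> (nat \<Rightarrow> nat \<Rightarrow> nat) \<Rightarrow> bool" where
  "gt_pattern \<nu> A \<longleftrightarrow> (\<forall>r. A 0 r = 0) \<and> (\<forall>k r. A k r \<le> A (Suc k) r) \<and>
     (\<forall>k r. A (Suc k) (Suc r) \<le> A k r) \<and> (\<exists>K. \<forall>k\<ge>K. A k = row_length \<nu>)"

definition pattern_of :: "nat list \<Rightarrow> (nat \<times> nat \<Rightarrow> nat) \<Rightarrow> nat \<Rightarrow> nat \<Rightarrow> nat" where
  "pattern_of \<nu> T k r = card {j. j < row_length \<nu> r \<and> T (r, j) < k}"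

text \<open>The entry of a cell in column j is at most k exactly when more than j entries of its row
  are smaller than k + 1; the least such k is the entry.\<close>

definition tableau_of :: "nat list \<Rightarrow> (nat \<Rightarrow> nat \<Rightarrow> nat) \<Rightarrow> nat \<times> nat \<Rightarrow> nat" where
  "tableau_of \<nu> A = restrict (\<lambda>(r, j). LEAST k. j < A (Suc k) r) (young_diagram \<nu>)"

lemma down_closed_eq_lessThan:
  assumes "finite S" "\<And>i j. j \<in> S \<Longrightarrow> i \<le> j \<Longrightarrow> i \<in> S"
  shows "S = {..<card (S :: nat set)}"
proof -
  define m where "m = (LEAST m. m \<notin> S)"
  have "\<exists>m. m \<notin> S" using assms(1) ex_new_if_finite infinite_UNIV_nat by blast
  then have "m \<notin> S" unfolding m_def by (rule LeastI_ex)
  then have "S \<subseteq> {..<m}" using assms(2) by (metis lessThan_iff not_less subsetI)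
  moreover have "{..<m} \<subseteq> S" unfolding m_def using not_less_Least by blast
  ultimately have "S = {..<m}" by blast
  then show ?thesis by simp
qed

lemma ssyt_row_mono:
  assumes "T \<in> ssyt \<nu>" "j < row_length \<nu> r" "i \<le> j"
  shows "T (r, i) \<le> T (r, j)"
  using assms(3,2)
proof (induction j rule: dec_induct)
  case (step m)
  then have "T (r, m) \<le> T (r, Suc m)"
    using assms(1) by (auto simp: ssyt_def mem_young_diagram)
  with step show ?case by simp
qed simp

text \<open>Rows increase weakly, so the entries smaller than k fill an initial segment of the
  row.\<close>

lemma pattern_of_less:
  assumes "T \<in> ssyt \<nu>" "j < row_length \<nu> r"
  shows "T (r, j) < k \<longleftrightarrow> j < pattern_of \<nu> T k r"
proof -
  have "{j. j < row_length \<nu> r \<and> T (r, j) < k} = {..<pattern_of \<nu> T k r}"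
    unfolding pattern_of_def
    by (rule down_closed_eq_lessThan) (use ssyt_row_mono[OF assms(1)] in \<open>auto intro: le_less_trans\<close>)
  with assms(2) show ?thesis by blast
qed

lemma pattern_of_le: "pattern_of \<nu> T k r \<le> row_length \<nu> r"
proof -
  have "pattern_of \<nu> T k r \<le> card {..<row_length \<nu> r}"
    unfolding pattern_of_def by (rule card_mono) auto
  then show ?thesis by simp
qed

lemma gt_pattern_of:
  assumes "is_partition \<nu>" "T \<in> ssyt \<nu>"
  shows "gt_pattern \<nu> (pattern_of \<nu> T)"
  unfolding gt_pattern_def
proof (intro conjI allI)
  show "pattern_of \<nu> T 0 r = 0" for r by (simp add: pattern_of_def)
  show "pattern_of \<nu> T k r \<le> pattern_of \<nu> T (Suc k) r" for k r
    unfolding pattern_of_def by (rule card_mono) auto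
  show "pattern_of \<nu> T (Suc k) (Suc r) \<le> pattern_of \<nu> T k r" for k r
  proof (rule ccontr)
    \<comment> \<open>In row r, column \<open>?j\<close> is the first one whose entry is not below
      k; strict increase down that column will contradict this.\<close>
    let ?j = "pattern_of \<nu> T k r"
    assume "\<not> ?thesis"
    then have j: "?j < pattern_of \<nu> T (Suc k) (Suc r)" by simp
    then have j1: "?j < row_length \<nu> (Suc r)" using pattern_of_le less_le_trans by blast
    then have j0: "?j < row_length \<nu> r" using row_length_antimono[OF assms(1)] less_le_trans by blast
    have "T (Suc r, ?j) < Suc k" using j pattern_of_less[OF assms(2) j1] by simp
    moreover have "T (r, ?j) < T (Suc r, ?j)"
      using assms(2) j1 by (simp add: ssyt_def mem_young_diagram)
    ultimately have "T (r, ?j) < k" by simp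
    then show False using pattern_of_less[OF assms(2) j0, of k] by simp
  qed
  \<comment> \<open>The extra 0 keeps \<open>Max\<close> defined for the empty diagram.\<close>
  let ?K = "Suc (Max (insert 0 (T ` young_diagram \<nu>)))"
  have "pattern_of \<nu> T k = row_length \<nu>" if "?K \<le> k" for k
  proof
    fix r
    have "T (r, j) < k" if "j < row_length \<nu> r" for j
    proof -
      have "T (r, j) \<le> Max (insert 0 (T ` young_diagram \<nu>))"
        using that by (intro Max_ge) (auto simp: finite_young_diagram mem_young_diagram)
      then show ?thesis using \<open>?K \<le> k\<close> by simp
    qed
    then have "{j. j < row_length \<nu> r \<and> T (r, j) < k} = {..<row_length \<nu> r}" by auto
    then show "pattern_of \<nu> T k r = row_length \<nu> r" by (simp add: pattern_of_def)
  qed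
  then show "\<exists>K. \<forall>k\<ge>K. pattern_of \<nu> T k = row_length \<nu>" by blast
qed

lemma pattern_of_inj:
  assumes "T \<in> ssyt \<nu>" "T' \<in> ssyt \<nu>" "pattern_of \<nu> T = pattern_of \<nu> T'"
  shows "T = T'"
proof (rule extensionalityI)
  show "T \<in> extensional (young_diagram \<nu>)" "T' \<in> extensional (young_diagram \<nu>)"
    using assms by (auto simp: ssyt_def)
  fix x assume "x \<in> young_diagram \<nu>"
  then obtain r j where x: "x = (r, j)" "j < row_length \<nu> r"
    by (cases x) (auto simp: mem_young_diagram)
  have "T (r, j) < k \<longleftrightarrow> T' (r, j) < k" for k
    using pattern_of_less[OF assms(1) x(2)] pattern_of_less[OF assms(2) x(2)] assms(3) by simp
  then show "T x = T' x" using x(1) by (meson linorder_neqE_nat less_irrefl)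
qed

lemma gt_pattern_mono:
  assumes "gt_pattern \<nu> A" "k \<le> k'"
  shows "A k r \<le> A k' r"
  using lift_Suc_mono_le[of "\<lambda>k. A k r" k k'] assms by (auto simp: gt_pattern_def)

lemma gt_pattern_le:
  assumes "gt_pattern \<nu> A"
  shows "A k r \<le> row_length \<nu> r"
proof -
  obtain K where "\<forall>k\<ge>K. A k = row_length \<nu>" using assms by (auto simp: gt_pattern_def)
  then have "A (max k K) r = row_length \<nu> r" by simp
  then show ?thesis using gt_pattern_mono[OF assms, of k "max k K" r] by simp
qed

lemma tableau_of_less:
  assumes "gt_pattern \<nu> A" "j < row_length \<nu> r"
  shows "tableau_of \<nu> A (r, j) < k \<longleftrightarrow> j < A k r"
proof -
  let ?t = "LEAST k. j < A (Suc k) r"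
  obtain K where "\<forall>k\<ge>K. A k = row_length \<nu>" using assms by (auto simp: gt_pattern_def)
  then have "j < A (Suc K) r" using assms(2) by simp
  then have t: "j < A (Suc ?t) r" by (rule LeastI)
  have "?t < k \<longleftrightarrow> j < A k r"
  proof
    assume "?t < k"
    then show "j < A k r" using t gt_pattern_mono[OF assms(1), of "Suc ?t" k r] by simp
  next
    assume *: "j < A k r"
    then obtain k' where k': "k = Suc k'" using assms(1) by (cases k) (auto simp: gt_pattern_def)
    then have "?t \<le> k'" using * by (intro Least_le) simp
    then show "?t < k" using k' by simp
  qed
  then show ?thesis using assms(2) by (simp add: tableau_of_def mem_young_diagram)
qed

lemma tableau_of_ssyt:
  assumes "is_partition \<nu>" "gt_pattern \<nu> A"
  shows "tableau_of \<nu> A \<in> ssyt \<nu>"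
proof -
  have "tableau_of \<nu> A (r, j) \<le> tableau_of \<nu> A (r, Suc j)" if "Suc j < row_length \<nu> r" for r j
  proof -
    have "Suc j < A (Suc (tableau_of \<nu> A (r, Suc j))) r"
      using tableau_of_less[OF assms(2) that] by blast
    then show ?thesis
      using tableau_of_less[OF assms(2), of j r "Suc (tableau_of \<nu> A (r, Suc j))"] that by simp
  qed
  moreover have "tableau_of \<nu> A (r, j) < tableau_of \<nu> A (Suc r, j)"
    if "j < row_length \<nu> (Suc r)" for r j
  proof -
    let ?k = "tableau_of \<nu> A (Suc r, j)"
    have "j < A (Suc ?k) (Suc r)"
      using tableau_of_less[OF assms(2) that] by blast
    also have "\<dots> \<le> A ?k r" using assms(2) by (simp add: gt_pattern_def)
    finally have "j < A ?k r" .
    moreover have "j < row_length \<nu> r"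
      using that row_length_antimono[OF assms(1), of r] by simp
    ultimately show ?thesis using tableau_of_less[OF assms(2)] by blast
  qed
  ultimately show ?thesis
    by (auto simp: ssyt_def mem_young_diagram) (auto simp: tableau_of_def)
qed

lemma pattern_of_tableau_of:
  assumes "gt_pattern \<nu> A"
  shows "pattern_of \<nu> (tableau_of \<nu> A) = A"
proof (intro ext)
  fix k r
  have "{j. j < row_length \<nu> r \<and> tableau_of \<nu> A (r, j) < k} = {..<A k r}"
    using tableau_of_less[OF assms] gt_pattern_le[OF assms, of k r] by auto
  then show "pattern_of \<nu> (tableau_of \<nu> A) k r = A k r" by (simp add: pattern_of_def)
qed

section \<open>The Bender-Knuth involution on patterns\<close>

definition toggle_low :: "nat \<Rightarrow> (nat \<Rightarrow> nat \<Rightarrow> nat) \<Rightarrow> nat \<Rightarrow> nat" where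
  "toggle_low i A r = max (A i r) (A (Suc (Suc i)) (Suc r))"

text \<open>Interlacing confines \<open>A (Suc i) r\<close> between \<open>toggle_low\<close> and
  this bound. Row 0 has no row above it, so there only the next pattern row bounds it.\<close>

definition toggle_high :: "nat \<Rightarrow> (nat \<Rightarrow> nat \<Rightarrow> nat) \<Rightarrow> nat \<Rightarrow> nat" where
  "toggle_high i A r = (case r of 0 \<Rightarrow> A (Suc (Suc i)) 0 | Suc q \<Rightarrow> min (A (Suc (Suc i)) r) (A i q))"

text \<open>
  The Bender-Knuth involution: each entry of the middle row of three consecutive rows of the pattern
  is reflected in the interval that its neighbours allow.
\<close>

definition toggle :: "nat \<Rightarrow> (nat \<Rightarrow> nat \<Rightarrow> nat) \<Rightarrow> nat \<Rightarrow> nat \<Rightarrow> nat" where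
  "toggle i A = A(Suc i := (\<lambda>r. toggle_low i A r + toggle_high i A r - A (Suc i) r))"

text \<open>These inequalities make the truncated subtraction in \<open>toggle\<close>
  exact.\<close>

lemma toggle_bounds:
  assumes "gt_pattern \<nu> A"
  shows "toggle_low i A r \<le> A (Suc i) r" "A (Suc i) r \<le> toggle_high i A r"
  using assms by (auto simp: gt_pattern_def toggle_low_def toggle_high_def split: nat.splits)

text \<open>Both bounds depend only on the pattern rows i and i + 2, which the toggle leaves alone,
  so the same reflection is applied twice.\<close>

lemma toggle_toggle:
  assumes "gt_pattern \<nu> A"
  shows "toggle i (toggle i A) = A"
proof -
  have "toggle_low i (toggle i A) = toggle_low i A" "toggle_high i (toggle i A) = toggle_high i A"
    by (auto simp: toggle_def toggle_low_def toggle_high_def fun_eq_iff split: nat.splits)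
  then have "toggle i (toggle i A) =
      A(Suc i := \<lambda>r. toggle_low i A r + toggle_high i A r -
        (toggle_low i A r + toggle_high i A r - A (Suc i) r))"
    by (simp add: toggle_def[of i "toggle i A"]) (simp add: toggle_def)
  also have "\<dots> = A"
    using toggle_bounds[OF assms, of i] by (auto simp: fun_eq_iff trans_le_add2)
  finally show ?thesis .
qed

lemma gt_pattern_toggle:
  assumes "gt_pattern \<nu> A"
  shows "gt_pattern \<nu> (toggle i A)"
proof -
  define B where "B r = toggle_low i A r + toggle_high i A r - A (Suc i) r" for r
  have B: "toggle_low i A r \<le> B r" "B r \<le> toggle_high i A r" for r
    using toggle_bounds[OF assms, of i r] by (auto simp: B_def)
  have t: "toggle i A = A(Suc i := B)" by (simp add: toggle_def B_def fun_eq_iff)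
  have B1: "A i r \<le> B r" "A (Suc (Suc i)) (Suc r) \<le> B r" for r
    using B(1)[of r] by (auto simp: toggle_low_def)
  have B2: "B (Suc r) \<le> A i r" for r
    using B(2)[of "Suc r"] by (simp add: toggle_high_def)
  have B3: "B r \<le> A (Suc (Suc i)) r" for r
    using B(2)[of r] by (auto simp: toggle_high_def split: nat.splits)
  obtain K where K: "\<forall>k\<ge>K. A k = row_length \<nu>" using assms by (auto simp: gt_pattern_def)
  show ?thesis
    unfolding gt_pattern_def t
  proof (intro conjI allI exI[of _ "max K (Suc (Suc i))"])
    show "(A(Suc i := B)) 0 r = 0" for r using assms by (simp add: gt_pattern_def)
    show "(A(Suc i := B)) k r \<le> (A(Suc i := B)) (Suc k) r" for k r
      using assms B1 B3 by (auto simp: gt_pattern_def)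
    show "(A(Suc i := B)) (Suc k) (Suc r) \<le> (A(Suc i := B)) k r" for k r
      using assms B1 B2 by (auto simp: gt_pattern_def)
  qed (use K in auto)
qed

text \<open>The lower bound in row r and the upper bound in row r + 1 are the maximum and the
  minimum of the same two numbers, so all bounds together add up to the two neighbouring pattern
  rows. This is why the toggle exchanges the numbers of entries i and i + 1.\<close>

lemma toggle_sum:
  assumes "gt_pattern \<nu> A"
  shows "(\<Sum>r<length \<nu>. toggle i A (Suc i) r) + (\<Sum>r<length \<nu>. A (Suc i) r) =
     (\<Sum>r<length \<nu>. A i r) + (\<Sum>r<length \<nu>. A (Suc (Suc i)) r)"
proof -
  have "(\<Sum>r<m. toggle_low i A r) + (\<Sum>r<Suc m. toggle_high i A r) =
      (\<Sum>r<m. A i r) + (\<Sum>r<Suc m. A (Suc (Suc i)) r)" for m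
  proof (induction m)
    case 0
    then show ?case by (simp add: toggle_high_def)
  next
    case (Suc m)
    have "toggle_low i A m + toggle_high i A (Suc m) = A i m + A (Suc (Suc i)) (Suc m)"
      by (simp add: toggle_low_def toggle_high_def)
    with Suc show ?case by simp
  qed
  from this[of "length \<nu>"]
  have *: "(\<Sum>r<length \<nu>. toggle_low i A r) + (\<Sum>r<length \<nu>. toggle_high i A r) +
        toggle_high i A (length \<nu>) =
      (\<Sum>r<length \<nu>. A i r) + (\<Sum>r<length \<nu>. A (Suc (Suc i)) r) + A (Suc (Suc i)) (length \<nu>)"
    by simp
  \<comment> \<open>Just below the diagram the pattern is 0, which disposes of the boundary terms of
    the shifted pairing.\<close>
  have z: "A k (length \<nu>) = 0" for k
    using gt_pattern_le[OF assms, of k "length \<nu>"] by (simp add: row_length_def)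
  have "toggle_high i A (length \<nu>) = 0"
    using z by (auto simp: toggle_high_def split: nat.splits)
  moreover have "(\<Sum>r<length \<nu>. toggle i A (Suc i) r) + (\<Sum>r<length \<nu>. A (Suc i) r) =
      (\<Sum>r<length \<nu>. toggle_low i A r + toggle_high i A r)"
    unfolding sum.distrib[symmetric]
    by (rule sum.cong) (use toggle_bounds[OF assms, of i] in \<open>auto simp: toggle_def trans_le_add2\<close>)
  ultimately show ?thesis using * z by (simp add: sum.distrib)
qed

lemma count_tableau_content: "count (tableau_content \<nu> T) k = card {x \<in> young_diagram \<nu>. T x = k}"
proof -
  have "count (image_mset T (mset_set D)) k = card {x \<in> D. T x = k}" if "finite D" for D
    using that
  proof induction
    case (insert x D)
    have "{y \<in> insert x D. T y = k} = (if T x = k then insert x else id) {y \<in> D. T y = k}" by auto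
    with insert show ?case by simp
  qed simp
  then show ?thesis by (simp add: tableau_content_def finite_young_diagram)
qed

lemma sum_pattern_of:
  "(\<Sum>r<length \<nu>. pattern_of \<nu> T k r) = card {x \<in> young_diagram \<nu>. T x < k}"
proof -
  have "{x \<in> young_diagram \<nu>. T x < k} =
      (SIGMA r:{..<length \<nu>}. {j. j < row_length \<nu> r \<and> T (r, j) < k})"
    by (auto simp: young_diagram_Sigma)
  then show ?thesis by (simp add: card_SigmaI pattern_of_def)
qed

lemma count_tableau_content_pattern:
  "(\<Sum>r<length \<nu>. pattern_of \<nu> T k r) + count (tableau_content \<nu> T) k =
   (\<Sum>r<length \<nu>. pattern_of \<nu> T (Suc k) r)"
proof -
  have "{x \<in> young_diagram \<nu>. T x < Suc k} =
      {x \<in> young_diagram \<nu>. T x < k} \<union> {x \<in> young_diagram \<nu>. T x = k}" by auto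
  then show ?thesis
    by (simp add: sum_pattern_of count_tableau_content card_Un_disjoint finite_young_diagram disjoint_iff)
qed

definition bender_knuth :: "nat list \<Rightarrow> nat \<Rightarrow> (nat \<times> nat \<Rightarrow> nat) \<Rightarrow> nat \<times> nat \<Rightarrow> nat" where
  "bender_knuth \<nu> i T = tableau_of \<nu> (toggle i (pattern_of \<nu> T))"

lemma bender_knuth:
  assumes "is_partition \<nu>" "T \<in> ssyt \<nu>"
  shows "bender_knuth \<nu> i T \<in> ssyt \<nu>" "bender_knuth \<nu> i (bender_knuth \<nu> i T) = T"
    and "tableau_content \<nu> (bender_knuth \<nu> i T) = image_mset (transpose i (Suc i)) (tableau_content \<nu> T)"
proof -
  let ?A = "pattern_of \<nu> T" and ?T = "bender_knuth \<nu> i T" and ?L = "{..<length \<nu>}"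
  note A = gt_pattern_of[OF assms]
  note B = gt_pattern_toggle[OF A, of i]
  show ssyt: "?T \<in> ssyt \<nu>"
    unfolding bender_knuth_def by (rule tableau_of_ssyt[OF assms(1) B])
  have pat: "pattern_of \<nu> ?T = toggle i ?A"
    unfolding bender_knuth_def by (rule pattern_of_tableau_of[OF B])
  show "bender_knuth \<nu> i ?T = T"
  proof (rule pattern_of_inj[OF _ assms(2)])
    show "bender_knuth \<nu> i ?T \<in> ssyt \<nu>"
      unfolding bender_knuth_def[of \<nu> i ?T] pat toggle_toggle[OF A]
      by (rule tableau_of_ssyt[OF assms(1) A])
    show "pattern_of \<nu> (bender_knuth \<nu> i ?T) = ?A"
      unfolding bender_knuth_def[of \<nu> i ?T] pat toggle_toggle[OF A]
      by (rule pattern_of_tableau_of[OF A])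
  qed
  \<comment> \<open>The multiplicity of k is the difference of the sums of the pattern rows k + 1
    and k, so only those of i and i + 1 can change.\<close>
  have other: "toggle i ?A k = ?A k" if "k \<noteq> Suc i" for k
    using that by (simp add: toggle_def)
  have "count (tableau_content \<nu> ?T) k = count (tableau_content \<nu> T) (transpose i (Suc i) k)" for k
  proof -
    note c = count_tableau_content_pattern[of \<nu> ?T k] count_tableau_content_pattern[of \<nu> T k]
    note c1 = count_tableau_content_pattern[of \<nu> T i] count_tableau_content_pattern[of \<nu> T "Suc i"]
      toggle_sum[OF A, of i]
    consider "k = i" | "k = Suc i" | "k \<noteq> i" "k \<noteq> Suc i" by blast
    then show ?thesis
    proof cases
      case 1
      then show ?thesis using c c1 other[of i] by (simp add: pat)
    next
      case 2
      then show ?thesis using c c1 other[of "Suc (Suc i)"] by (simp add: pat)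
    next
      case 3
      then show ?thesis using c other[of k] other[of "Suc k"] by (simp add: pat)
    qed
  qed
  moreover have "count (image_mset (transpose i (Suc i)) M) k = count M (transpose i (Suc i) k)" for M k
    by (induction M) (auto simp: transpose_def)
  ultimately show "tableau_content \<nu> ?T = image_mset (transpose i (Suc i)) (tableau_content \<nu> T)"
    by (intro multiset_eqI) simp
qed

lemma swap_invariant_schur:
  assumes "is_partition \<nu>"
  shows "swap_invariant (schur \<nu>)"
  unfolding swap_invariant_def
proof (intro allI)
  fix i M
  let ?\<tau> = "transpose i (Suc i)"
  have \<tau>: "image_mset ?\<tau> (image_mset ?\<tau> N) = N" for N
    by (simp add: image_mset.compositionality)
  have "bij_betw (bender_knuth \<nu> i) {T \<in> ssyt \<nu>. tableau_content \<nu> T = M}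
      {T \<in> ssyt \<nu>. tableau_content \<nu> T = image_mset ?\<tau> M}"
    by (rule bij_betw_byWitness[where f' = "bender_knuth \<nu> i"])
       (auto simp: bender_knuth[OF assms] \<tau>)
  then show "mps_coeff (schur \<nu>) (image_mset ?\<tau> M) = mps_coeff (schur \<nu>) M"
    by (simp add: coeff_schur bij_betw_same_card)
qed

section \<open>The leading monomial of a Schur function\<close>

lemma ssyt_ge_row:
  assumes "is_partition \<nu>" "T \<in> ssyt \<nu>" "j < row_length \<nu> r"
  shows "r \<le> T (r, j)"
  using assms(3)
proof (induction r)
  case (Suc r)
  then have "T (r, j) < T (Suc r, j)"
    using assms(2) by (auto simp: ssyt_def mem_young_diagram)
  moreover have "r \<le> T (r, j)"
    using Suc row_length_antimono[OF assms(1), of r] by simp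
  ultimately show ?case by simp
qed simp

text \<open>The pointwise smallest semistandard tableau; its content is the leading
  monomial.\<close>

definition row_tableau :: "nat list \<Rightarrow> nat \<times> nat \<Rightarrow> nat" where
  "row_tableau \<nu> = restrict fst (young_diagram \<nu>)"

lemma row_tableau_ssyt:
  assumes "is_partition \<nu>"
  shows "row_tableau \<nu> \<in> ssyt \<nu>"
proof -
  have "j < row_length \<nu> r" if "j < row_length \<nu> (Suc r)" for r j
    using that row_length_antimono[OF assms, of r] by simp
  then show ?thesis by (simp add: ssyt_def row_tableau_def mem_young_diagram)
qed

lemma tableau_content_row_tableau: "tableau_content \<nu> (row_tableau \<nu>) = partition_monomial \<nu>"
proof (rule multiset_eqI)
  fix k
  have "{x \<in> young_diagram \<nu>. row_tableau \<nu> x = k} = Pair k ` {..<row_length \<nu> k}"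
    by (auto simp: row_tableau_def mem_young_diagram)
  then show "count (tableau_content \<nu> (row_tableau \<nu>)) k = count (partition_monomial \<nu>) k"
    by (simp add: count_tableau_content card_image inj_on_def count_partition_monomial row_length_def)
qed

lemma sum_mset_tableau_content: "sum_mset (tableau_content \<nu> T) = (\<Sum>x\<in>young_diagram \<nu>. T x)"
  by (simp add: tableau_content_def sum_unfold_sum_mset)

text \<open>Every tableau lies pointwise above the row tableau, so the sum of the entries alone can
  play the part of the dominance order.\<close>

lemma tableau_content_sum_mset:
  assumes "is_partition \<nu>" "T \<in> ssyt \<nu>"
  shows "T = row_tableau \<nu> \<or> sum_mset (partition_monomial \<nu>) < sum_mset (tableau_content \<nu> T)"
proof -
  have le: "row_tableau \<nu> x \<le> T x" if "x \<in> young_diagram \<nu>" for x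
    using that ssyt_ge_row[OF assms] by (cases x) (auto simp: row_tableau_def mem_young_diagram)
  show ?thesis
  proof (cases "\<exists>x\<in>young_diagram \<nu>. row_tableau \<nu> x \<noteq> T x")
    case True
    then obtain x where "x \<in> young_diagram \<nu>" "row_tableau \<nu> x < T x"
      using le by (metis le_neq_implies_less)
    then have "(\<Sum>x\<in>young_diagram \<nu>. row_tableau \<nu> x) < (\<Sum>x\<in>young_diagram \<nu>. T x)"
      using le by (intro sum_strict_mono_ex1) (auto simp: finite_young_diagram)
    then show ?thesis by (simp flip: sum_mset_tableau_content tableau_content_row_tableau)
  next
    case False
    then have "T = row_tableau \<nu>"
      using assms(2) row_tableau_ssyt[OF assms(1)]
      by (intro extensionalityI[of _ "young_diagram \<nu>"]) (auto simp: ssyt_def)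
    then show ?thesis by simp
  qed
qed

lemma partition_monomial_inj:
  assumes "is_partition \<nu>" "is_partition \<kappa>" "partition_monomial \<nu> = partition_monomial \<kappa>"
  shows "\<nu> = \<kappa>"
  using assms by (metis exponents_partition_monomial is_partition_def partition_mset_inj)

lemma coeff_schur_diagonal:
  assumes \<nu>: "is_partition \<nu>"
  shows "mps_coeff (schur \<nu>) (partition_monomial \<nu>) = 1"
proof -
  have "{T \<in> ssyt \<nu>. tableau_content \<nu> T = partition_monomial \<nu>} = {row_tableau \<nu>}"
    using tableau_content_sum_mset[OF \<nu>] row_tableau_ssyt[OF \<nu>]
    by (fastforce simp: tableau_content_row_tableau)
  then show ?thesis by (simp add: coeff_schur)
qed

text \<open>The other partition monomials of a Schur function have a larger sum of indices, hence
  the minus sign in the height.\<close>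

lemma triangular_schur:
  "triangular (schur :: nat list \<Rightarrow> 'a::field mps) (\<lambda>\<nu>. - int (sum_mset (partition_monomial \<nu>)))"
  unfolding triangular_def
proof (intro allI impI conjI)
  fix \<nu> assume \<nu>: "is_partition \<nu>"
  have nonempty: "\<exists>T \<in> ssyt \<nu>. tableau_content \<nu> T = M" if "mps_coeff (schur \<nu> :: 'a mps) M \<noteq> 0" for M
  proof (rule ccontr)
    assume "\<not> ?thesis"
    then have "{T \<in> ssyt \<nu>. tableau_content \<nu> T = M} = {}" by blast
    with that show False unfolding coeff_schur by (metis card.empty of_nat_0)
  qed
  have "size (tableau_content \<nu> T) = sum_list \<nu>" for T
  proof -
    have "size (tableau_content \<nu> T) = size (tableau_content \<nu> (row_tableau \<nu>))" by (simp add: tableau_content_def)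
    also have "\<dots> = sum_list \<nu>"
      using \<nu> by (simp add: tableau_content_row_tableau size_partition_monomial is_partition_def)
    finally show ?thesis .
  qed
  then show "(schur \<nu> :: 'a mps) \<in> sym_homog (sum_list \<nu>)"
    using swap_invariant_schur[OF \<nu>] nonempty by (fastforce simp: sym_homog_def)
  show "mps_coeff (schur \<nu> :: 'a mps) (partition_monomial \<nu>) \<noteq> 0"
    by (simp add: coeff_schur_diagonal[OF \<nu>])
  fix \<kappa> assume \<kappa>: "is_partition \<kappa>" "mps_coeff (schur \<nu> :: 'a mps) (partition_monomial \<kappa>) \<noteq> 0"
  from nonempty[OF \<kappa>(2)] obtain T where "T \<in> ssyt \<nu>" "tableau_content \<nu> T = partition_monomial \<kappa>" by blast
  then have "\<kappa> = \<nu> \<or> sum_mset (partition_monomial \<nu>) < sum_mset (partition_monomial \<kappa>)"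
    using tableau_content_sum_mset[OF \<nu>, of T] partition_monomial_inj[OF \<nu> \<kappa>(1)]
      tableau_content_row_tableau by auto
  then show "\<kappa> = \<nu> \<or> - int (sum_mset (partition_monomial \<kappa>)) < - int (sum_mset (partition_monomial \<nu>))"
    unfolding neg_less_iff_less of_nat_less_iff .
qed

section \<open>Power sums\<close>

text \<open>Indexing by multisets instead of sorted lists lets parts be added and removed
  freely.\<close>

definition power_prod :: "nat multiset \<Rightarrow> 'a::comm_ring_1 mps" where
  "power_prod A = prod_mset (image_mset power_sum A)"

lemma power_prod_simps [simp]:
  "power_prod {#} = 1"
  "power_prod (add_mset k A) = power_sum k * power_prod A"
  by (simp_all add: power_prod_def)

lemma power_prod_union: "power_prod (A + B) = power_prod A * power_prod B"
  by (simp add: power_prod_def)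

lemma power_sum_sym_power_prod: "power_sum_sym \<nu> = power_prod (mset \<nu>)"
  by (induction \<nu>) (auto simp: power_sum_sym_def)

lemma finite_count_ge: "k > 0 \<Longrightarrow> finite {i. k \<le> count M i}"
  by (rule finite_subset[of _ "set_mset M"]) (auto intro: count_inI)

lemma coeff_power_sum_mult:
  assumes "k > 0"
  shows "mps_coeff (power_sum k * f) M =
    (\<Sum>i | k \<le> count M i. mps_coeff f (M - replicate_mset k i))"
proof -
  \<comment> \<open>For k = 0 these monomials would all be empty; positivity makes the variable
    recoverable.\<close>
  have inj: "inj_on (replicate_mset k) {i. k \<le> count M i}"
    using assms by (auto simp: inj_on_def replicate_mset_eq_iff)
  have "mps_coeff (power_sum k * f) M =
      (\<Sum>N | N \<subseteq># M. if \<exists>i. N = replicate_mset k i then mps_coeff f (M - N) else 0)"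
    unfolding times_mps.rep_eq power_sum_def mps_coeff_Abs by (intro sum.cong refl) simp
  also have "\<dots> = (\<Sum>N\<in>replicate_mset k ` {i. k \<le> count M i}. mps_coeff f (M - N))"
  proof (rule sum.mono_neutral_cong_right[OF finite_submultisets])
    show "replicate_mset k ` {i. k \<le> count M i} \<subseteq> {N. N \<subseteq># M}"
      by (auto simp: subseteq_mset_def)
    show "\<forall>N\<in>{N. N \<subseteq># M} - replicate_mset k ` {i. k \<le> count M i}.
        (if \<exists>i. N = replicate_mset k i then mps_coeff f (M - N) else 0) = 0"
    proof (intro ballI if_not_P notI)
      fix N assume N: "N \<in> {N. N \<subseteq># M} - replicate_mset k ` {i. k \<le> count M i}"
        "\<exists>i. N = replicate_mset k i"
      then obtain i where i: "N = replicate_mset k i" by blast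
      with N have "count N i \<le> count M i" unfolding subseteq_mset_def by blast
      with N i show False by simp
    qed
  qed auto
  also have "\<dots> = (\<Sum>i | k \<le> count M i. mps_coeff f (M - replicate_mset k i))"
    by (simp add: sum.reindex[OF inj])
  finally show ?thesis .
qed

text \<open>A swap of variables merely permutes the variable that supplies the k-th power.\<close>

lemma power_sum_mult_sym_homog:
  assumes "k > 0" "f \<in> sym_homog n"
  shows "power_sum k * f \<in> sym_homog (n + k)"
  unfolding sym_homog_def swap_invariant_def mem_Collect_eq
proof (intro conjI allI impI)
  fix i M
  let ?\<tau> = "transpose i (Suc i)"
  have cnt: "count (image_mset ?\<tau> M) j = count M (?\<tau> j)" for M j
    by (induction M) (auto simp: transpose_def)
  have diff: "image_mset ?\<tau> M - replicate_mset k (?\<tau> j) = image_mset ?\<tau> (M - replicate_mset k j)" for j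
    by (rule multiset_eqI) (auto simp: cnt transpose_def)
  show "mps_coeff (power_sum k * f) (image_mset ?\<tau> M) = mps_coeff (power_sum k * f) M"
    unfolding coeff_power_sum_mult[OF assms(1)]
  proof (rule sum.reindex_bij_witness[of _ ?\<tau> ?\<tau>])
    fix j assume "j \<in> {j. k \<le> count (image_mset ?\<tau> M) j}"
    show "mps_coeff f (M - replicate_mset k (?\<tau> j)) =
        mps_coeff f (image_mset ?\<tau> M - replicate_mset k j)"
      using diff[of "?\<tau> j"] assms(2) unfolding sym_homog_def swap_invariant_def by simp
  qed (auto simp: cnt)
next
  fix M assume "mps_coeff (power_sum k * f) M \<noteq> 0"
  then obtain i where i: "k \<le> count M i" "mps_coeff f (M - replicate_mset k i) \<noteq> 0"
    unfolding coeff_power_sum_mult[OF assms(1)]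
    by (auto elim: sum.not_neutral_contains_not_neutral)
  then have "size (M - replicate_mset k i) = n" using assms(2) by (simp add: sym_homog_def)
  moreover have "replicate_mset k i \<subseteq># M" using i(1) by (simp add: subseteq_mset_def)
  moreover have "k \<le> size M" by (rule order_trans[OF i(1) count_le_size])
  ultimately show "size M = n + k" by (simp add: size_Diff_submset)
qed

lemma one_sym_homog: "1 \<in> sym_homog 0"
  by (auto simp: sym_homog_def swap_invariant_def one_mps.rep_eq split: if_splits)

lemma power_prod_sym_homog:
  "0 \<notin># A \<Longrightarrow> power_prod A \<in> sym_homog (sum_mset A)"
proof (induction A)
  case (add k A)
  then show ?case
    using power_sum_mult_sym_homog[of k "power_prod A" "sum_mset A"] by (simp add: add.commute[of k])
qed (simp add: one_sym_homog)

lemma exponents_replicate: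
  assumes "k > 0" "i \<notin># M"
  shows "exponents (M + replicate_mset k i) = add_mset k (exponents M)"
proof -
  have "set_mset (M + replicate_mset k i) = insert i (set_mset M)" using assms by auto
  moreover have "image_mset (count (M + replicate_mset k i)) (mset_set (set_mset M)) =
      image_mset (count M) (mset_set (set_mset M))"
    using assms(2) by (intro image_mset_cong) auto
  moreover have "count (M + replicate_mset k i) i = k" using assms(2) by (simp add: not_in_iff)
  ultimately show ?thesis using assms(2) unfolding exponents_def by simp
qed

lemma size_exponents_card: "size (exponents M) = card (set_mset M)"
  by (simp add: exponents_def)

lemma coeff_power_prod_nonneg:
  "0 \<notin># A \<Longrightarrow> mps_coeff (power_prod A :: 'a::linordered_field mps) M \<ge> 0"
  by (induction A arbitrary: M) (auto simp: one_mps.rep_eq coeff_power_sum_mult intro!: sum_nonneg)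

text \<open>One variable of exponent k supplies the factor \<open>power_sum k\<close>, and induction
  covers the rest. All other contributions are nonnegative, so nothing cancels.\<close>

lemma coeff_power_prod_pos:
  "0 \<notin># A \<Longrightarrow> exponents M = A \<Longrightarrow> mps_coeff (power_prod A :: 'a::linordered_field mps) M > 0"
proof (induction A arbitrary: M)
  case empty
  then have "size M = 0" using size_exponents[of M] by simp
  then show ?case by (simp add: one_mps.rep_eq)
next
  case (add k A)
  then have k: "k > 0" and A: "0 \<notin># A" by auto
  have "k \<in># exponents M" using add.prems(2) by simp
  then obtain i where i: "count M i = k" by (auto simp: exponents_def)
  let ?M = "M - replicate_mset k i"
  have M: "?M + replicate_mset k i = M" using i by (intro multiset_eqI) auto
  moreover have "i \<notin># ?M" using i by (simp add: not_in_iff)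
  ultimately have "exponents M = add_mset k (exponents ?M)" using exponents_replicate[OF k] by metis
  then have "exponents ?M = A" using add.prems(2) by simp
  then have "mps_coeff (power_prod A :: 'a mps) ?M > 0" using add.IH A by blast
  then have "(\<Sum>i | k \<le> count M i. mps_coeff (power_prod A :: 'a mps) (M - replicate_mset k i)) > 0"
    using i finite_count_ge[OF k] coeff_power_prod_nonneg[OF A] by (intro sum_pos2[of _ i]) auto
  then show ?case by (simp add: coeff_power_sum_mult[OF k])
qed

text \<open>Each factor brings in at most one new variable. With as many variables as factors, every
  factor has a variable of its own, and the exponents are the parts.\<close>

lemma coeff_power_prod_nonzero:
  "0 \<notin># A \<Longrightarrow> mps_coeff (power_prod A :: 'a::comm_ring_1 mps) M \<noteq> 0 \<Longrightarrow> exponents M = A \<or> card (set_mset M) < size A"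
proof (induction A arbitrary: M)
  case empty
  then show ?case by (auto simp: one_mps.rep_eq exponents_def split: if_splits)
next
  case (add k A)
  then have k: "k > 0" and A: "0 \<notin># A" by auto
  have "(\<Sum>i | k \<le> count M i. mps_coeff (power_prod A :: 'a mps) (M - replicate_mset k i)) \<noteq> 0"
    using add.prems(2) by (simp add: coeff_power_sum_mult[OF k])
  then obtain i where i: "k \<le> count M i" "mps_coeff (power_prod A :: 'a mps) (M - replicate_mset k i) \<noteq> 0"
    by (auto elim: sum.not_neutral_contains_not_neutral)
  let ?M = "M - replicate_mset k i"
  have M: "?M + replicate_mset k i = M" using i(1) by (intro multiset_eqI) auto
  have set: "set_mset M = insert i (set_mset ?M)"
    using k arg_cong[OF M, of set_mset] by auto
  have IH: "exponents ?M = A \<or> card (set_mset ?M) < size A" using add.IH A i(2) by blast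
  show ?case
  proof (cases "i \<in># ?M")
    case True
    then have "card (set_mset M) = card (set_mset ?M)" using set by (simp add: insert_absorb)
    then show ?thesis using IH size_exponents_card[of ?M] by auto
  next
    case False
    then have "card (set_mset M) = Suc (card (set_mset ?M))" using set by simp
    moreover have "exponents M = add_mset k (exponents ?M)"
      using exponents_replicate[OF k False] M by simp
    ultimately show ?thesis using IH by auto
  qed
qed

lemma triangular_power_sum_sym:
  "triangular (power_sum_sym :: nat list \<Rightarrow> 'a::linordered_field mps) (\<lambda>\<nu>. int (length \<nu>))"
  unfolding triangular_def power_sum_sym_power_prod
proof (intro allI impI conjI)
  fix \<nu> assume "is_partition \<nu>"
  then have \<nu>: "0 \<notin># mset \<nu>" "is_partition \<nu>" by (auto simp: is_partition_def)
  show "power_prod (mset \<nu>) \<in> sym_homog (sum_list \<nu>)"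
    using power_prod_sym_homog[OF \<nu>(1)] by (simp add: sum_mset_sum_list)
  have "exponents (partition_monomial \<nu>) = mset \<nu>"
    using \<nu> by (simp add: exponents_partition_monomial)
  from coeff_power_prod_pos[OF \<nu>(1) this]
  show "mps_coeff (power_prod (mset \<nu>) :: 'a mps) (partition_monomial \<nu>) \<noteq> 0" by (metis less_irrefl)
  fix \<kappa> assume \<kappa>: "is_partition \<kappa>" "mps_coeff (power_prod (mset \<nu>) :: 'a mps) (partition_monomial \<kappa>) \<noteq> 0"
  then have "0 \<notin> set \<kappa>" by (simp add: is_partition_def)
  then have "exponents (partition_monomial \<kappa>) = mset \<kappa>" "card (set_mset (partition_monomial \<kappa>)) = length \<kappa>"
    by (simp_all add: exponents_partition_monomial set_partition_monomial)
  then show "\<kappa> = \<nu> \<or> int (length \<kappa>) < int (length \<nu>)"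
    using coeff_power_prod_nonzero[OF \<nu>(1) \<kappa>(2)] partition_mset_inj[OF \<kappa>(1) \<nu>(2)] by auto
qed

section \<open>Expansions in power sums indexed by multisets\<close>

definition mpartitions :: "nat \<Rightarrow> nat multiset set" where
  "mpartitions n = {A. 0 \<notin># A \<and> sum_mset A = n}"

lemma bij_betw_mset_partitions: "bij_betw mset (partitions n) (mpartitions n)"
  unfolding bij_betw_def
proof
  show "inj_on mset (partitions n)"
    by (auto simp: inj_on_def partitions_def intro: partition_mset_inj)
  show "mset ` partitions n = mpartitions n"
  proof (intro equalityI subsetI)
    fix A assume "A \<in> mpartitions n"
    moreover from this obtain \<nu> where "is_partition \<nu>" "mset \<nu> = A"
      using partition_of_mset[of A] by (auto simp: mpartitions_def)
    ultimately show "A \<in> mset ` partitions n"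
      by (auto simp: mpartitions_def partitions_def sum_mset_sum_list image_iff)
  qed (auto simp: mpartitions_def partitions_def is_partition_def sum_mset_sum_list)
qed

lemma finite_mpartitions: "finite (mpartitions n)"
  using bij_betw_finite[OF bij_betw_mset_partitions] finite_partitions by blast

lemma sum_mpartitions:
  "(\<Sum>A\<in>mpartitions n. mps_scale (x A) (power_prod A)) =
   (\<Sum>\<nu>\<in>partitions n. mps_scale (x (mset \<nu>)) (power_sum_sym \<nu>))"
  by (simp add: power_sum_sym_power_prod sum.reindex_bij_betw[OF bij_betw_mset_partitions, symmetric])

lemma partitions_is_partition: "partitions n \<subseteq> Collect is_partition"
  by (auto simp: partitions_def)

lemma power_prod_independent:
  assumes "(\<Sum>A\<in>mpartitions n. mps_scale (x A) (power_prod A)) = (0 :: 'a::linordered_field mps)"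
    and "A \<in> mpartitions n"
  shows "x A = 0"
proof -
  obtain \<nu> where "\<nu> \<in> partitions n" "A = mset \<nu>"
    using assms(2) bij_betw_mset_partitions by (auto simp: bij_betw_def)
  then show ?thesis
    using triangular_zero[OF triangular_power_sum_sym finite_partitions partitions_is_partition
        assms(1)[unfolded sum_mpartitions]] by simp
qed

lemma power_prod_span:
  assumes "(f :: 'a::linordered_field mps) \<in> sym_homog n"
  shows "\<exists>x. f = (\<Sum>A\<in>mpartitions n. mps_scale (x A) (power_prod A))"
proof -
  obtain y where y: "f = (\<Sum>\<nu>\<in>partitions n. mps_scale (y \<nu>) (power_sum_sym \<nu>))"
    using triangular_span[OF triangular_power_sum_sym assms] by blast
  define x where "x A = y (the_inv_into (partitions n) mset A)" for A
  have "x (mset \<nu>) = y \<nu>" if "\<nu> \<in> partitions n" for \<nu>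
    using that bij_betw_mset_partitions[of n] by (simp add: x_def bij_betw_def the_inv_into_f_f)
  then have "f = (\<Sum>A\<in>mpartitions n. mps_scale (x A) (power_prod A))"
    unfolding y sum_mpartitions by (intro sum.cong) auto
  then show ?thesis by blast
qed

definition z_mset :: "nat multiset \<Rightarrow> nat" where
  "z_mset A = (\<Prod>i\<in>set_mset A. i ^ count A i * fact (count A i))"

lemma z_part_mset: "z_part \<nu> = z_mset (mset \<nu>)"
  by (simp add: z_part_def z_mset_def count_mset)

lemma z_mset_pos: "0 \<notin># A \<Longrightarrow> z_mset A > 0"
  unfolding z_mset_def by (intro prod_pos) (metis fact_gt_zero gr0I nat_0_less_mult_iff zero_less_power)

lemma z_mset_add: "z_mset (add_mset j A) = j * Suc (count A j) * z_mset A"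
proof -
  let ?f = "\<lambda>i c. i ^ c * fact c :: nat"
  have "z_mset (add_mset j A) =
      ?f j (Suc (count A j)) * (\<Prod>i\<in>set_mset A - {j}. ?f i (count (add_mset j A) i))"
    unfolding z_mset_def by (subst set_mset_add_mset_insert, subst prod.insert_remove) simp_all
  also have "(\<Prod>i\<in>set_mset A - {j}. ?f i (count (add_mset j A) i)) = (\<Prod>i\<in>set_mset A - {j}. ?f i (count A i))"
    by (rule prod.cong) auto
  also have "z_mset A = ?f j (count A j) * (\<Prod>i\<in>set_mset A - {j}. ?f i (count A i))"
  proof (cases "j \<in># A")
    case True
    then show ?thesis unfolding z_mset_def by (subst prod.remove[of _ j]) simp_all
  next
    case False
    then show ?thesis by (simp add: z_mset_def not_in_iff)
  qed
  ultimately show ?thesis by (simp add: algebra_simps)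
qed

lemma jack_inner_sum:
  fixes \<beta> :: "'a::linordered_field"
  shows "jack_inner \<beta> (\<Sum>A\<in>mpartitions n. mps_scale (x A) (power_prod A))
      (\<Sum>A\<in>mpartitions n. mps_scale (y A) (power_prod A)) =
    (\<Sum>A\<in>mpartitions n. x A * y A * (of_nat (z_mset A) * \<beta> ^ size A))"
proof -
  note coeff = basis_coeff_sum[OF triangular_power_sum_sym finite_partitions partitions_is_partition]
  let ?C = "\<lambda>x :: nat multiset \<Rightarrow> 'a. basis_coeff power_sum_sym (\<Sum>\<nu>\<in>partitions n. mps_scale (x (mset \<nu>)) (power_sum_sym \<nu>))"
  have "jack_inner \<beta> (\<Sum>A\<in>mpartitions n. mps_scale (x A) (power_prod A))
      (\<Sum>A\<in>mpartitions n. mps_scale (y A) (power_prod A)) =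
    (\<Sum>\<nu> | is_partition \<nu> \<and> ?C x \<nu> \<noteq> 0. ?C x \<nu> * ?C y \<nu> * (of_nat (z_part \<nu>) * \<beta> ^ length \<nu>))"
    unfolding jack_inner_def orthogonal_form_def sum_mpartitions ..
  also have "\<dots> = (\<Sum>\<nu>\<in>partitions n. x (mset \<nu>) * y (mset \<nu>) * (of_nat (z_part \<nu>) * \<beta> ^ length \<nu>))"
  \<comment> \<open>\<open>orthogonal_form\<close> sums only over the partitions where the first
    coefficient is nonzero; the other partitions of n contribute 0.\<close>
  proof (rule sum.mono_neutral_cong_left[OF finite_partitions])
    have C: "?C x \<nu> = (if \<nu> \<in> partitions n then x (mset \<nu>) else 0)" if "is_partition \<nu>"
      for \<nu> and x :: "nat multiset \<Rightarrow> 'a"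
      by (rule coeff[OF that])
    have part: "is_partition \<nu>" if "\<nu> \<in> partitions n" for \<nu>
      using that by (simp add: partitions_def)
    show "{\<nu>. is_partition \<nu> \<and> ?C x \<nu> \<noteq> 0} \<subseteq> partitions n"
      using C by (metis (mono_tags, lifting) mem_Collect_eq subsetI)
    show "\<forall>\<nu>\<in>partitions n - {\<nu>. is_partition \<nu> \<and> ?C x \<nu> \<noteq> 0}.
        x (mset \<nu>) * y (mset \<nu>) * (of_nat (z_part \<nu>) * \<beta> ^ length \<nu>) = 0"
    proof
      fix \<nu> assume "\<nu> \<in> partitions n - {\<nu>. is_partition \<nu> \<and> ?C x \<nu> \<noteq> 0}"
      then have "?C x \<nu> = 0" "\<nu> \<in> partitions n" using part by blast+
      then have "x (mset \<nu>) = 0" using C[OF part] by metis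
      then show "x (mset \<nu>) * y (mset \<nu>) * (of_nat (z_part \<nu>) * \<beta> ^ length \<nu>) = 0" by simp
    qed
    fix \<nu> assume \<nu>: "\<nu> \<in> {\<nu>. is_partition \<nu> \<and> ?C x \<nu> \<noteq> 0}"
    then have "\<nu> \<in> partitions n" using C by (metis (mono_tags, lifting) mem_Collect_eq)
    then have "?C x \<nu> = x (mset \<nu>)" "?C y \<nu> = y (mset \<nu>)" using C[OF part] by metis+
    then show "?C x \<nu> * ?C y \<nu> * (of_nat (z_part \<nu>) * \<beta> ^ length \<nu>) =
        x (mset \<nu>) * y (mset \<nu>) * (of_nat (z_part \<nu>) * \<beta> ^ length \<nu>)" by simp
  qed
  also have "\<dots> = (\<Sum>A\<in>mpartitions n. x A * y A * (of_nat (z_mset A) * \<beta> ^ size A))"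
    by (simp add: z_part_mset sum.reindex_bij_betw[OF bij_betw_mset_partitions, symmetric])
  finally show ?thesis .
qed

section \<open>Products of the power series \<open>\<Prod>\<^sub>i (1 - x\<^sub>i t)\<^sup>-\<^sup>g\<close>\<close>

text \<open>The coefficient of x^j in (1 - x)^(-g).\<close>

definition rising_coeff :: "'a::field_char_0 \<Rightarrow> nat \<Rightarrow> 'a" where
  "rising_coeff g j = pochhammer g j / fact j"

text \<open>\<open>g_series g k\<close> is the coefficient of \<open>t\<^sup>k\<close> in the product of all \<open>(1 - x\<^sub>i t)\<^sup>-\<^sup>g\<close>.\<close>

definition g_series :: "'a::field_char_0 \<Rightarrow> nat \<Rightarrow> 'a mps" where
  "g_series g k =
     Abs_mps (\<lambda>M. if size M = k then \<Prod>i\<in>set_mset M. rising_coeff g (count M i) else 0)"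

lemma coeff_g_series:
  "mps_coeff (g_series g k) M =
     (if size M = k then \<Prod>i\<in>set_mset M. rising_coeff g (count M i) else 0)"
  by (simp add: g_series_def)

lemma rising_coeff_0 [simp]: "rising_coeff g 0 = 1"
  by (simp add: rising_coeff_def)

text \<open>These are the coefficients in x b' = g x / (1 - x) b, which b = (1 - x)^(-g)
  satisfies.\<close>

lemma rising_coeff_sum: "of_nat m * rising_coeff g m = g * (\<Sum>j<m. rising_coeff g j)"
proof (induction m)
  case (Suc m)
  have "of_nat (Suc m) * rising_coeff g (Suc m) = pochhammer g m * (g + of_nat m) / fact m"
    by (simp add: rising_coeff_def pochhammer_Suc del: of_nat_Suc)
  also have "\<dots> = g * rising_coeff g m + of_nat m * rising_coeff g m"
    by (simp add: rising_coeff_def algebra_simps add_divide_distrib)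
  finally show ?case using Suc by (simp add: algebra_simps)
qed simp

text \<open>Newton's identity, i.e. the differential equation in \<open>t\<close> of the product.\<close>

lemma newton_g_series:
  "mps_scale (of_nat k) (g_series g k) =
     mps_scale g (\<Sum>j=1..k. power_sum j * g_series g (k - j))"
proof (rule mps_eqI)
  fix M
  let ?b = "rising_coeff g"
  have rhs: "mps_coeff (mps_scale g (\<Sum>j=1..k. power_sum j * g_series g (k - j))) M =
      g * (\<Sum>j=1..k. \<Sum>i | j \<le> count M i. mps_coeff (g_series g (k - j)) (M - replicate_mset j i))"
    by (simp add: mps_coeff_simps mps_coeff_sum coeff_power_sum_mult)
  have sub: "replicate_mset j i \<subseteq># M" if "j \<le> count M i" for i j
    using that by (simp add: subseteq_mset_def)
  show "mps_coeff (mps_scale (of_nat k) (g_series g k)) M =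
      mps_coeff (mps_scale g (\<Sum>j=1..k. power_sum j * g_series g (k - j))) M"
  proof (cases "size M = k")
    case False
    have "mps_coeff (g_series g (k - j)) (M - replicate_mset j i) = 0"
      if "j \<in> {1..k}" "j \<le> count M i" for i j
    proof -
      have "size (M - replicate_mset j i) + j = size M"
        using size_Diff_submset[OF sub[OF that(2)]] size_mset_mono[OF sub[OF that(2)]] by simp
      then show ?thesis using that(1) False by (auto simp: coeff_g_series)
    qed
    then show ?thesis using False unfolding rhs by (simp add: mps_coeff_simps coeff_g_series)
  next
    case True
    have cnt: "count M i \<le> k" for i using True count_le_size[of M i] by simp
    let ?Q = "\<lambda>i. \<Prod>i'\<in>set_mset M - {i}. ?b (count M i')"
    have prod_M: "mps_coeff (g_series g (k - j)) (M - replicate_mset j i) = ?b (count M i - j) * ?Q i"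
      if "j \<in> {1..k}" "j \<le> count M i" for i j
    proof -
      let ?M = "M - replicate_mset j i"
      have i: "i \<in># M" using that by (auto intro: count_inI)
      have "size ?M = k - j" using size_Diff_submset[OF sub[OF that(2)]] True by simp
      then have "mps_coeff (g_series g (k - j)) ?M = (\<Prod>i\<in>set_mset ?M. ?b (count ?M i))"
        by (simp add: coeff_g_series)
      \<comment> \<open>A variable that is used up leaves the support, but its factor is
        \<open>rising_coeff g 0 = 1\<close>.\<close>
      also have "\<dots> = (\<Prod>i\<in>set_mset M. ?b (count ?M i))"
        by (rule prod.mono_neutral_left) (auto dest: in_diffD simp: not_in_iff)
      also have "\<dots> = ?b (count M i - j) * ?Q i"
        using i by (subst prod.remove[of _ i]) auto
      finally show ?thesis .
    qed
    have "(\<Sum>j=1..k. \<Sum>i | j \<le> count M i. mps_coeff (g_series g (k - j)) (M - replicate_mset j i)) =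
        (\<Sum>j=1..k. \<Sum>i | j \<le> count M i. ?b (count M i - j) * ?Q i)"
      by (intro sum.cong refl) (simp add: prod_M)
    also have "\<dots> = (\<Sum>(j, i)\<in>(SIGMA j:{1..k}. {i. j \<le> count M i}). ?b (count M i - j) * ?Q i)"
      by (intro sum.Sigma) (auto intro: finite_count_ge)
    \<comment> \<open>With the variable i fixed first, the inner sum over j is the one in
      \<open>rising_coeff_sum\<close>.\<close>
    also have "\<dots> = (\<Sum>(i, j)\<in>(SIGMA i:set_mset M. {1..count M i}). ?b (count M i - j) * ?Q i)"
    proof (rule sum.reindex_bij_witness[of _ prod.swap prod.swap])
      fix x assume "x \<in> (SIGMA j:{1..k}. {i. j \<le> count M i})"
      then show "prod.swap x \<in> (SIGMA i:set_mset M. {1..count M i})"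
        by (auto simp flip: count_greater_zero_iff)
    next
      fix x assume "x \<in> (SIGMA i:set_mset M. {1..count M i})"
      then show "prod.swap x \<in> (SIGMA j:{1..k}. {i. j \<le> count M i})"
        by (auto intro: order_trans[OF _ cnt])
    qed auto
    also have "\<dots> = (\<Sum>i\<in>set_mset M. \<Sum>j=1..count M i. ?b (count M i - j) * ?Q i)"
      by (intro sum.Sigma[symmetric]) auto
    also have "g * \<dots> = (\<Sum>i\<in>set_mset M. of_nat (count M i) * (?b (count M i) * ?Q i))"
    proof (subst sum_distrib_left, intro sum.cong refl)
      fix i
      have "(\<Sum>j=1..count M i. ?b (count M i - j)) = (\<Sum>j<count M i. ?b j)"
        by (rule sum.reindex_bij_witness[of _ "\<lambda>j. count M i - j" "\<lambda>j. count M i - j"]) auto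
      then show "g * (\<Sum>j=1..count M i. ?b (count M i - j) * ?Q i) =
          of_nat (count M i) * (?b (count M i) * ?Q i)"
        using rising_coeff_sum[of "count M i" g]
        by (simp add: sum_distrib_right[symmetric] mult.assoc[symmetric])
    qed
    also have "\<dots> = (\<Sum>i\<in>set_mset M. of_nat (count M i) * (\<Prod>i\<in>set_mset M. ?b (count M i)))"
      by (intro sum.cong refl) (simp add: prod.remove)
    also have "\<dots> = of_nat k * (\<Prod>i\<in>set_mset M. ?b (count M i))"
      by (simp add: sum_distrib_right[symmetric] True[symmetric] size_multiset_overloaded_eq)
    finally show ?thesis
      unfolding rhs by (simp add: mps_coeff_simps coeff_g_series True)
  qed
qed

abbreviation z_inv :: "nat multiset \<Rightarrow> 'a::field_char_0" where
  "z_inv A \<equiv> inverse (of_nat (z_mset A))"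

lemma z_inv_add:
  assumes "j > 0"
  shows "of_nat (j * Suc (count A j)) * z_inv (add_mset j A) = (z_inv A :: 'a::field_char_0)"
proof -
  have "(of_nat (j * Suc (count A j)) :: 'a) \<noteq> 0"
    using assms by (simp only: of_nat_eq_0_iff) simp
  then show ?thesis unfolding z_mset_add of_nat_mult[of "j * Suc (count A j)"] by simp
qed

lemma sum_mset_eq_sum_count: "sum_mset A = (\<Sum>j\<in>set_mset A. count A j * j)" for A :: "nat multiset"
proof -
  have "(\<Sum>j\<in>S. count A j * j) = sum_mset A" if "finite S" "set_mset A \<subseteq> S" for S
    using that(2)
  proof (induction A)
    case (add x A)
    have "(\<Sum>j\<in>S. count (add_mset x A) j * j) = (\<Sum>j\<in>S. (if j = x then x else 0) + count A j * j)"
      by (intro sum.cong) auto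
    also have "\<dots> = x + (\<Sum>j\<in>S. count A j * j)"
      using add.prems that(1) by (simp add: sum.distrib)
    finally show ?case using add by simp
  qed simp
  then show ?thesis by (metis finite_set_mset subset_refl)
qed

text \<open>Removing one part j multiplies \<open>z_inv\<close> by j times its multiplicity, and
  these products add up to the weight k of \<open>A\<close>.\<close>

lemma sum_z_mset_remove:
  assumes "A \<in> mpartitions k"
  shows "(\<Sum>j\<in>set_mset A. inverse (of_nat (z_mset (A - {#j#})))) =
    (of_nat k * inverse (of_nat (z_mset A)) :: 'a::field_char_0)"
proof -
  have "inverse (of_nat (z_mset (A - {#j#}))) =
      (of_nat (j * count A j) * inverse (of_nat (z_mset A)) :: 'a)" if j: "j \<in># A" for j
  proof -
    obtain B where B: "A = add_mset j B" using multi_member_split[OF j] by blast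
    have "j > 0" using assms B by (auto simp: mpartitions_def)
    then show ?thesis using z_inv_add[of j B, where 'a = 'a] B by simp
  qed
  then have "(\<Sum>j\<in>set_mset A. inverse (of_nat (z_mset (A - {#j#})))) =
      (\<Sum>j\<in>set_mset A. of_nat (j * count A j) * inverse (of_nat (z_mset A)) :: 'a)" by simp
  also have "\<dots> = of_nat (\<Sum>j\<in>set_mset A. count A j * j) * inverse (of_nat (z_mset A))"
    by (simp add: sum_distrib_left sum_distrib_right mult_ac)
  also have "(\<Sum>j\<in>set_mset A. count A j * j) = k"
    using assms by (simp add: mpartitions_def sum_mset_eq_sum_count)
  finally show ?thesis .
qed

lemma mps_scale_scale: "mps_scale c (mps_scale d f) = mps_scale (c * d) f"
  by (rule mps_eqI) (simp add: mps_coeff_simps mult.assoc)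

lemma mps_scale_sum: "mps_scale c (sum f S) = (\<Sum>i\<in>S. mps_scale c (f i))"
  by (rule mps_eqI) (simp add: mps_coeff_simps mps_coeff_sum sum_distrib_left)

lemma mps_scale_add_left: "mps_scale (c + d) f = mps_scale c f + mps_scale d f"
  by (rule mps_eqI) (simp add: mps_coeff_simps distrib_right)

lemma mps_scale_sum_left: "mps_scale (sum c S) f = (\<Sum>i\<in>S. mps_scale (c i) f)"
  by (rule mps_eqI) (simp add: mps_coeff_simps mps_coeff_sum sum_distrib_right)

text \<open>The expansion of exp (g * sum of p_j t^j / j). Both sides obey the recursion
  \<open>newton_g_series\<close>.\<close>

lemma g_series_power_sums:
  fixes g :: "'a::field_char_0"
  shows "g_series g k =
    (\<Sum>A\<in>mpartitions k. mps_scale (g ^ size A * inverse (of_nat (z_mset A))) (power_prod A))"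
proof (induction k rule: less_induct)
  case (less k)
  show ?case
  proof (cases "k = 0")
    case True
    have "mpartitions 0 = {{#}}"
      by (auto simp: mpartitions_def) (metis multiset_nonemptyE)
    moreover have "g_series g 0 = 1"
      by (rule mps_eqI) (simp add: coeff_g_series one_mps.rep_eq)
    ultimately show ?thesis using True by (simp add: z_mset_def)
  next
    case False
    let ?c = "\<lambda>A. g ^ size A * inverse (of_nat (z_mset A)) :: 'a"
    let ?d = "\<lambda>j A. g ^ size A * inverse (of_nat (z_mset (A - {#j#}))) :: 'a"
    have "mps_scale (of_nat k) (g_series g k) =
        (\<Sum>j=1..k. mps_scale g (power_sum j *
          (\<Sum>A\<in>mpartitions (k - j). mps_scale (?c A) (power_prod A))))"
      unfolding newton_g_series mps_scale_sum by (intro sum.cong refl) (simp add: less)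
    also have "\<dots> = (\<Sum>j=1..k. \<Sum>A\<in>mpartitions (k - j).
        mps_scale (?d j (add_mset j A)) (power_prod (add_mset j A)))"
      by (simp add: sum_distrib_left mps_scale_sum mps_scale_mult_right mps_scale_scale mult.assoc)
    also have "\<dots> = (\<Sum>(j, A)\<in>(SIGMA j:{1..k}. mpartitions (k - j)).
        mps_scale (?d j (add_mset j A)) (power_prod (add_mset j A)))"
      by (intro sum.Sigma) (auto simp: finite_mpartitions)
    \<comment> \<open>Adding j to the multiset turns the pairs into multisets of weight k with one
      part value marked.\<close>
    also have "\<dots> = (\<Sum>(A, j)\<in>(SIGMA A:mpartitions k. set_mset A).
        mps_scale (?d j A) (power_prod A))"
    proof (rule sum.reindex_bij_witness[of _ "\<lambda>(A, j). (j, A - {#j#})" "\<lambda>(j, A). (add_mset j A, j)"])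
      fix x assume x: "x \<in> (SIGMA j:{1..k}. mpartitions (k - j))"
      then show "(case x of (j, A) \<Rightarrow> (add_mset j A, j)) \<in> (SIGMA A:mpartitions k. set_mset A)"
        by (auto simp: mpartitions_def)
    next
      fix x assume x: "x \<in> (SIGMA A:mpartitions k. set_mset A)"
      obtain A j where Aj: "x = (A, j)" by (cases x)
      with x have "j \<in># A" by simp
      then obtain B where "A = add_mset j B" using multi_member_split by metis
      with x Aj show "(case x of (A, j) \<Rightarrow> (j, A - {#j#})) \<in> (SIGMA j:{1..k}. mpartitions (k - j))"
        by (auto simp: mpartitions_def)
    qed auto
    also have "\<dots> = (\<Sum>A\<in>mpartitions k. \<Sum>j\<in>set_mset A. mps_scale (?d j A) (power_prod A))"
      by (intro sum.Sigma[symmetric]) (auto simp: finite_mpartitions)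
    also have "\<dots> = (\<Sum>A\<in>mpartitions k. mps_scale (of_nat k) (mps_scale (?c A) (power_prod A)))"
      by (intro sum.cong refl)
         (simp add: mps_scale_sum_left[symmetric] sum_distrib_left[symmetric] sum_z_mset_remove
           mps_scale_scale mult.left_commute)
    finally have *: "mps_scale (of_nat k) (g_series g k) = mps_scale (of_nat k)
        (\<Sum>A\<in>mpartitions k. mps_scale (?c A) (power_prod A))"
      by (simp add: mps_scale_sum)
    show ?thesis
    proof (rule mps_eqI)
      fix M
      show "mps_coeff (g_series g k) M =
          mps_coeff (\<Sum>A\<in>mpartitions k. mps_scale (?c A) (power_prod A)) M"
        using arg_cong[OF *, of "\<lambda>f. mps_coeff f M"] False by (simp add: mps_scale.rep_eq)
    qed
  qed
qed

section \<open>The adjoint of multiplication by \<open>g_series\<close>\<close>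

text \<open>The coefficient of \<open>x\<^sub>0\<^sup>s\<close>, as a series in the variables \<open>x\<^sub>1, x\<^sub>2, \<dots>\<close> renamed to
  \<open>x\<^sub>0, x\<^sub>1, \<dots>\<close>.\<close>

definition slice :: "nat \<Rightarrow> 'a mps \<Rightarrow> 'a mps" where
  "slice s f = Abs_mps (\<lambda>M. mps_coeff f (replicate_mset s 0 + image_mset Suc M))"

lemma coeff_slice: "mps_coeff (slice s f) M = mps_coeff f (replicate_mset s 0 + image_mset Suc M)"
  by (simp add: slice_def)

lemma slice_scale: "slice s (mps_scale c f) = mps_scale c (slice s f)"
  by (rule mps_eqI) (simp add: coeff_slice mps_scale.rep_eq)

lemma slice_sum: "slice s (sum f S) = (\<Sum>i\<in>S. slice s (f i))"
  by (rule mps_eqI) (simp add: coeff_slice mps_coeff_sum)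

lemma count_image_Suc: "count (image_mset Suc M) (Suc i) = count M i" "count (image_mset Suc M) 0 = 0"
  by (induction M) auto

text \<open>The power sum splits into x_0^j and the power sum of the remaining variables.\<close>

lemma slice_power_sum_mult:
  assumes "j > 0"
  shows "slice s (power_sum j * f) =
    power_sum j * slice s f + (if j \<le> s then slice (s - j) f else 0)"
proof (rule mps_eqI)
  fix M
  let ?N = "replicate_mset s 0 + image_mset Suc M"
  have cnt: "count ?N 0 = s" "count ?N (Suc i) = count M i" for i
    by (simp_all add: count_image_Suc)
  have N0: "?N - replicate_mset j 0 = replicate_mset (s - j) 0 + image_mset Suc M" if "j \<le> s"
    by (rule multiset_eqI) (use that in \<open>auto simp: count_image_Suc\<close>)
  have NS: "?N - replicate_mset j (Suc i) = replicate_mset s 0 + image_mset Suc (M - replicate_mset j i)" for i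
  proof (rule multiset_eqI)
    fix x show "count (?N - replicate_mset j (Suc i)) x =
        count (replicate_mset s 0 + image_mset Suc (M - replicate_mset j i)) x"
      by (cases x) (simp_all add: count_image_Suc)
  qed
  have "{i. j \<le> count ?N i} = Suc ` {i. j \<le> count M i} \<union> (if j \<le> s then {0} else {})"
  proof (intro set_eqI)
    fix x show "x \<in> {i. j \<le> count ?N i} \<longleftrightarrow>
        x \<in> Suc ` {i. j \<le> count M i} \<union> (if j \<le> s then {0} else {})"
      using assms by (cases x) (auto simp: count_image_Suc)
  qed
  then have "mps_coeff (slice s (power_sum j * f)) M =
      (\<Sum>i\<in>Suc ` {i. j \<le> count M i} \<union> (if j \<le> s then {0} else {}). mps_coeff f (?N - replicate_mset j i))"
    by (simp add: coeff_slice coeff_power_sum_mult[OF assms])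
  also have "\<dots> = (\<Sum>i\<in>Suc ` {i. j \<le> count M i}. mps_coeff f (?N - replicate_mset j i)) +
      (\<Sum>i\<in>(if j \<le> s then {0} else {}). mps_coeff f (?N - replicate_mset j i))"
    using finite_count_ge[OF assms] by (intro sum.union_disjoint) auto
  also have "(\<Sum>i\<in>Suc ` {i. j \<le> count M i}. mps_coeff f (?N - replicate_mset j i)) =
      mps_coeff (power_sum j * slice s f) M"
    by (simp add: sum.reindex coeff_power_sum_mult[OF assms] coeff_slice NS)
  finally show "mps_coeff (slice s (power_sum j * f)) M =
      mps_coeff (power_sum j * slice s f + (if j \<le> s then slice (s - j) f else 0)) M"
    by (simp add: plus_mps.rep_eq coeff_slice N0 zero_mps.rep_eq)
qed

lemma slice_one: "slice s 1 = (if s = 0 then 1 else 0)"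
  by (rule mps_eqI) (auto simp: coeff_slice one_mps.rep_eq zero_mps.rep_eq)

text \<open>\<open>B\<close> collects the parts that stay power sums; the removed parts, of total
  size s, become powers of x_0.\<close>

definition submultisets :: "nat multiset \<Rightarrow> nat \<Rightarrow> nat multiset set" where
  "submultisets A s = {B. B \<subseteq># A \<and> sum_mset (A - B) = s}"

lemma finite_submultisets_weight: "finite (submultisets A s)"
  unfolding submultisets_def by (rule finite_subset[OF _ finite_submultisets[of A]]) auto

text \<open>When the product of x_0^j + p_j over the parts j of \<open>A\<close> is expanded, the
  number of ways to keep \<open>B\<close> is a product of binomial coefficients, which equals z_A /
  (z_B z_(A - B)). The induction is Pascal's rule for these numbers.\<close>

lemma slice_power_prod:
  "0 \<notin># A \<Longrightarrow> slice s (power_prod A) =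
    (\<Sum>B\<in>submultisets A s.
      mps_scale (of_nat (z_mset A) * (z_inv B * z_inv (A - B))) (power_prod B :: 'a::field_char_0 mps))"
proof (induction A arbitrary: s)
  case empty
  have "submultisets {#} s = (if s = 0 then {{#}} else {})" by (auto simp: submultisets_def)
  then show ?case by (simp add: slice_one z_mset_def)
next
  case (add j A)
  then have j: "j > 0" and A: "0 \<notin># A" by auto
  let ?A = "add_mset j A"
  let ?z = "of_nat (z_mset A) :: 'a"
  let ?t = "\<lambda>A B. z_inv B * z_inv (A - B) :: 'a"
  let ?P = "power_prod :: nat multiset \<Rightarrow> 'a mps"
  let ?S = "submultisets ?A s"
  have "power_sum j * slice s (?P A) =
      (\<Sum>B\<in>submultisets A s. mps_scale (?z * ?t A B) (?P (add_mset j B)))"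
    using add.IH[OF A, of s] by (simp add: sum_distrib_left mps_scale_mult_right)
  also have "\<dots> = (\<Sum>B\<in>{B\<in>?S. j \<in># B}.
      mps_scale (?z * (of_nat (j * count B j) * ?t ?A B)) (?P B))"
  proof (rule sum.reindex_bij_witness[of _ "\<lambda>B. B - {#j#}" "add_mset j"])
    fix B assume "B \<in> submultisets A s"
    then show "add_mset j B \<in> {B\<in>?S. j \<in># B}" by (simp add: submultisets_def)
    have "of_nat (j * Suc (count B j)) * ?t ?A (add_mset j B) = ?t A B"
      unfolding mult.assoc[symmetric] z_inv_add[OF j] by simp
    then show "mps_scale (?z * (of_nat (j * count (add_mset j B) j) * ?t ?A (add_mset j B)))
        (?P (add_mset j B)) = mps_scale (?z * ?t A B) (?P (add_mset j B))" by simp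
  next
    fix B assume B: "B \<in> {B\<in>?S. j \<in># B}"
    then have "j \<in># B" by simp
    then obtain C where C: "B = add_mset j C" using multi_member_split by metis
    then show "B - {#j#} \<in> submultisets A s" "add_mset j (B - {#j#}) = B"
      using B by (simp_all add: submultisets_def)
  qed simp
  \<comment> \<open>The factor \<open>count B j\<close> kills the additional terms.\<close>
  also have "\<dots> = (\<Sum>B\<in>?S. mps_scale (?z * (of_nat (j * count B j) * ?t ?A B)) (?P B))"
    by (rule sum.mono_neutral_left)
       (auto simp: finite_submultisets_weight not_in_iff intro: mps_eqI simp: mps_coeff_simps)
  finally have 1: "power_sum j * slice s (?P A) =
      (\<Sum>B\<in>?S. mps_scale (?z * (of_nat (j * count B j) * ?t ?A B)) (?P B))" .
  have "(if j \<le> s then slice (s - j) (?P A) else 0) =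
      (\<Sum>B\<in>(if j \<le> s then submultisets A (s - j) else {}). mps_scale (?z * ?t A B) (?P B))"
    using add.IH[OF A, of "s - j"] by simp
  also have "\<dots> = (\<Sum>B\<in>{B\<in>?S. B \<subseteq># A}.
      mps_scale (?z * (of_nat (j * count (?A - B) j) * ?t ?A B)) (?P B))"
  proof (rule sum.cong)
    have "?A - B = add_mset j (A - B)" if "B \<subseteq># A" for B
      using that by (intro multiset_eqI) (simp add: subseteq_mset_def Suc_diff_le)
    note diff = this
    have "B \<subseteq># ?A" if "B \<subseteq># A" for B
      using that by (simp add: subseteq_mset_def le_SucI)
    then show "(if j \<le> s then submultisets A (s - j) else {}) = {B\<in>?S. B \<subseteq># A}"
      using diff by (auto simp: submultisets_def)
    fix B assume "B \<in> {B\<in>?S. B \<subseteq># A}"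
    then have d: "?A - B = add_mset j (A - B)" using diff by simp
    have "of_nat (j * count (?A - B) j) * ?t ?A B =
        z_inv B * (of_nat (j * Suc (count (A - B) j)) * z_inv (add_mset j (A - B)))"
      unfolding d by (simp only: count_add_mset if_True refl mult.left_commute simp_thms)
    also have "\<dots> = ?t A B" unfolding z_inv_add[OF j] ..
    finally have E: "of_nat (j * count (?A - B) j) * ?t ?A B = ?t A B" .
    show "mps_scale (?z * ?t A B) (?P B) =
        mps_scale (?z * (of_nat (j * count (?A - B) j) * ?t ?A B)) (?P B)" unfolding E ..
  qed
  also have "\<dots> = (\<Sum>B\<in>?S. mps_scale (?z * (of_nat (j * count (?A - B) j) * ?t ?A B)) (?P B))"
  proof (rule sum.mono_neutral_left)
    show "\<forall>B\<in>?S - {B\<in>?S. B \<subseteq># A}.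
        mps_scale (?z * (of_nat (j * count (?A - B) j) * ?t ?A B)) (?P B) = 0"
    proof
      fix B assume B: "B \<in> ?S - {B\<in>?S. B \<subseteq># A}"
      then have le: "B \<subseteq># ?A" "\<not> B \<subseteq># A" by (auto simp: submultisets_def)
      have "count (?A - B) j = 0"
      proof (rule ccontr)
        assume "count (?A - B) j \<noteq> 0"
        then have "count B i \<le> count A i" for i
          using le(1) by (cases "i = j") (auto simp: subseteq_mset_def dest: spec[of _ i])
        then show False using le(2) by (simp add: subseteq_mset_def)
      qed
      then show "mps_scale (?z * (of_nat (j * count (?A - B) j) * ?t ?A B)) (?P B) = 0"
        by (intro mps_eqI) (simp add: mps_coeff_simps)
    qed
  qed (auto simp: finite_submultisets_weight)
  finally have 2: "(if j \<le> s then slice (s - j) (?P A) else 0) =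
      (\<Sum>B\<in>?S. mps_scale (?z * (of_nat (j * count (?A - B) j) * ?t ?A B)) (?P B))" .
  have "slice s (?P ?A) =
      (\<Sum>B\<in>?S. mps_scale (?z * (of_nat (j * count B j) * ?t ?A B) +
        ?z * (of_nat (j * count (?A - B) j) * ?t ?A B)) (?P B))"
    unfolding power_prod_simps slice_power_sum_mult[OF j] 1 2 mps_scale_add_left sum.distrib ..
  also have "\<dots> = (\<Sum>B\<in>?S. mps_scale (of_nat (z_mset ?A) * ?t ?A B) (?P B))"
  proof (intro sum.cong refl arg_cong2[of _ _ _ _ mps_scale])
    fix B assume "B \<in> ?S"
    then have "count B j \<le> Suc (count A j)"
      by (auto simp: submultisets_def subseteq_mset_def dest: spec[of _ j])
    \<comment> \<open>Pascal's rule enters here: the copies of j are divided between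
      \<open>B\<close> and its complement.\<close>
    then have "j * count B j + j * count (?A - B) j = j * Suc (count A j)"
      by (simp add: distrib_left[symmetric] del: mult_Suc_right)
    then have "of_nat (j * count B j) + of_nat (j * count (?A - B) j) = (of_nat (j * Suc (count A j)) :: 'a)"
      by (metis of_nat_add)
    then have "?z * (of_nat (j * Suc (count A j)) * ?t ?A B) =
        ?z * ((of_nat (j * count B j) + of_nat (j * count (?A - B) j)) * ?t ?A B)" by simp
    then show "?z * (of_nat (j * count B j) * ?t ?A B) + ?z * (of_nat (j * count (?A - B) j) * ?t ?A B) =
        of_nat (z_mset ?A) * ?t ?A B"
      unfolding z_mset_add by (simp add: algebra_simps del: of_nat_Suc)
  qed
  finally show ?case .
qed

lemma submultisets_mpartitions:
  assumes "s \<le> n"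
  shows "A \<in> mpartitions n \<and> B \<in> submultisets A s \<longleftrightarrow>
    A \<in> mpartitions n \<and> B \<in> mpartitions (n - s) \<and> B \<subseteq># A"
proof -
  have "sum_mset A = sum_mset (A - B) + sum_mset B" if "B \<subseteq># A"
    using that by (metis subset_mset.diff_add sum_mset.union)
  then show ?thesis
    using assms by (auto simp: submultisets_def mpartitions_def dest: mset_subset_eqD)
qed

lemma sum_submultisets_swap:
  fixes h :: "nat multiset \<Rightarrow> nat multiset \<Rightarrow> 'b::comm_monoid_add"
  assumes "s \<le> n"
  shows "(\<Sum>A\<in>mpartitions n. \<Sum>B\<in>submultisets A s. h A B) =
    (\<Sum>B\<in>mpartitions (n - s). \<Sum>A\<in>{A \<in> mpartitions n. B \<subseteq># A}. h A B)"
proof -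
  let ?T = "SIGMA A:mpartitions n. submultisets A s"
  let ?T' = "SIGMA B:mpartitions (n - s). {A \<in> mpartitions n. B \<subseteq># A}"
  have T: "B \<in> submultisets A s \<longleftrightarrow> B \<in> mpartitions (n - s) \<and> B \<subseteq># A"
    if "A \<in> mpartitions n" for A B
    using submultisets_mpartitions[OF assms, of A B] that by blast
  have "(\<Sum>A\<in>mpartitions n. \<Sum>B\<in>submultisets A s. h A B) = (\<Sum>(A, B)\<in>?T. h A B)"
    by (intro sum.Sigma) (auto simp: finite_mpartitions finite_submultisets_weight)
  also have "\<dots> = (\<Sum>(B, A)\<in>?T'. h A B)"
    by (rule sum.reindex_bij_witness[of _ prod.swap prod.swap]) (auto simp: T)
  also have "\<dots> = (\<Sum>B\<in>mpartitions (n - s). \<Sum>A\<in>{A \<in> mpartitions n. B \<subseteq># A}. h A B)"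
    by (intro sum.Sigma[symmetric]) (auto simp: finite_mpartitions)
  finally show ?thesis .
qed

lemma g_series_mult:
  fixes a :: "'a::field_char_0"
  assumes "s \<le> n"
  shows "g_series a s * g_series g (n - s) = (\<Sum>A\<in>mpartitions n.
    mps_scale (\<Sum>B\<in>submultisets A s. (a ^ size (A - B) * z_inv (A - B)) * (g ^ size B * z_inv B)) (power_prod A))"
proof -
  let ?y = "\<lambda>B. g ^ size B * z_inv B :: 'a"
  let ?w = "\<lambda>C. a ^ size C * z_inv C :: 'a"
  let ?X = "\<lambda>A. \<Sum>B\<in>submultisets A s. ?w (A - B) * ?y B"
  have "g_series a s * g_series g (n - s) =
      (\<Sum>C\<in>mpartitions s. \<Sum>B\<in>mpartitions (n - s). mps_scale (?w C * ?y B) (power_prod (C + B)))"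
    unfolding g_series_power_sums sum_product
    by (simp add: mps_scale_mult_left mps_scale_mult_right mps_scale_scale power_prod_union mult_ac)
  also have "\<dots> = (\<Sum>B\<in>mpartitions (n - s). \<Sum>C\<in>mpartitions s. mps_scale (?w C * ?y B) (power_prod (C + B)))"
    by (rule sum.swap)
  also have "\<dots> = (\<Sum>B\<in>mpartitions (n - s). \<Sum>A\<in>{A \<in> mpartitions n. B \<subseteq># A}.
      mps_scale (?w (A - B) * ?y B) (power_prod A))"
  proof (rule sum.cong[OF refl])
    fix B assume B: "B \<in> mpartitions (n - s)"
    show "(\<Sum>C\<in>mpartitions s. mps_scale (?w C * ?y B) (power_prod (C + B))) =
        (\<Sum>A\<in>{A \<in> mpartitions n. B \<subseteq># A}. mps_scale (?w (A - B) * ?y B) (power_prod A))"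
    proof (rule sum.reindex_bij_witness[of _ "\<lambda>A. A - B" "\<lambda>C. C + B"])
      fix A assume A: "A \<in> {A \<in> mpartitions n. B \<subseteq># A}"
      then show "A - B + B = A" by simp
      have "B \<in> submultisets A s" using A B submultisets_mpartitions[OF assms, of A B] by simp
      then show "A - B \<in> mpartitions s"
        using A by (auto simp: submultisets_def mpartitions_def dest: in_diffD)
    qed (use B assms in \<open>auto simp: mpartitions_def\<close>)
  qed
  also have "\<dots> = (\<Sum>A\<in>mpartitions n. mps_scale (?X A) (power_prod A))"
    unfolding sum_submultisets_swap[OF assms, symmetric] mps_scale_sum_left ..
  finally show ?thesis .
qed

lemma g_series_mult_sym_homog:
  "s \<le> n \<Longrightarrow> g_series a s * g_series g (n - s) \<in> sym_homog n"
  unfolding g_series_mult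
  by (intro mps.subspace_sum mps.subspace_scale sym_homog_subspace)
     (auto simp: mpartitions_def intro: power_prod_sym_homog)

text \<open>The coefficient of p_A in the product is a sum over the same sub-multisets as in
  \<open>slice_power_prod\<close>. Since a \<beta> = 1, the powers of a cancel against the weight
  \<beta>^(size A), and the pairing becomes a combination of coefficients of the slice.\<close>

lemma g_series_orthogonal:
  fixes a \<beta> :: "'a::linordered_field"
  assumes "a * \<beta> = 1" "s \<le> n" "f \<in> sym_homog n" "slice s f = 0"
  shows "jack_inner \<beta> (g_series a s * g_series g (n - s)) f = 0"
proof -
  let ?y = "\<lambda>B. g ^ size B * z_inv B :: 'a"
  let ?w = "\<lambda>C. a ^ size C * z_inv C :: 'a"
  let ?X = "\<lambda>A. \<Sum>B\<in>submultisets A s. ?w (A - B) * ?y B"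
  note swap = sum_submultisets_swap[OF assms(2)]
  obtain x where f: "f = (\<Sum>A\<in>mpartitions n. mps_scale (x A) (power_prod A))"
    using power_prod_span[OF assms(3)] by blast
  \<comment> \<open>\<open>c B\<close> is the coefficient of p_B in the slice of
    \<open>f\<close>.\<close>
  define c where "c B = (\<Sum>A\<in>{A \<in> mpartitions n. B \<subseteq># A}.
      x A * (of_nat (z_mset A) * (z_inv B * z_inv (A - B))))" for B
  have "slice s f = (\<Sum>A\<in>mpartitions n. \<Sum>B\<in>submultisets A s.
      mps_scale (x A * (of_nat (z_mset A) * (z_inv B * z_inv (A - B)))) (power_prod B))"
    unfolding f slice_sum slice_scale
    by (intro sum.cong refl) (simp add: slice_power_prod mpartitions_def mps_scale_sum mps_scale_scale)
  also have "\<dots> = (\<Sum>B\<in>mpartitions (n - s). mps_scale (c B) (power_prod B))"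
    unfolding swap c_def mps_scale_sum_left ..
  finally have c0: "c B = 0" if "B \<in> mpartitions (n - s)" for B
    using power_prod_independent[of c "n - s" B] assms(4) that by simp
  have "jack_inner \<beta> (g_series a s * g_series g (n - s)) f =
      (\<Sum>A\<in>mpartitions n. ?X A * x A * (of_nat (z_mset A) * \<beta> ^ size A))"
    unfolding g_series_mult[OF assms(2)] f by (rule jack_inner_sum)
  also have "\<dots> = (\<Sum>A\<in>mpartitions n. \<Sum>B\<in>submultisets A s.
      (\<beta> ^ size B * g ^ size B) * (x A * (of_nat (z_mset A) * (z_inv B * z_inv (A - B)))))"
  proof (rule sum.cong[OF refl])
    fix A assume A: "A \<in> mpartitions n"
    have "?w (A - B) * ?y B * x A * (of_nat (z_mset A) * \<beta> ^ size A) =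
        (\<beta> ^ size B * g ^ size B) * (x A * (of_nat (z_mset A) * (z_inv B * z_inv (A - B))))"
      if "B \<in> submultisets A s" for B
    proof -
      have "size A = size (A - B) + size B"
        using that by (metis (mono_tags, lifting) mem_Collect_eq size_union subset_mset.diff_add submultisets_def)
      then have "a ^ size (A - B) * \<beta> ^ size A = \<beta> ^ size B"
        using assms(1) by (simp add: power_add mult.assoc[symmetric] power_mult_distrib[symmetric])
      then have "a ^ size (A - B) * \<beta> ^ size A * (z_inv (A - B) * ?y B * x A * of_nat (z_mset A)) =
          \<beta> ^ size B * (z_inv (A - B) * ?y B * x A * of_nat (z_mset A))" by simp
      then show ?thesis by (simp add: mult_ac)
    qed
    note eq = this
    show "?X A * x A * (of_nat (z_mset A) * \<beta> ^ size A) = (\<Sum>B\<in>submultisets A s.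
        (\<beta> ^ size B * g ^ size B) * (x A * (of_nat (z_mset A) * (z_inv B * z_inv (A - B)))))"
      unfolding sum_distrib_right by (intro sum.cong refl eq)
  qed
  also have "\<dots> = (\<Sum>B\<in>mpartitions (n - s). (\<beta> ^ size B * g ^ size B) * c B)"
    unfolding swap c_def sum_distrib_left ..
  also have "\<dots> = 0" using c0 by simp
  finally show "jack_inner \<beta> (g_series a s * g_series g (n - s)) f = 0" .
qed

section \<open>An explicit multiple of the Jack function of a hook\<close>

text \<open>\<open>g_series (- 1) r\<close> is (-1)^r e_r. In the weight (n - r) + a r, the two
  terms are the degrees that t d/dt produces on the two factors, the second one multiplied by
  a.\<close>

definition hook_summand :: "'a::field_char_0 \<Rightarrow> nat \<Rightarrow> nat \<Rightarrow> 'a mps" where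
  "hook_summand a n r =
     mps_scale (of_nat n + (a - 1) * of_nat r) (g_series a (n - r) * g_series (- 1) r)"

definition hook_function :: "'a::field_char_0 \<Rightarrow> nat \<Rightarrow> nat \<Rightarrow> 'a mps" where
  "hook_function a n l = (\<Sum>r\<le>l. hook_summand a n r)"

text \<open>
  The full sum is the coefficient of \<open>t\<^sup>n\<close> in \<open>t A' E + a t A E'\<close>, where \<open>A = \<Prod> (1 - x\<^sub>i t)\<^sup>-\<^sup>a\<close> and
  \<open>E = \<Prod> (1 - x\<^sub>i t)\<close>, and \<open>A' / A = - a E' / E\<close>.
\<close>

lemma hook_function_full: "hook_function a n n = 0"
proof -
  let ?G = "g_series a" and ?E = "g_series (- 1) :: nat \<Rightarrow> 'a mps"
  let ?p = "power_sum :: nat \<Rightarrow> 'a mps"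
  have summand: "hook_summand a n r =
      mps_scale a (\<Sum>j=1..n - r. ?p j * ?G (n - r - j) * ?E r) -
      mps_scale a (\<Sum>j=1..r. ?p j * ?G (n - r) * ?E (r - j))" if "r \<le> n" for r
  proof -
    have "of_nat n + (a - 1) * of_nat r = of_nat (n - r) + a * of_nat r"
      using that by (simp add: of_nat_diff algebra_simps)
    then have "hook_summand a n r =
        mps_scale (of_nat (n - r)) (?G (n - r)) * ?E r +
        mps_scale a (?G (n - r) * mps_scale (of_nat r) (?E r))"
      by (simp add: hook_summand_def mps_scale_add_left mps_scale_scale mps_scale_mult_left mps_scale_mult_right)
    also have "\<dots> = mps_scale a (\<Sum>j=1..n - r. ?p j * ?G (n - r - j)) * ?E r +
        mps_scale a (?G (n - r) * mps_scale (- 1) (\<Sum>j=1..r. ?p j * ?E (r - j)))"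
      by (simp only: newton_g_series)
    also have "\<dots> = mps_scale a (\<Sum>j=1..n - r. ?p j * ?G (n - r - j) * ?E r) +
        mps_scale (- a) (\<Sum>j=1..r. ?p j * ?G (n - r) * ?E (r - j))"
      by (simp add: mps_scale_mult_left mps_scale_mult_right mps_scale_scale sum_distrib_left
          sum_distrib_right mult_ac)
    also have "mps_scale (- a) f = - mps_scale a f" for f :: "'a mps"
      by (rule mps_eqI) (simp add: mps_coeff_simps)
    finally show ?thesis by simp
  qed
  have "(\<Sum>r\<le>n. \<Sum>j=1..r. ?p j * ?G (n - r) * ?E (r - j)) =
      (\<Sum>(r, j)\<in>(SIGMA r:{..n}. {1..r}). ?p j * ?G (n - r) * ?E (r - j))"
    by (intro sum.Sigma) auto
  \<comment> \<open>Both double sums run over the ways to split n into j and two degrees; the shift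
    r - j moves j from one factor to the other.\<close>
  also have "\<dots> = (\<Sum>(r, j)\<in>(SIGMA r:{..n}. {1..n - r}). ?p j * ?G (n - r - j) * ?E r)"
    by (rule sum.reindex_bij_witness[of _ "\<lambda>(r, j). (r + j, j)" "\<lambda>(r, j). (r - j, j)"]) auto
  also have "\<dots> = (\<Sum>r\<le>n. \<Sum>j=1..n - r. ?p j * ?G (n - r - j) * ?E r)"
    by (intro sum.Sigma[symmetric]) auto
  finally have "(\<Sum>r\<le>n. mps_scale a (\<Sum>j=1..r. ?p j * ?G (n - r) * ?E (r - j))) =
      (\<Sum>r\<le>n. mps_scale a (\<Sum>j=1..n - r. ?p j * ?G (n - r - j) * ?E r))"
    by (simp only: mps_scale_sum[symmetric])
  then show ?thesis
    by (simp add: hook_function_def summand sum_subtractf)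
qed

section \<open>Coefficients of the hook function\<close>

lemma pochhammer_minus_one: "j \<ge> 2 \<Longrightarrow> pochhammer (- 1 :: 'a::field_char_0) j = 0"
  using pochhammer_of_nat_eq_0_lemma[of 1 j, where 'a = 'a] by simp

text \<open>Each factor 1 - x_i t has the coefficients 1, -1, 0, 0, ..., so only squarefree
  monomials remain.\<close>

lemma coeff_elementary:
  "mps_coeff (g_series (- 1 :: 'a::field_char_0) r) N =
     (if N = mset_set (set_mset N) \<and> card (set_mset N) = r then (- 1) ^ r else 0)"
proof (cases "N = mset_set (set_mset N)")
  case True
  have "count N i = 1" if "i \<in># N" for i
    using that by (subst True) simp
  moreover have "size N = card (set_mset N)" by (subst True) simp
  ultimately show ?thesis using True by (simp add: coeff_g_series rising_coeff_def)
next
  case False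
  then obtain i where "count N i \<noteq> count (mset_set (set_mset N)) i" by (auto simp: multiset_eq_iff)
  then have i: "count N i \<ge> 2" "i \<in># N"
    by (cases "i \<in># N"; auto simp: not_in_iff simp flip: count_greater_zero_iff)+
  then have "rising_coeff (- 1 :: 'a) (count N i) = 0"
    by (simp add: rising_coeff_def pochhammer_minus_one)
  then show ?thesis using i(2) False by (auto simp: coeff_g_series intro!: prod_zero)
qed

lemma coeff_g_elementary:
  "mps_coeff (g_series a s * g_series (- 1 :: 'a::field_char_0) r) M =
     (- 1) ^ r * (\<Sum>S | S \<subseteq> set_mset M \<and> card S = r. mps_coeff (g_series a s) (M - mset_set S))"
proof -
  have fin: "finite S" if "S \<subseteq> set_mset M" for S using finite_subset[OF that] by simp
  have inj: "inj_on mset_set {S. S \<subseteq> set_mset M \<and> card S = r}"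
    using fin by (intro inj_onI) (metis (mono_tags, lifting) finite_set_mset_mset_set mem_Collect_eq)
  have sub: "mset_set S \<subseteq># M" if "S \<subseteq> set_mset M" for S
    using fin[OF that] that unfolding subseteq_mset_def
    by (auto simp: count_mset_set' simp flip: count_greater_zero_iff)
  have "mps_coeff (g_series a s * g_series (- 1) r) M =
      mps_coeff (g_series (- 1) r * g_series a s) M" by (simp add: mult.commute)
  also have "\<dots> = (\<Sum>N | N \<subseteq># M. mps_coeff (g_series (- 1) r) N * mps_coeff (g_series a s) (M - N))"
    by (simp add: times_mps.rep_eq)
  also have "\<dots> = (\<Sum>N\<in>mset_set ` {S. S \<subseteq> set_mset M \<and> card S = r}.
      (- 1) ^ r * mps_coeff (g_series a s) (M - N))"
  proof (rule sum.mono_neutral_cong_right[OF finite_submultisets])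
    show "mset_set ` {S. S \<subseteq> set_mset M \<and> card S = r} \<subseteq> {N. N \<subseteq># M}" using sub by auto
    show "\<forall>N\<in>{N. N \<subseteq># M} - mset_set ` {S. S \<subseteq> set_mset M \<and> card S = r}.
        mps_coeff (g_series (- 1) r) N * mps_coeff (g_series a s) (M - N) = 0"
    proof
      fix N assume N: "N \<in> {N. N \<subseteq># M} - mset_set ` {S. S \<subseteq> set_mset M \<and> card S = r}"
      then have "set_mset N \<subseteq> set_mset M" by (auto dest: mset_subset_eqD)
      then have "\<not> (N = mset_set (set_mset N) \<and> card (set_mset N) = r)" using N by blast
      then have "mps_coeff (g_series (- 1 :: 'a) r) N = 0"
        unfolding coeff_elementary by (rule if_not_P)
      then show "mps_coeff (g_series (- 1) r) N * mps_coeff (g_series a s) (M - N) = 0" by simp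
    qed
    fix N assume "N \<in> mset_set ` {S. S \<subseteq> set_mset M \<and> card S = r}"
    then show "mps_coeff (g_series (- 1) r) N * mps_coeff (g_series a s) (M - N) =
        (- 1) ^ r * mps_coeff (g_series a s) (M - N)"
      using fin by (auto simp: coeff_elementary)
  qed
  also have "\<dots> = (\<Sum>S | S \<subseteq> set_mset M \<and> card S = r. (- 1) ^ r * mps_coeff (g_series a s) (M - mset_set S))"
    by (simp add: sum.reindex[OF inj])
  finally show ?thesis by (simp add: sum_distrib_left)
qed

lemma coeff_hook_summand:
  "mps_coeff (hook_summand a n r) M = (of_nat n + (a - 1) * of_nat r) * (- 1) ^ r *
     (\<Sum>S | S \<subseteq> set_mset M \<and> card S = r. mps_coeff (g_series a (n - r)) (M - mset_set S))"
  by (simp add: hook_summand_def mps_scale.rep_eq coeff_g_elementary mult.assoc)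

lemma coeff_hook_summand_0:
  assumes "card (set_mset M) < r"
  shows "mps_coeff (hook_summand a n r) M = 0"
proof -
  have "card S \<noteq> r" if "S \<subseteq> set_mset M" for S
    using card_mono[OF _ that] assms by simp
  then have S: "{S. S \<subseteq> set_mset M \<and> card S = r} = {}" by blast
  show ?thesis unfolding coeff_hook_summand S by simp
qed

text \<open>The tail serves monomials in few variables; for the squarefree monomial of degree n the
  head is summed directly.\<close>

lemma coeff_hook_function_tail:
  assumes "l \<le> n"
  shows "mps_coeff (hook_function a n l) M = - (\<Sum>r\<in>{l<..n}. mps_coeff (hook_summand a n r) M)"
proof -
  have "{..n} = {..l} \<union> {l<..n}" using assms by auto
  then have "hook_function a n n = hook_function a n l + (\<Sum>r\<in>{l<..n}. hook_summand a n r)"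
    unfolding hook_function_def by (simp add: sum.union_disjoint disjoint_iff)
  then have "mps_coeff (hook_function a n l) M + (\<Sum>r\<in>{l<..n}. mps_coeff (hook_summand a n r) M) = 0"
    by (metis hook_function_full mps_coeff_sum plus_mps.rep_eq zero_mps.rep_eq)
  then show ?thesis by (simp add: add_eq_0_iff)
qed

lemma coeff_hook_function_few_variables:
  assumes "l \<le> n" "card (set_mset M) \<le> l"
  shows "mps_coeff (hook_function a n l) M = 0"
  using assms by (simp add: coeff_hook_function_tail coeff_hook_summand_0)

text \<open>With exactly l + 1 variables only r = l + 1 survives in the tail, with all variables
  chosen. The sign is - (-1)^(l + 1) = (-1)^l.\<close>

lemma coeff_hook_function_leading:
  assumes "l < n" "card (set_mset M) = Suc l"
  shows "mps_coeff (hook_function a n l) M = (- 1) ^ l * (of_nat n + (a - 1) * of_nat (Suc l)) *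
    mps_coeff (g_series a (n - Suc l)) (M - mset_set (set_mset M))"
proof -
  have "S = set_mset M" if "S \<subseteq> set_mset M" "card S = Suc l" for S
    using that assms(2) by (intro card_subset_eq) auto
  then have S: "{S. S \<subseteq> set_mset M \<and> card S = Suc l} = {set_mset M}" using assms(2) by blast
  have "(\<Sum>r\<in>{l<..n}. mps_coeff (hook_summand a n r) M) =
      (\<Sum>r\<in>{l<..n}. if r = Suc l then mps_coeff (hook_summand a n (Suc l)) M else 0)"
    using assms(2) by (intro sum.cong refl) (auto intro: coeff_hook_summand_0)
  also have "\<dots> = mps_coeff (hook_summand a n (Suc l)) M" using assms(1) by simp
  finally show ?thesis
    using assms(1) by (simp add: coeff_hook_function_tail coeff_hook_summand S)
qed

text \<open>Let t_r = (n - r) (n choose r) a^(n - r). As r (n choose r) = (n - r + 1) (n choose (r -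
  1)), the r-th summand is (-1)^r (t_r + t_(r - 1)), and the sum telescopes.\<close>

lemma coeff_hook_function_squarefree:
  assumes "l \<le> n"
  shows "mps_coeff (hook_function a n l) (mset_set {..<n}) =
    (- 1) ^ l * of_nat ((n - l) * (n choose l)) * a ^ (n - l)"
proof -
  have summand: "mps_coeff (hook_summand a n r) (mset_set {..<n}) =
      (of_nat n + (a - 1) * of_nat r) * (- 1) ^ r * (of_nat (n choose r) * a ^ (n - r))" for r
  proof -
    have "mps_coeff (g_series a (n - r)) (mset_set {..<n} - mset_set S) = a ^ (n - r)"
      if "S \<subseteq> {..<n}" "card S = r" for S
    proof -
      have fin: "finite S" using finite_subset[OF that(1)] by simp
      have "mset_set {..<n} - mset_set S = mset_set ({..<n} - S)"
        using that(1) by (simp add: mset_set_Diff)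
      moreover have "card ({..<n} - S) = n - r" using that fin by (simp add: card_Diff_subset)
      ultimately show ?thesis by (simp add: coeff_g_series rising_coeff_def)
    qed
    then have "(\<Sum>S | S \<subseteq> {..<n} \<and> card S = r. mps_coeff (g_series a (n - r)) (mset_set {..<n} - mset_set S)) =
        (\<Sum>S | S \<subseteq> {..<n} \<and> card S = r. a ^ (n - r))" by simp
    then show ?thesis by (simp add: coeff_hook_summand n_subsets)
  qed
  have "(\<Sum>r\<le>l. (of_nat n + (a - 1) * of_nat r) * (- 1) ^ r * (of_nat (n choose r) * a ^ (n - r))) =
      (- 1) ^ l * of_nat ((n - l) * (n choose l)) * a ^ (n - l)"
    using assms
  proof (induction l)
    case (Suc l)
    then obtain k where k: "n = Suc l + k" by (metis le_Suc_ex)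
    have nl: "n - l = Suc k" "n - Suc l = k" using k by auto
    have eq: "(n - l) * (n choose l) = Suc l * (n choose Suc l)"
      using Suc.prems by (metis binomial_absorb_comp binomial_absorption diff_Suc_Suc mult.commute)
    note IH = Suc.IH[OF Suc_leD[OF Suc.prems], unfolded eq, unfolded nl(1)]
    have "of_nat n + (a - 1) * of_nat (Suc l) = of_nat k + a * of_nat (Suc l)"
      unfolding k of_nat_add by (simp add: algebra_simps)
    note n = this
    show ?case
      unfolding sum.atMost_Suc IH n nl(2) of_nat_mult by (simp add: algebra_simps del: of_nat_Suc)
  qed simp
  then show ?thesis by (simp add: hook_function_def mps_coeff_sum summand)
qed

section \<open>The scalar products\<close>

text \<open>The form is defined through coefficients, so its linearity is derived in a fixed degree,
  where the products of power sums span.\<close>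

lemma jack_inner_add_left:
  fixes \<beta> :: "'a::linordered_field"
  assumes "f \<in> sym_homog n" "g \<in> sym_homog n" "h \<in> sym_homog n"
  shows "jack_inner \<beta> (f + g) h = jack_inner \<beta> f h + jack_inner \<beta> g h"
proof -
  from assms obtain x y z where xyz:
    "f = (\<Sum>A\<in>mpartitions n. mps_scale (x A) (power_prod A))"
    "g = (\<Sum>A\<in>mpartitions n. mps_scale (y A) (power_prod A))"
    "h = (\<Sum>A\<in>mpartitions n. mps_scale (z A) (power_prod A))"
    by (metis power_prod_span)
  have fg: "f + g = (\<Sum>A\<in>mpartitions n. mps_scale (x A + y A) (power_prod A))"
    by (simp add: xyz mps_scale_add_left sum.distrib)
  show ?thesis unfolding fg unfolding xyz jack_inner_sum by (simp add: sum.distrib algebra_simps)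
qed

lemma jack_inner_scale_left:
  fixes \<beta> :: "'a::linordered_field"
  assumes "f \<in> sym_homog n" "h \<in> sym_homog n"
  shows "jack_inner \<beta> (mps_scale c f) h = c * jack_inner \<beta> f h"
proof -
  from assms obtain x z where xz:
    "f = (\<Sum>A\<in>mpartitions n. mps_scale (x A) (power_prod A))"
    "h = (\<Sum>A\<in>mpartitions n. mps_scale (z A) (power_prod A))"
    by (metis power_prod_span)
  have cf: "mps_scale c f = (\<Sum>A\<in>mpartitions n. mps_scale (c * x A) (power_prod A))"
    by (simp add: xz mps_scale_sum mps_scale_scale)
  show ?thesis unfolding cf unfolding xz jack_inner_sum by (simp add: sum_distrib_left algebra_simps)
qed

lemma jack_inner_commute:
  fixes \<beta> :: "'a::linordered_field"
  assumes "f \<in> sym_homog n" "h \<in> sym_homog n"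
  shows "jack_inner \<beta> f h = jack_inner \<beta> h f"
proof -
  from assms obtain x z where xz:
    "f = (\<Sum>A\<in>mpartitions n. mps_scale (x A) (power_prod A))"
    "h = (\<Sum>A\<in>mpartitions n. mps_scale (z A) (power_prod A))"
    by (metis power_prod_span)
  show ?thesis unfolding xz jack_inner_sum by (simp add: mult_ac)
qed

text \<open>In power sum coordinates the form is a sum of squares with positive weights.\<close>

lemma jack_inner_definite:
  fixes \<beta> :: "'a::linordered_field"
  assumes "\<beta> > 0" "f \<in> sym_homog n" "jack_inner \<beta> f f = 0"
  shows "f = 0"
proof -
  from assms obtain x where x: "f = (\<Sum>A\<in>mpartitions n. mps_scale (x A) (power_prod A))"
    by (metis power_prod_span)
  have pos: "of_nat (z_mset A) * \<beta> ^ size A > 0" if "A \<in> mpartitions n" for A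
    using that z_mset_pos[of A] assms(1) by (simp add: mpartitions_def)
  have "(\<Sum>A\<in>mpartitions n. x A * x A * (of_nat (z_mset A) * \<beta> ^ size A)) = 0"
    using assms(3) unfolding x jack_inner_sum .
  then have "\<forall>A\<in>mpartitions n. x A * x A * (of_nat (z_mset A) * \<beta> ^ size A) = 0"
    using pos by (subst (asm) sum_nonneg_eq_0_iff) (auto simp: finite_mpartitions less_imp_le)
  then have "x A = 0" if "A \<in> mpartitions n" for A
    using that pos[OF that] by (metis less_irrefl mult_eq_0_iff)
  then show ?thesis unfolding x by (intro mps_eqI) (simp add: mps_coeff_sum mps_coeff_simps)
qed

lemma zero_sym_homog: "(0 :: 'a::field mps) \<in> sym_homog n"
  using mps.subspace_0[OF sym_homog_subspace, of n] .

lemma jack_inner_sum_left: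
  fixes \<beta> :: "'a::linordered_field"
  assumes "\<And>i. i \<in> S \<Longrightarrow> f i \<in> sym_homog n" "h \<in> sym_homog n"
  shows "jack_inner \<beta> (\<Sum>i\<in>S. mps_scale (c i) (f i)) h = (\<Sum>i\<in>S. c i * jack_inner \<beta> (f i) h)"
  using assms(1)
proof (induction S rule: infinite_finite_induct)
  case (insert i S)
  have "(\<Sum>i\<in>S. mps_scale (c i) (f i)) \<in> sym_homog n"
    using insert.prems by (intro mps.subspace_sum mps.subspace_scale sym_homog_subspace) auto
  moreover have "mps_scale (c i) (f i) \<in> sym_homog n"
    using insert.prems by (intro mps.subspace_scale sym_homog_subspace) auto
  ultimately show ?case
    using insert assms(2) by (simp add: jack_inner_add_left[of _ n] jack_inner_scale_left[of _ n])
qed (use jack_inner_scale_left[OF zero_sym_homog assms(2), of \<beta> 0] in auto)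

text \<open>In the Schur expansion of \<open>f\<close>, a term of maximal height also appears as a
  monomial of \<open>f\<close>, so no term is higher than \<mu>. The coefficient of
  \<open>schur \<mu>\<close> is therefore a leading coefficient.\<close>

lemma hall_inner_schur:
  assumes "f \<in> sym_homog n" "\<mu> \<in> partitions n"
    and "\<And>\<kappa>. \<kappa> \<in> partitions n \<Longrightarrow> mps_coeff f (partition_monomial \<kappa>) \<noteq> 0 \<Longrightarrow>
      sum_mset (partition_monomial \<mu>) \<le> sum_mset (partition_monomial \<kappa>)"
  shows "hall_inner f (schur \<mu>) = mps_coeff f (partition_monomial \<mu>)"
proof -
  let ?h = "\<lambda>\<nu>. - int (sum_mset (partition_monomial \<nu>))"
  obtain x where x: "f = (\<Sum>\<nu>\<in>partitions n. mps_scale (x \<nu>) (schur \<nu>))"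
    using triangular_span[OF triangular_schur assms(1)] by blast
  note leading = triangular_leading[OF triangular_schur finite_partitions partitions_is_partition,
      of _ n x, folded x]
  have le: "?h \<kappa> \<le> ?h \<mu>" if "\<kappa> \<in> partitions n" "x \<kappa> \<noteq> 0" for \<kappa>
  proof -
    let ?T = "{\<kappa> \<in> partitions n. x \<kappa> \<noteq> 0}"
    have fin: "finite ?T" "?T \<noteq> {}" using that finite_partitions by auto
    then have "Max (?h ` ?T) \<in> ?h ` ?T" by (intro Max_in) auto
    then obtain \<eta> where \<eta>: "\<eta> \<in> ?T" "?h \<eta> = Max (?h ` ?T)" by force
    have max: "?h \<kappa> \<le> ?h \<eta>" if "\<kappa> \<in> ?T" for \<kappa>
      unfolding \<eta>(2) using fin that by (intro Max_ge) auto
    have "mps_coeff f (partition_monomial \<eta>) = x \<eta> * mps_coeff (schur \<eta>) (partition_monomial \<eta>)"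
      by (rule leading) (use \<eta> max in auto)
    also have "\<dots> \<noteq> 0"
      using \<eta>(1) coeff_schur_diagonal[of \<eta>, where 'a = 'a] by (auto simp: partitions_def)
    finally have "sum_mset (partition_monomial \<mu>) \<le> sum_mset (partition_monomial \<eta>)"
      using assms(3)[of \<eta>] \<eta>(1) by simp
    then have "?h \<eta> \<le> ?h \<mu>" unfolding neg_le_iff_le of_nat_le_iff .
    then show ?thesis using max[of \<kappa>] that by simp
  qed
  have "mps_coeff f (partition_monomial \<mu>) = x \<mu> * mps_coeff (schur \<mu>) (partition_monomial \<mu>)"
    by (rule leading[OF assms(2) le])
  also have "\<dots> = x \<mu>" using assms(2) by (simp add: coeff_schur_diagonal partitions_def)
  finally have \<mu>: "mps_coeff f (partition_monomial \<mu>) = x \<mu>" .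
  have C: "basis_coeff schur f \<nu> = (if \<nu> \<in> partitions n then x \<nu> else 0)" if "is_partition \<nu>" for \<nu>
    unfolding x by (rule basis_coeff_sum[OF triangular_schur finite_partitions partitions_is_partition that])
  have "(schur \<mu> :: 'a mps) = (\<Sum>\<kappa>\<in>{\<mu>}. mps_scale 1 (schur \<kappa>))" by simp
  moreover have "basis_coeff schur (\<Sum>\<kappa>\<in>{\<mu>}. mps_scale 1 (schur \<kappa> :: 'a mps)) \<nu> = (if \<nu> \<in> {\<mu>} then 1 else 0)"
    if "is_partition \<nu>" for \<nu>
    by (rule basis_coeff_sum[OF triangular_schur _ _ that]) (use assms(2) in \<open>auto simp: partitions_def\<close>)
  ultimately have S: "basis_coeff schur (schur \<mu> :: 'a mps) \<nu> = (if \<nu> = \<mu> then 1 else 0)"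
    if "is_partition \<nu>" for \<nu> using that by (metis singleton_iff)
  let ?U = "{\<nu>. is_partition \<nu> \<and> basis_coeff schur f \<nu> \<noteq> 0}"
  have sub: "?U \<subseteq> partitions n"
  proof safe
    fix \<nu> assume "is_partition \<nu>" "basis_coeff schur f \<nu> \<noteq> 0"
    then show "\<nu> \<in> partitions n" using C[of \<nu>] by (simp split: if_splits)
  qed
  have "hall_inner f (schur \<mu>) =
      (\<Sum>\<nu>\<in>?U. basis_coeff schur f \<nu> * basis_coeff schur (schur \<mu>) \<nu> * 1)"
    unfolding hall_inner_def orthogonal_form_def ..
  also have "\<dots> = (\<Sum>\<nu>\<in>?U. if \<nu> = \<mu> then x \<mu> else 0)"
  proof (rule sum.cong[OF refl])
    fix \<nu> assume "\<nu> \<in> ?U"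
    then have "is_partition \<nu>" "\<nu> \<in> partitions n" using sub by auto
    then show "basis_coeff schur f \<nu> * basis_coeff schur (schur \<mu>) \<nu> * 1 = (if \<nu> = \<mu> then x \<mu> else 0)"
      using C[of \<nu>] S[of \<nu>] by simp
  qed
  also have "\<dots> = x \<mu>"
    using finite_subset[OF sub finite_partitions] C[of \<mu>] assms(2) by (auto simp: partitions_def)
  finally show ?thesis using \<mu> by simp
qed

section \<open>Jack functions of hooks\<close>

lemma symmetric_functions_swap_invariant: "f \<in> symmetric_functions \<Longrightarrow> swap_invariant f"
  by (simp add: symmetric_functions_def swap_invariant_def)

text \<open>Homogeneity of the Jack functions is not part of their characterization, so the
  expansion runs over all degrees up to a bound \<open>d\<close>.\<close>

lemma basis_coeff_monomial_sym:
  fixes f :: "'a::field mps"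
  assumes "f \<in> symmetric_functions" "is_partition \<nu>"
  shows "basis_coeff monomial_sym f \<nu> = mps_coeff f (partition_monomial \<nu>)"
proof -
  obtain d where d: "\<And>M. size M > d \<Longrightarrow> mps_coeff f M = 0"
    using assms(1) by (auto simp: symmetric_functions_def)
  let ?S = "\<Union>k\<le>d. partitions k"
  have fin: "finite ?S" by (simp add: finite_partitions)
  have sub: "?S \<subseteq> Collect is_partition" using partitions_is_partition by blast
  have mem: "\<nu> \<in> ?S" if "is_partition \<nu>" "mps_coeff f (partition_monomial \<nu>) \<noteq> 0" for \<nu>
  proof -
    have "size (partition_monomial \<nu>) \<le> d" using that(2) d not_less by blast
    then show ?thesis
      using that(1) by (auto simp: size_partition_monomial partitions_def is_partition_def)
  qed
  have f: "f = (\<Sum>\<nu>\<in>?S. mps_scale (mps_coeff f (partition_monomial \<nu>)) (monomial_sym \<nu>))"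
    using symmetric_functions_swap_invariant[OF assms(1)] fin sub mem by (rule swap_invariant_expansion)
  have "basis_coeff monomial_sym f \<nu> = (if \<nu> \<in> ?S then mps_coeff f (partition_monomial \<nu>) else 0)"
    by (subst f) (rule basis_coeff_sum[OF triangular_monomial_sym fin sub assms(2)])
  then show ?thesis using mem[OF assms(2)] by auto
qed

text \<open>Otherwise the first \<open>length \<kappa>\<close> parts of \<nu> would already have the
  full sum, leaving nothing for the later parts.\<close>

lemma dominated_by_length:
  assumes "is_partition \<kappa>" "is_partition \<nu>" "dominated_by \<kappa> \<nu>"
  shows "length \<nu> \<le> length \<kappa>"
proof (rule ccontr)
  assume "\<not> ?thesis"
  then have "drop (length \<kappa>) \<nu> \<noteq> []" by simp
  moreover have "0 \<notin> set (drop (length \<kappa>) \<nu>)"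
    using assms(2) by (auto simp: is_partition_def dest: in_set_dropD)
  ultimately have "sum_list (drop (length \<kappa>) \<nu>) > 0"
    using length_le_sum_list[of "drop (length \<kappa>) \<nu>"] by (cases "drop (length \<kappa>) \<nu>") auto
  moreover have "sum_list \<kappa> \<le> sum_list (take (length \<kappa>) \<nu>)"
    using assms(3) by (auto simp: dominated_by_def dest: spec[of _ "length \<kappa>"])
  moreover have "sum_list \<nu> = sum_list (take (length \<kappa>) \<nu>) + sum_list (drop (length \<kappa>) \<nu>)"
    by (metis append_take_drop_id sum_list_append)
  ultimately show False using assms(3) by (simp add: dominated_by_def)
qed

text \<open>The part with index i occurs in L - i of the partial sums and i times in the index sum,
  hence L times in all.\<close>

lemma sum_mset_partition_monomial:
  assumes "length \<nu> \<le> L"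
  shows "sum_mset (partition_monomial \<nu>) + (\<Sum>i<L. sum_list (take (Suc i) \<nu>)) = L * sum_list \<nu>"
  using assms
proof (induction \<nu> rule: rev_induct)
  case (snoc x \<nu>)
  let ?j = "length \<nu>"
  have "partition_monomial (\<nu> @ [x]) = partition_monomial \<nu> + replicate_mset x ?j"
    unfolding partition_monomial_def by (simp add: nth_append)
  then have 1: "sum_mset (partition_monomial (\<nu> @ [x])) = sum_mset (partition_monomial \<nu>) + x * ?j"
    by simp
  have "sum_list (take (Suc i) (\<nu> @ [x])) = sum_list (take (Suc i) \<nu>) + (if ?j \<le> i then x else 0)" for i
    by (auto simp: not_le Suc_diff_le)
  then have "(\<Sum>i<L. sum_list (take (Suc i) (\<nu> @ [x]))) =
      (\<Sum>i<L. sum_list (take (Suc i) \<nu>)) + (\<Sum>i<L. if ?j \<le> i then x else 0)"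
    by (simp only: sum.distrib)
  also have "(\<Sum>i<L. if ?j \<le> i then x else 0) = (\<Sum>i\<in>{?j..<L}. x)"
    by (rule sum.mono_neutral_cong_right) auto
  also have "\<dots> = (L - ?j) * x" by simp
  finally have 2: "(\<Sum>i<L. sum_list (take (Suc i) (\<nu> @ [x]))) =
      (\<Sum>i<L. sum_list (take (Suc i) \<nu>)) + (L - ?j) * x" .
  have "x * ?j + (L - ?j) * x = (?j + (L - ?j)) * x"
    by (simp only: add_mult_distrib mult.commute[of x])
  also have "\<dots> = L * x" using snoc.prems by simp
  finally have "x * ?j + (L - ?j) * x = L * x" .
  moreover have "L * sum_list (\<nu> @ [x]) = L * sum_list \<nu> + L * x" by (simp add: distrib_left)
  moreover have "sum_mset (partition_monomial \<nu>) + (\<Sum>i<L. sum_list (take (Suc i) \<nu>)) = L * sum_list \<nu>"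
    using snoc by simp
  ultimately show ?case unfolding 1 2 by linarith
qed (simp add: partition_monomial_def)

text \<open>Larger partial sums mean a smaller index sum, which links dominance to the height of the
  Schur functions.\<close>

lemma dominated_by_sum_mset:
  assumes "dominated_by \<kappa> \<nu>"
  shows "sum_mset (partition_monomial \<nu>) \<le> sum_mset (partition_monomial \<kappa>)"
proof -
  let ?L = "max (length \<kappa>) (length \<nu>)"
  have "(\<Sum>i<?L. sum_list (take (Suc i) \<kappa>)) \<le> (\<Sum>i<?L. sum_list (take (Suc i) \<nu>))"
    using assms by (intro sum_mono) (simp add: dominated_by_def)
  moreover have "sum_list \<kappa> = sum_list \<nu>" using assms by (simp add: dominated_by_def)
  ultimately show ?thesis
    using sum_mset_partition_monomial[of \<kappa> ?L] sum_mset_partition_monomial[of \<nu> ?L] by simp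
qed

lemma jack_family_coeff:
  assumes "jack_family \<beta> J" "is_partition \<mu>" "is_partition \<nu>"
    and "mps_coeff (J \<mu>) (partition_monomial \<nu>) \<noteq> 0"
  shows "dominated_by \<nu> \<mu>"
  using assms basis_coeff_monomial_sym[of "J \<mu>" \<nu>] unfolding jack_family_def by metis

text \<open>Triangularity forces homogeneity, since dominance includes equality of the sums.\<close>

lemma jack_family_sym_homog:
  assumes "jack_family \<beta> J" "\<mu> \<in> partitions n"
  shows "J \<mu> \<in> sym_homog n"
proof -
  have \<mu>: "is_partition \<mu>" "sum_list \<mu> = n" using assms(2) by (auto simp: partitions_def)
  have sf: "J \<mu> \<in> symmetric_functions" using assms(1) \<mu>(1) by (simp add: jack_family_def)
  note swap = symmetric_functions_swap_invariant[OF sf]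
  have "size M = n" if M: "mps_coeff (J \<mu>) M \<noteq> 0" for M
  proof -
    obtain \<nu> where \<nu>: "is_partition \<nu>" "mset \<nu> = exponents M"
      "mps_coeff (J \<mu>) M = mps_coeff (J \<mu>) (partition_monomial \<nu>)"
      using sorted_monomial[of M] swap by blast
    have "sum_list \<nu> = n"
      using jack_family_coeff[OF assms(1) \<mu>(1) \<nu>(1)] M \<nu>(3) \<mu>(2) by (simp add: dominated_by_def)
    then show ?thesis using \<nu>(2) size_exponents[of M] by (metis sum_mset_sum_list)
  qed
  then show ?thesis using swap by (simp add: sym_homog_def)
qed

section \<open>The hook and the space below it\<close>

lemma is_partition_replicate: "is_partition (replicate n 1)"
  by (simp add: is_partition_def sorted_wrt_iff_nth_less)

lemma partition_monomial_replicate: "partition_monomial (replicate n 1) = mset_set {..<n}"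
  by (rule multiset_eqI) (simp add: count_partition_monomial count_mset_set')

lemma jack_family_squarefree:
  assumes "jack_family \<beta> J" "\<mu> \<in> partitions n"
  shows "mps_coeff (J \<mu>) (mset_set {..<n}) = fact n"
proof -
  have \<mu>: "is_partition \<mu>" "sum_list \<mu> = n" using assms(2) by (auto simp: partitions_def)
  have sf: "J \<mu> \<in> symmetric_functions" using assms(1) \<mu>(1) by (simp add: jack_family_def)
  show ?thesis
    using assms(1) \<mu> basis_coeff_monomial_sym[OF sf is_partition_replicate[of n]]
    by (auto simp: jack_family_def partition_monomial_replicate[unfolded One_nat_def])
qed

definition hook :: "nat \<Rightarrow> nat \<Rightarrow> nat list" where
  "hook n l = (n - l) # replicate l 1"

lemma hook_partitions: "l < n \<Longrightarrow> hook n l \<in> partitions n"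
  using is_partition_replicate[of l]
  by (auto simp: hook_def partitions_def is_partition_def sum_list_replicate)

lemma size_le_sum_mset: "0 \<notin># B \<Longrightarrow> size B \<le> sum_mset (B :: nat multiset)"
  by (induction B) auto

lemma sum_mset_minimal: "0 \<notin># B \<Longrightarrow> sum_mset B \<le> size B \<Longrightarrow> B = replicate_mset (size B) (1 :: nat)"
proof (induction B)
  case (add x B)
  then have "size B \<le> sum_mset B" using size_le_sum_mset[of B] by simp
  with add show ?case by simp
qed simp

text \<open>A part of size at least n - l leaves at most l for the other parts, of which there are
  at least l, so these are all 1.\<close>

lemma hook_unique:
  assumes "\<nu> \<in> partitions n" "l < n" "Suc l \<le> length \<nu>" "s \<in> set \<nu>" "n - l \<le> s"
  shows "\<nu> = hook n l"
proof -
  have "s \<in># mset \<nu>" using assms(4) by simp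
  then obtain B where B: "mset \<nu> = add_mset s B" using multi_member_split by metis
  have nz: "0 \<notin># mset \<nu>" using assms(1) by (simp add: partitions_def is_partition_def)
  have "sum_mset (mset \<nu>) = n" using assms(1) by (simp add: partitions_def sum_mset_sum_list)
  then have sumB: "s + sum_mset B = n" using B by simp
  have "size (mset \<nu>) = Suc (size B)" using B by simp
  then have sizeB: "l \<le> size B" using assms(3) by simp
  have "0 \<notin># B" using nz B by simp
  then have "sum_mset B = l" "size B = l" "B = replicate_mset (size B) 1"
    using size_le_sum_mset[of B] sum_mset_minimal[of B] sumB sizeB assms(2,5) by auto
  then have "mset \<nu> = mset (hook n l)" using B sumB by (auto simp: hook_def)
  then show ?thesis
    using assms(1) hook_partitions[OF assms(2)] by (auto simp: partitions_def intro: partition_mset_inj)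
qed

text \<open>The partitions strictly below the hook in the dominance order.\<close>

definition below_hook :: "nat \<Rightarrow> nat \<Rightarrow> nat list set" where
  "below_hook n l = {\<nu> \<in> partitions n. Suc l \<le> length \<nu> \<and> \<nu> \<noteq> hook n l}"

definition below_hook_space :: "nat \<Rightarrow> nat \<Rightarrow> 'a::field mps set" where
  "below_hook_space n l = {f \<in> sym_homog n.
     \<forall>\<nu>\<in>partitions n. mps_coeff f (partition_monomial \<nu>) \<noteq> 0 \<longrightarrow> \<nu> \<in> below_hook n l}"

lemma below_hook_partitions: "below_hook n l \<subseteq> partitions n"
  by (auto simp: below_hook_def)

text \<open>A monomial seen by the slice has the exponent n - r \<ge> n - l, which by
  \<open>hook_unique\<close> does not occur below the hook.\<close>

lemma slice_below_hook:
  assumes "f \<in> below_hook_space n l" "l < n" "r \<le> l"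
  shows "slice (n - r) f = 0"
proof (rule mps_eqI, rule ccontr)
  fix M
  let ?N = "replicate_mset (n - r) 0 + image_mset Suc M"
  assume "mps_coeff (slice (n - r) f) M \<noteq> mps_coeff 0 M"
  then have N: "mps_coeff f ?N \<noteq> 0" by (simp add: coeff_slice zero_mps.rep_eq)
  have f: "f \<in> sym_homog n" using assms(1) by (simp add: below_hook_space_def)
  obtain \<nu> where \<nu>: "is_partition \<nu>" "mset \<nu> = exponents ?N"
    "mps_coeff f ?N = mps_coeff f (partition_monomial \<nu>)"
    using sorted_monomial[of ?N] f by (auto simp: sym_homog_def)
  have "size ?N = n" using N f unfolding sym_homog_def by blast
  then have "sum_list \<nu> = n" using \<nu>(2) size_exponents[of ?N] by (metis sum_mset_sum_list)
  then have part: "\<nu> \<in> partitions n" using \<nu>(1) by (simp add: partitions_def)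
  then have "\<nu> \<in> below_hook n l" using assms(1) N \<nu>(3) by (auto simp: below_hook_space_def)
  moreover have "n - r \<in> set \<nu>"
  proof -
    have c: "count ?N 0 = n - r" by (simp add: count_image_Suc)
    then have "0 \<in># ?N" using assms(2,3) by (simp flip: count_greater_zero_iff)
    then have "n - r \<in> count ?N ` set_mset ?N" using c by (metis image_eqI)
    then have "n - r \<in># exponents ?N" by (simp only: exponents_def set_image_mset finite_set_mset_mset_set finite_set_mset)
    then show ?thesis using \<nu>(2) by (metis set_mset_mset)
  qed
  ultimately show False
    using hook_unique[OF part assms(2), of "n - r"] diff_le_mono2[OF assms(3), of n]
    by (auto simp: below_hook_def)
qed

text \<open>Going down in dominance does not lower the number of parts, and it cannot reach the
  hook, because the first part of \<nu> is already smaller than n - l.\<close>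

lemma jack_family_below_hook:
  assumes "jack_family \<beta> J" "l < n" "\<nu> \<in> below_hook n l"
  shows "J \<nu> \<in> below_hook_space n l"
proof -
  have \<nu>: "\<nu> \<in> partitions n" "is_partition \<nu>" "Suc l \<le> length \<nu>" "\<nu> \<noteq> hook n l"
    using assms(3) by (auto simp: below_hook_def partitions_def)
  have "\<kappa> \<in> below_hook n l" if \<kappa>: "\<kappa> \<in> partitions n" "mps_coeff (J \<nu>) (partition_monomial \<kappa>) \<noteq> 0" for \<kappa>
  proof -
    have p: "is_partition \<kappa>" using \<kappa>(1) by (simp add: partitions_def)
    have dom: "dominated_by \<kappa> \<nu>" by (rule jack_family_coeff[OF assms(1) \<nu>(2) p \<kappa>(2)])
    have "\<kappa> \<noteq> hook n l"
    proof
      assume k: "\<kappa> = hook n l"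
      obtain s \<nu>' where s: "\<nu> = s # \<nu>'" using \<nu>(3) by (cases \<nu>) auto
      have "sum_list (take 1 \<kappa>) \<le> sum_list (take 1 \<nu>)" using dom by (simp add: dominated_by_def)
      then have "n - l \<le> s" by (simp add: k s hook_def)
      then show False using hook_unique[OF \<nu>(1) assms(2) \<nu>(3), of s] \<nu>(4) s by simp
    qed
    then show ?thesis
      using \<kappa>(1) dominated_by_length[OF p \<nu>(2) dom] \<nu>(3) by (simp add: below_hook_def)
  qed
  then show ?thesis
    using jack_family_sym_homog[OF assms(1) \<nu>(1)] by (simp add: below_hook_space_def)
qed

text \<open>
  Pairwise orthogonality makes the Jack functions below the hook independent, so that they are a
  basis of the space, by counting.
\<close>

lemma below_hook_space_span:
  fixes \<beta> :: "'a::linordered_field"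
  assumes J: "jack_family \<beta> J" and "\<beta> > 0" "l < n"
  shows "below_hook_space n l \<subseteq> mps.span (J ` below_hook n l)"
proof -
  let ?D = "below_hook n l" and ?m = "monomial_sym :: nat list \<Rightarrow> 'a mps"
  have sub: "?D \<subseteq> Collect is_partition" using below_hook_partitions partitions_is_partition by blast
  have fin: "finite ?D" using finite_subset[OF below_hook_partitions finite_partitions] .
  have hom: "J \<nu> \<in> sym_homog n" if "\<nu> \<in> ?D" for \<nu>
    using jack_family_sym_homog[OF J] that below_hook_partitions by blast
  \<comment> \<open>\<open>J \<nu>\<close> is nonzero because of its squarefree coefficient n!, and
    the form is definite.\<close>
  have nz: "jack_inner \<beta> (J \<nu>) (J \<nu>) \<noteq> 0" if "\<nu> \<in> ?D" for \<nu>
  proof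
    assume "jack_inner \<beta> (J \<nu>) (J \<nu>) = 0"
    then have "J \<nu> = 0" using jack_inner_definite[OF assms(2) hom[OF that]] by simp
    then show False
      using jack_family_squarefree[OF J, of \<nu> n] that below_hook_partitions[of n l]
      by (auto simp: zero_mps.rep_eq)
  qed
  have orth: "jack_inner \<beta> (J \<nu>) (J \<kappa>) = 0" if "\<nu> \<in> ?D" "\<kappa> \<in> ?D" "\<nu> \<noteq> \<kappa>" for \<nu> \<kappa>
    using J that sub unfolding jack_family_def by blast
  have inj: "inj_on J ?D"
    by (rule inj_onI) (metis nz orth)
  have indep: "mps.independent (J ` ?D)"
    unfolding mps.dependent_explicit
  proof safe
    fix T u v assume T: "finite T" "T \<subseteq> J ` ?D" "(\<Sum>v\<in>T. mps_scale (u v) v) = 0" "v \<in> T" "u v \<noteq> 0"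
    have homT: "w \<in> sym_homog n" if "w \<in> T" for w using that T(2) hom by auto
    have "jack_inner \<beta> (\<Sum>w\<in>T. mps_scale (u w) w) v = (\<Sum>w\<in>T. u w * jack_inner \<beta> w v)"
      by (rule jack_inner_sum_left) (use homT T(4) in auto)
    also have "\<dots> = (\<Sum>w\<in>T. if w = v then u v * jack_inner \<beta> v v else 0)"
    proof (rule sum.cong[OF refl])
      fix w assume "w \<in> T"
      with T obtain \<nu> \<kappa> where "w = J \<nu>" "v = J \<kappa>" "\<nu> \<in> ?D" "\<kappa> \<in> ?D" by blast
      then show "u w * jack_inner \<beta> w v = (if w = v then u v * jack_inner \<beta> v v else 0)"
        using orth by auto
    qed
    also have "\<dots> = u v * jack_inner \<beta> v v" using T(1,4) by simp
    finally have "u v * jack_inner \<beta> v v = 0"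
      using T(3) jack_inner_scale_left[OF zero_sym_homog homT[OF T(4)], of \<beta> 0] by simp
    moreover have "jack_inner \<beta> v v \<noteq> 0" using T(2,4) nz by auto
    ultimately show False using T(5) by simp
  qed
  have sp: "f \<in> mps.span (?m ` ?D)" if f: "f \<in> below_hook_space n l" for f
  proof -
    have "f = (\<Sum>\<nu>\<in>?D. mps_scale (mps_coeff f (partition_monomial \<nu>)) (monomial_sym \<nu>))"
    proof (rule swap_invariant_expansion[OF _ fin sub])
      show "swap_invariant f" using f by (simp add: below_hook_space_def sym_homog_def)
      fix \<nu> assume \<nu>: "is_partition \<nu>" "mps_coeff f (partition_monomial \<nu>) \<noteq> 0"
      then have "size (partition_monomial \<nu>) = n" using f by (simp add: below_hook_space_def sym_homog_def)
      then have "\<nu> \<in> partitions n"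
        using \<nu>(1) by (simp add: size_partition_monomial partitions_def is_partition_def)
      then show "\<nu> \<in> ?D" using f \<nu>(2) by (auto simp: below_hook_space_def)
    qed
    also have "\<dots> \<in> mps.span (?m ` ?D)"
      by (intro mps.span_sum mps.span_scale mps.span_base imageI)
    finally show ?thesis .
  qed
  have "inj_on ?m ?D" using triangular_inj[OF triangular_monomial_sym] sub by (rule inj_on_subset)
  then have "card (J ` ?D) = card (?m ` ?D)" using inj by (simp add: card_image)
  moreover have "J ` ?D \<subseteq> mps.span (?m ` ?D)"
    using sp jack_family_below_hook[OF J assms(3)] by blast
  ultimately have "mps.span (J ` ?D) = mps.span (?m ` ?D)"
    using fin indep by (intro mps.span_eq_of_card) auto
  then show ?thesis using sp by blast
qed

lemma jack_hook_orthogonal: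
  fixes \<beta> :: "'a::linordered_field"
  assumes J: "jack_family \<beta> J" and "\<beta> > 0" "l < n" and f: "f \<in> below_hook_space n l"
  shows "jack_inner \<beta> (J (hook n l)) f = 0"
proof -
  let ?D = "below_hook n l"
  have fin: "finite (J ` ?D)" using finite_subset[OF below_hook_partitions finite_partitions] by blast
  have hom: "v \<in> sym_homog n" if "v \<in> J ` ?D" for v
    using jack_family_sym_homog[OF J] that below_hook_partitions by blast
  note hook = hook_partitions[OF assms(3)]
  note homh = jack_family_sym_homog[OF J hook]
  have "f \<in> mps.span (J ` ?D)" using below_hook_space_span[OF assms(1-3)] f by blast
  then obtain u where u: "f = (\<Sum>v\<in>J ` ?D. mps_scale (u v) v)"
    by (auto simp: mps.span_finite[OF fin])
  have "jack_inner \<beta> f (J (hook n l)) = (\<Sum>v\<in>J ` ?D. u v * jack_inner \<beta> v (J (hook n l)))"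
    unfolding u by (rule jack_inner_sum_left[OF hom homh])
  also have "\<dots> = 0"
  proof (rule sum.neutral, safe)
    fix \<nu> assume "\<nu> \<in> ?D"
    then have "is_partition \<nu>" "is_partition (hook n l)" "\<nu> \<noteq> hook n l"
      using hook by (auto simp: below_hook_def partitions_def)
    then have "jack_inner \<beta> (J \<nu>) (J (hook n l)) = 0" using J by (simp add: jack_family_def)
    then show "u (J \<nu>) * jack_inner \<beta> (J \<nu>) (J (hook n l)) = 0" by simp
  qed
  finally show ?thesis
    using jack_inner_commute[OF homh, of f \<beta>] f by (simp add: below_hook_space_def)
qed

lemma hook_summand_sym_homog: "r \<le> n \<Longrightarrow> hook_summand a n r \<in> sym_homog n"
  for a :: "'a::linordered_field"
  using g_series_mult_sym_homog[of "n - r" n a "- 1"]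
  by (simp add: hook_summand_def mps.subspace_scale[OF sym_homog_subspace])

lemma hook_function_sym_homog: "l \<le> n \<Longrightarrow> hook_function a n l \<in> sym_homog n"
  for a :: "'a::linordered_field"
  unfolding hook_function_def
  by (intro mps.subspace_sum sym_homog_subspace hook_summand_sym_homog) auto

lemma hook_function_orthogonal:
  fixes a \<beta> :: "'a::linordered_field"
  assumes "a * \<beta> = 1" "l < n" and f: "f \<in> below_hook_space n l"
  shows "jack_inner \<beta> (hook_function a n l) f = 0"
proof -
  have hom: "f \<in> sym_homog n" using f by (simp add: below_hook_space_def)
  have "jack_inner \<beta> (g_series a (n - r) * g_series (- 1) r) f = 0" if "r \<le> l" for r
    using g_series_orthogonal[OF assms(1) _ hom slice_below_hook[OF f assms(2) that], of "- 1"]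
      that assms(2) by simp
  moreover have "g_series a (n - r) * g_series (- 1) r \<in> sym_homog n" if "r \<le> l" for r
    using g_series_mult_sym_homog[of "n - r" n a "- 1"] that assms(2) by simp
  ultimately show ?thesis
    unfolding hook_function_def hook_summand_def
    by (subst jack_inner_sum_left[of _ _ n]) (auto intro: hom)
qed

lemma card_set_partition_monomial: "is_partition \<nu> \<Longrightarrow> card (set_mset (partition_monomial \<nu>)) = length \<nu>"
  by (simp add: is_partition_def set_partition_monomial)

text \<open>Proportionality in cross-multiplied form. \<open>H\<close> is the combination whose
  coefficient at the hook cancels, so it lies in the space below the hook. Both of its terms are
  orthogonal to that space, so \<open>H\<close> is orthogonal to itself.\<close>

lemma jack_hook_proportional:
  fixes a \<beta> :: "'a::linordered_field"
  assumes J: "jack_family \<beta> J" and "\<beta> > 0" "a * \<beta> = 1" "l < n"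
  shows "mps_coeff (hook_function a n l) (partition_monomial (hook n l)) * fact n =
    mps_coeff (J (hook n l)) (partition_monomial (hook n l)) *
      mps_coeff (hook_function a n l) (mset_set {..<n})"
proof -
  let ?j = "J (hook n l)" and ?F = "hook_function a n l" and ?M = "partition_monomial (hook n l)"
  define H where "H = mps_scale (mps_coeff ?F ?M) ?j + mps_scale (- mps_coeff ?j ?M) ?F"
  note hook = hook_partitions[OF assms(4)]
  note homj = jack_family_sym_homog[OF J hook]
  have homF: "?F \<in> sym_homog n" using hook_function_sym_homog[of l n a] assms(4) by simp
  have hom: "mps_scale (mps_coeff ?F ?M) ?j \<in> sym_homog n" "mps_scale (- mps_coeff ?j ?M) ?F \<in> sym_homog n"
    by (intro mps.subspace_scale[OF sym_homog_subspace] homj homF)+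
  have homH: "H \<in> sym_homog n"
    unfolding H_def using hom by (rule mps.subspace_add[OF sym_homog_subspace])
  have "mps_coeff H (partition_monomial \<nu>) = 0" if \<nu>: "\<nu> \<in> partitions n" "\<nu> \<notin> below_hook n l" for \<nu>
  proof (cases "\<nu> = hook n l")
    case True
    then show ?thesis by (simp add: H_def mps_coeff_simps)
  next
    case False
    then have len: "length \<nu> \<le> l" using \<nu> by (auto simp: below_hook_def)
    have p: "is_partition \<nu>" "is_partition (hook n l)" using \<nu>(1) hook by (auto simp: partitions_def)
    have "mps_coeff ?j (partition_monomial \<nu>) = 0"
    proof (rule ccontr)
      assume "\<not> ?thesis"
      then have "dominated_by \<nu> (hook n l)" by (rule jack_family_coeff[OF J p(2,1)])
      from dominated_by_length[OF p this] len show False by (simp add: hook_def)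
    qed
    moreover have "mps_coeff ?F (partition_monomial \<nu>) = 0"
      using assms(4) len p(1) by (intro coeff_hook_function_few_variables) (auto simp: card_set_partition_monomial)
    ultimately show ?thesis by (simp add: H_def mps_coeff_simps)
  qed
  then have H: "H \<in> below_hook_space n l" using homH by (auto simp: below_hook_space_def)
  have "jack_inner \<beta> H H = mps_coeff ?F ?M * jack_inner \<beta> ?j H +
      (- mps_coeff ?j ?M) * jack_inner \<beta> ?F H"
    using jack_inner_add_left[OF hom homH, of \<beta>] jack_inner_scale_left[OF homj homH, of \<beta>]
      jack_inner_scale_left[OF homF homH, of \<beta>]
    by (simp only: H_def[symmetric])
  then have "jack_inner \<beta> H H = 0"
    using jack_hook_orthogonal[OF J assms(2,4) H] hook_function_orthogonal[OF assms(3,4) H] by simp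
  then have "H = 0" by (rule jack_inner_definite[OF assms(2) homH])
  then have "mps_coeff H (mset_set {..<n}) = 0" by (simp add: zero_mps.rep_eq)
  then show ?thesis
    by (simp add: H_def mps_coeff_simps jack_family_squarefree[OF J hook])
qed

lemma coeff_hook_function_hook:
  assumes "l < n"
  shows "mps_coeff (hook_function a n l) (partition_monomial (hook n l)) =
    (- 1) ^ l * (of_nat n + (a - 1) * of_nat (Suc l)) * rising_coeff a (n - Suc l)"
proof -
  let ?M = "partition_monomial (hook n l)"
  have p: "is_partition (hook n l)" using hook_partitions[OF assms] by (simp add: partitions_def)
  have set: "set_mset ?M = {..<Suc l}"
    using p by (simp add: set_partition_monomial is_partition_def hook_def)
  \<comment> \<open>Dividing the hook monomial once by each of its l + 1 variables leaves a power of
    x_0.\<close>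
  have "?M - mset_set (set_mset ?M) = replicate_mset (n - Suc l) 0"
  proof (rule multiset_eqI)
    fix i show "count (?M - mset_set (set_mset ?M)) i = count (replicate_mset (n - Suc l) 0) i"
      unfolding set by (cases i) (auto simp: count_partition_monomial count_mset_set' hook_def)
  qed
  moreover have "mps_coeff (g_series a (n - Suc l)) (replicate_mset (n - Suc l) 0) = rising_coeff a (n - Suc l)"
    by (cases "n - Suc l") (simp_all add: coeff_g_series)
  ultimately show ?thesis
    using coeff_hook_function_leading[OF assms, of ?M a] set by simp
qed

lemma jack_hook_coeff:
  fixes a \<beta> :: "'a::linordered_field"
  assumes J: "jack_family \<beta> J" and "\<beta> > 0" "a * \<beta> = 1" "l < n"
  shows "a ^ n * mps_coeff (J (hook n l)) (partition_monomial (hook n l)) =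
    a ^ l * fact l * (of_nat n + (a - 1) * of_nat (Suc l)) * pochhammer a (n - Suc l)"
proof -
  let ?v = "mps_coeff (J (hook n l)) (partition_monomial (hook n l))"
  let ?k = "n - Suc l" and ?c = "of_nat n + (a - 1) * of_nat (Suc l)"
  have a: "a \<noteq> 0" using assms(3) by auto
  have "(- 1) ^ l * (?c * rising_coeff a ?k * fact n) =
      (- 1) ^ l * (?v * (of_nat ((n - l) * (n choose l)) * a ^ (n - l)))"
    using jack_hook_proportional[OF assms] assms(4)
    by (simp add: coeff_hook_function_hook coeff_hook_function_squarefree mult_ac)
  then have "?c * rising_coeff a ?k * fact n = ?v * (of_nat ((n - l) * (n choose l)) * a ^ (n - l))"
    by simp
  \<comment> \<open>This splits off the binomial factor to be cancelled; the factor (n - l - 1)!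
    then clears the denominator of \<open>rising_coeff\<close>.\<close>
  also have "fact n = (fact l * fact ?k * of_nat ((n - l) * (n choose l)) :: 'a)"
  proof -
    have "n - l = Suc ?k" using assms(4) by simp
    then have "fact l * fact ?k * ((n - l) * (n choose l)) = fact l * fact (n - l) * (n choose l)"
      by (simp add: algebra_simps)
    also have "\<dots> = fact n" using assms(4) by (simp add: binomial_fact_lemma)
    finally show ?thesis by (metis of_nat_fact of_nat_mult)
  qed
  finally have "of_nat ((n - l) * (n choose l)) * (?c * rising_coeff a ?k * fact l * fact ?k) =
      of_nat ((n - l) * (n choose l)) * (?v * a ^ (n - l))" by (simp only: mult_ac)
  moreover have "(of_nat ((n - l) * (n choose l)) :: 'a) \<noteq> 0" using assms(4) by (simp only: of_nat_eq_0_iff) simp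
  ultimately have "?c * rising_coeff a ?k * fact l * fact ?k = ?v * a ^ (n - l)"
    by (metis mult_left_cancel)
  then have "a ^ l * (?c * pochhammer a ?k * fact l) = a ^ l * (?v * a ^ (n - l))"
    by (simp add: rising_coeff_def)
  also have "\<dots> = a ^ n * ?v"
    using assms(4) by (simp add: mult_ac power_add[symmetric])
  finally show ?thesis by (simp add: mult_ac)
qed

section \<open>Rook and hit polynomials of Ferrers boards\<close>

definition placements :: "nat \<Rightarrow> (nat \<times> nat) set \<Rightarrow> (nat \<times> nat) set set" where
  "placements k B = {S. S \<subseteq> B \<and> nonattacking S \<and> card S = k}"

lemma rook_number_placements: "rook_number k B = card (placements k B)"
  by (simp add: rook_number_def placements_def)

lemma finite_placements: "finite B \<Longrightarrow> finite (placements k B)"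
  by (rule finite_subset[of _ "Pow B"]) (auto simp: placements_def)

lemma nonattacking_subset: "nonattacking S \<Longrightarrow> S' \<subseteq> S \<Longrightarrow> nonattacking S'"
  unfolding nonattacking_def by (meson subsetD)

lemma nonattacking_inj:
  assumes "nonattacking S"
  shows "inj_on fst S" "inj_on snd S"
  using assms by (auto simp: nonattacking_def inj_on_def)

lemma nonattacking_insert:
  assumes "s \<notin> S"
  shows "nonattacking (insert s S) \<longleftrightarrow> nonattacking S \<and> fst s \<notin> fst ` S \<and> snd s \<notin> snd ` S"
  using assms unfolding nonattacking_def by (auto simp: image_iff)

text \<open>Without an ambient square the last column can be split off, for induction on m.\<close>

definition column_board :: "nat \<Rightarrow> (nat \<Rightarrow> nat) \<Rightarrow> (nat \<times> nat) set" where
  "column_board m c = (SIGMA i:{1..m}. {1..c i})"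

lemma finite_column_board: "finite (column_board m c)"
  by (simp add: column_board_def)

lemma column_board_Suc: "column_board (Suc m) c = column_board m c \<union> Pair (Suc m) ` {1..c (Suc m)}"
  by (auto simp: column_board_def image_iff elim: le_SucE)

lemma placements_too_many:
  assumes "m < k"
  shows "placements k (column_board m c) = {}"
proof -
  have le: "card S \<le> m" if "S \<subseteq> column_board m c" "nonattacking S" for S
  proof -
    have "card S = card (fst ` S)" by (simp add: card_image nonattacking_inj(1)[OF that(2)])
    also have "\<dots> \<le> card {1..m}"
      using that(1) by (intro card_mono) (auto simp: column_board_def)
    finally show ?thesis by simp
  qed
  have "card S \<noteq> k" if "S \<subseteq> column_board m c" "nonattacking S" for S
    using le[OF that] assms by simp
  then show ?thesis unfolding placements_def by blast
qed

text \<open>The other columns are at most as high as the last one, so k rooks in them block exactly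
  k of its cells.\<close>

lemma card_placements_with_column:
  assumes mono: "\<And>i. 1 \<le> i \<Longrightarrow> i \<le> m \<Longrightarrow> c i \<le> c (Suc m)"
  shows "card {S \<in> placements (Suc k) (column_board (Suc m) c). Suc m \<in> fst ` S} =
    card (placements k (column_board m c)) * (c (Suc m) - k)"
proof -
  let ?P = "placements k (column_board m c)"
  let ?Q = "SIGMA S:?P. {1..c (Suc m)} - snd ` S"
  let ?f = "\<lambda>(S, j). insert (Suc m, j) S"
  have notin: "(Suc m, j) \<notin> S" "Suc m \<notin> fst ` S" if "S \<in> ?P" for S j
    using that by (auto simp: placements_def column_board_def)
  have fin: "finite S" if "S \<in> ?P" for S
    using that by (intro finite_subset[OF _ finite_column_board]) (auto simp: placements_def)
  have "?f ` ?Q = {S \<in> placements (Suc k) (column_board (Suc m) c). Suc m \<in> fst ` S}"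
  proof (intro equalityI subsetI)
    fix U assume "U \<in> ?f ` ?Q"
    then obtain S j where S: "S \<in> ?P" "j \<in> {1..c (Suc m)}" "j \<notin> snd ` S" "U = insert (Suc m, j) S"
      by auto
    then show "U \<in> {S \<in> placements (Suc k) (column_board (Suc m) c). Suc m \<in> fst ` S}"
      using notin[OF S(1)] fin[OF S(1)]
      by (auto simp: placements_def nonattacking_insert column_board_Suc)
  next
    fix U assume U: "U \<in> {S \<in> placements (Suc k) (column_board (Suc m) c). Suc m \<in> fst ` S}"
    then obtain j where j: "(Suc m, j) \<in> U" by force
    define S where "S = U - {(Suc m, j)}"
    have U': "U = insert (Suc m, j) S" "(Suc m, j) \<notin> S" using j by (auto simp: S_def)
    have na: "nonattacking S" "Suc m \<notin> fst ` S" "j \<notin> snd ` S"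
      using U U' by (auto simp: placements_def nonattacking_insert)
    have "finite U"
      using U by (intro finite_subset[OF _ finite_column_board]) (auto simp: placements_def)
    then have "card S = k" using U U' by (simp add: placements_def)
    moreover have "S \<subseteq> column_board m c"
    proof
      fix x assume x: "x \<in> S"
      then have "x \<in> column_board (Suc m) c" using U U' by (auto simp: placements_def)
      moreover have "fst x \<noteq> Suc m" using na(2) x by (metis image_eqI)
      ultimately show "x \<in> column_board m c" by (auto simp: column_board_Suc)
    qed
    moreover have "j \<in> {1..c (Suc m)}"
      using U j by (auto simp: placements_def column_board_def)
    ultimately have "(S, j) \<in> ?Q" using na by (auto simp: placements_def)
    then show "U \<in> ?f ` ?Q" using U'(1) by (intro image_eqI[of _ _ "(S, j)"]) auto
  qed
  moreover have "inj_on ?f ?Q"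
  proof (rule inj_onI, clarify)
    fix S j S' j'
    assume *: "S \<in> ?P" "S' \<in> ?P" "insert (Suc m, j) S = insert (Suc m, j') S'"
    have "(Suc m, j) \<in> insert (Suc m, j') S'" using *(3) by blast
    then have "j = j'" using notin(1)[OF *(2)] by simp
    moreover from this have "S = S'"
      using *(3) insert_ident[OF notin(1)[OF *(1)] notin(1)[OF *(2)]] by simp
    ultimately show "S = S' \<and> j = j'" by simp
  qed
  ultimately have "card {S \<in> placements (Suc k) (column_board (Suc m) c). Suc m \<in> fst ` S} = card ?Q"
    using card_image[of ?f ?Q] by simp
  also have "\<dots> = (\<Sum>S\<in>?P. card ({1..c (Suc m)} - snd ` S))"
    using finite_placements[OF finite_column_board] by (intro card_SigmaI) auto
  also have "\<dots> = (\<Sum>S\<in>?P. c (Suc m) - k)"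
  proof (rule sum.cong)
    fix S assume S: "S \<in> ?P"
    have "snd ` S \<subseteq> {1..c (Suc m)}"
    proof
      fix j assume "j \<in> snd ` S"
      then obtain i where i: "(i, j) \<in> S" by force
      then have "1 \<le> i" "i \<le> m" "1 \<le> j" "j \<le> c i"
        using S by (auto simp: placements_def column_board_def)
      then show "j \<in> {1..c (Suc m)}" using mono[of i] by simp
    qed
    moreover have "card (snd ` S) = k"
      using S by (simp add: placements_def card_image nonattacking_inj)
    ultimately show "card ({1..c (Suc m)} - snd ` S) = c (Suc m) - k"
      using fin[OF S] by (simp add: card_Diff_subset)
  qed simp
  finally show ?thesis by simp
qed

lemma placements_without_column:
  "{S \<in> placements k (column_board (Suc m) c). Suc m \<notin> fst ` S} = placements k (column_board m c)"
proof (intro equalityI subsetI)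
  fix S assume S: "S \<in> {S \<in> placements k (column_board (Suc m) c). Suc m \<notin> fst ` S}"
  then have "S \<subseteq> column_board m c" by (force simp: placements_def column_board_Suc)
  with S show "S \<in> placements k (column_board m c)" by (simp add: placements_def)
next
  fix S assume "S \<in> placements k (column_board m c)"
  then show "S \<in> {S \<in> placements k (column_board (Suc m) c). Suc m \<notin> fst ` S}"
    by (fastforce simp: placements_def column_board_def)
qed

lemma rook_number_0: "rook_number 0 (column_board m c) = 1"
proof -
  have "placements 0 (column_board m c) = {{}}"
    using finite_subset[OF _ finite_column_board] by (auto simp: placements_def nonattacking_def)
  then show ?thesis by (simp add: rook_number_placements)
qed

lemma rook_number_Suc:
  assumes "\<And>i. 1 \<le> i \<Longrightarrow> i \<le> m \<Longrightarrow> c i \<le> c (Suc m)"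
  shows "rook_number (Suc k) (column_board (Suc m) c) =
    rook_number (Suc k) (column_board m c) + rook_number k (column_board m c) * (c (Suc m) - k)"
proof -
  let ?R = "placements (Suc k) (column_board (Suc m) c)"
  have "?R = {S \<in> ?R. Suc m \<notin> fst ` S} \<union> {S \<in> ?R. Suc m \<in> fst ` S}" by auto
  then have "card ?R = card {S \<in> ?R. Suc m \<notin> fst ` S} + card {S \<in> ?R. Suc m \<in> fst ` S}"
    using finite_placements[OF finite_column_board]
    by (metis (no_types, lifting) card_Un_disjoint disjoint_iff finite_Un mem_Collect_eq)
  then show ?thesis
    by (simp add: rook_number_placements placements_without_column
        card_placements_with_column[of m c k] assms)
qed

text \<open>This makes the truncated subtraction in \<open>rook_number_Suc\<close> agree with
  subtraction in the ring: where they differ, the rook number is 0.\<close>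

lemma rook_number_rows:
  assumes mono: "\<And>i. 1 \<le> i \<Longrightarrow> i \<le> m \<Longrightarrow> c i \<le> h" and "h < k"
  shows "rook_number k (column_board m c) = 0"
proof -
  have le: "card S \<le> h" if S: "S \<subseteq> column_board m c" "nonattacking S" for S
  proof -
    have "card S = card (snd ` S)" by (simp add: card_image nonattacking_inj(2)[OF that(2)])
    also have "\<dots> \<le> card {1..h}"
    proof (rule card_mono)
      show "snd ` S \<subseteq> {1..h}"
      proof
        fix j assume "j \<in> snd ` S"
        then obtain i where "(i, j) \<in> S" by force
        then have "1 \<le> i" "i \<le> m" "1 \<le> j" "j \<le> c i"
          using S by (auto simp: column_board_def)
        then show "j \<in> {1..h}" using mono[of i] by simp
      qed
    qed simp
    finally show ?thesis by simp
  qed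
  have "card S \<noteq> k" if "S \<subseteq> column_board m c" "nonattacking S" for S
    using le[OF that] \<open>h < k\<close> by simp
  then have "placements k (column_board m c) = {}" unfolding placements_def by blast
  then show ?thesis by (simp add: rook_number_placements)
qed

section \<open>Factorization of the rook polynomial\<close>

definition ffact :: "'a::comm_ring_1 \<Rightarrow> nat \<Rightarrow> 'a" where
  "ffact x k = (\<Prod>i<k. x - of_nat i)"

lemma ffact_gchoose: "(x gchoose k) * fact k = ffact (x::'a::field_char_0) k"
  by (simp add: gbinomial_prod_rev ffact_def atLeast0LessThan)

text \<open>The factorization theorem of Goldman, Joichi and White.\<close>

lemma rook_polynomial_factorization:
  fixes x :: "'a::comm_ring_1"
  assumes "\<And>i j. 1 \<le> i \<Longrightarrow> i \<le> j \<Longrightarrow> j \<le> m \<Longrightarrow> c i \<le> c j"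
  shows "(\<Sum>k\<le>m. of_nat (rook_number k (column_board m c)) * ffact x (m - k)) =
    (\<Prod>i=1..m. x + of_nat (c i) - of_nat (i - 1))"
  using assms
proof (induction m)
  case 0
  then show ?case by (simp add: rook_number_0 ffact_def)
next
  case (Suc m)
  let ?r = "\<lambda>k. rook_number k (column_board m c)" and ?h = "c (Suc m)"
  have mono: "c i \<le> ?h" if "1 \<le> i" "i \<le> m" for i using Suc.prems[of i "Suc m"] that by simp
  have IH: "(\<Sum>k\<le>m. of_nat (?r k) * ffact x (m - k)) =
      (\<Prod>i=1..m. x + of_nat (c i) - of_nat (i - 1))"
    using Suc by simp
  have step: "of_nat (?r k * (?h - k)) = of_nat (?r k) * (of_nat ?h - of_nat k :: 'a)" for k
    using rook_number_rows[of m c ?h k] mono by (cases "k \<le> ?h") (auto simp: of_nat_diff)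
  have rec: "of_nat (rook_number (Suc k) (column_board (Suc m) c)) =
      of_nat (?r (Suc k)) + of_nat (?r k) * (of_nat ?h - of_nat k :: 'a)" for k
    using rook_number_Suc[of m c k] mono by (simp only: of_nat_add step)
  have "(\<Sum>k\<le>Suc m. of_nat (rook_number k (column_board (Suc m) c)) * ffact x (Suc m - k)) =
      ffact x (Suc m) + (\<Sum>k\<le>m. of_nat (rook_number (Suc k) (column_board (Suc m) c)) * ffact x (m - k))"
    by (subst sum.atMost_Suc_shift) (simp add: rook_number_0)
  also have "\<dots> = ffact x (Suc m) + (\<Sum>k\<le>m. of_nat (?r (Suc k)) * ffact x (m - k)) +
      (\<Sum>k\<le>m. of_nat (?r k) * (of_nat ?h - of_nat k) * ffact x (m - k))"
    by (simp add: rec sum.distrib distrib_right add.assoc)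
  also have "ffact x (Suc m) + (\<Sum>k\<le>m. of_nat (?r (Suc k)) * ffact x (m - k)) =
      (\<Sum>k\<le>Suc m. of_nat (?r k) * ffact x (Suc m - k))"
    by (subst sum.atMost_Suc_shift) (simp add: rook_number_0)
  also have "\<dots> = (\<Sum>k\<le>m. of_nat (?r k) * ffact x (Suc m - k))"
    by (simp add: rook_number_placements placements_too_many)
  also have "\<dots> = (\<Sum>k\<le>m. of_nat (?r k) * ((x - of_nat (m - k)) * ffact x (m - k)))"
    by (rule sum.cong) (auto simp: ffact_def Suc_diff_le mult.commute)
  \<comment> \<open>The weights x - (m - k) and h - k add up to x + h - m, which does not depend on
    k.\<close>
  also have "\<dots> + (\<Sum>k\<le>m. of_nat (?r k) * (of_nat ?h - of_nat k) * ffact x (m - k)) =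
      (\<Sum>k\<le>m. of_nat (?r k) * ffact x (m - k)) * (x + of_nat ?h - of_nat m)"
    unfolding sum.distrib[symmetric] sum_distrib_right
    by (rule sum.cong) (auto simp: of_nat_diff algebra_simps)
  finally have E: "(\<Sum>k\<le>Suc m. of_nat (rook_number k (column_board (Suc m) c)) * ffact x (Suc m - k)) =
      (\<Sum>k\<le>m. of_nat (?r k) * ffact x (m - k)) * (x + of_nat ?h - of_nat m)" .
  show ?case unfolding E IH by simp
qed

lemma ferrers_board_column_board:
  assumes "\<And>i. 1 \<le> i \<Longrightarrow> i \<le> n \<Longrightarrow> c i \<le> n"
  shows "ferrers_board n c = column_board n c"
  using assms by (force simp: ferrers_board_def grid_def column_board_def)

lemma rook_sum_ferrers_board:
  fixes x :: "'a::field_char_0"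
  assumes "\<And>i j. 1 \<le> i \<Longrightarrow> i \<le> j \<Longrightarrow> j \<le> n \<Longrightarrow> c i \<le> c j"
    and "\<And>i. 1 \<le> i \<Longrightarrow> i \<le> n \<Longrightarrow> c i \<le> n"
  shows "(\<Sum>k=0..n. of_nat (rook_number (n - k) (ferrers_board n c)) * (x gchoose k) * fact k) =
    (\<Prod>i=1..n. x + of_nat (c i) - of_nat (i - 1))"
proof -
  have "(\<Sum>k=0..n. of_nat (rook_number (n - k) (ferrers_board n c)) * (x gchoose k) * fact k) =
      (\<Sum>k\<le>n. of_nat (rook_number (n - k) (column_board n c)) * ffact x k)"
    by (simp add: ferrers_board_column_board[OF assms(2)] ffact_gchoose[symmetric] mult.assoc
        atMost_atLeast0)
  also have "\<dots> = (\<Sum>k\<le>n. of_nat (rook_number k (column_board n c)) * ffact x (n - k))"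
    by (rule sum.reindex_bij_witness[of _ "\<lambda>k. n - k" "\<lambda>k. n - k"]) auto
  finally show ?thesis using rook_polynomial_factorization[of n c x] assms(1) by simp
qed

text \<open>In a column without a rook, every extension uses one of the n - card S free rows;
  sorting by this row leaves extensions of a placement with one more rook.\<close>

lemma card_extensions:
  assumes "S \<subseteq> grid n" "nonattacking S"
  shows "card {U \<in> placements n (grid n). S \<subseteq> U} = fact (n - card S)"
  using assms
proof (induction "n - card S" arbitrary: S)
  case 0
  have fin: "finite (grid n)" by (simp add: grid_def)
  have "card S = card (fst ` S)" by (simp add: card_image nonattacking_inj(1)[OF 0(3)])
  also have "\<dots> \<le> card {1..n}" using 0(2) by (intro card_mono) (auto simp: grid_def)
  finally have S: "card S = n" using 0(1) by simp
  have "{U \<in> placements n (grid n). S \<subseteq> U} = {S}"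
  proof (intro equalityI subsetI)
    fix U assume U: "U \<in> {U \<in> placements n (grid n). S \<subseteq> U}"
    then have "finite U" by (intro finite_subset[OF _ fin]) (auto simp: placements_def)
    then have "S = U" using U S by (intro card_subset_eq) (auto simp: placements_def)
    then show "U \<in> {S}" by simp
  qed (use 0 S in \<open>auto simp: placements_def\<close>)
  with S show ?case by simp
next
  case (Suc m)
  have fin: "finite (grid n)" by (simp add: grid_def)
  have finS: "finite S" by (rule finite_subset[OF Suc(3) fin])
  have cfst: "card (fst ` S) = card S" and csnd: "card (snd ` S) = card S"
    by (simp_all add: card_image nonattacking_inj[OF Suc(4)])
  have sub: "fst ` S \<subseteq> {1..n}" "snd ` S \<subseteq> {1..n}" using Suc(3) by (auto simp: grid_def)
  have "\<exists>i\<in>{1..n}. i \<notin> fst ` S"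
  proof (rule ccontr)
    assume "\<not> ?thesis"
    then have "{1..n} = fst ` S" using sub(1) by blast
    then show False using cfst Suc(2) by (metis card_atLeastAtMost diff_Suc_1 diff_self_eq_0 nat.distinct(1))
  qed
  then obtain i where i: "i \<in> {1..n}" "i \<notin> fst ` S" by blast
  define R where "R = {1..n} - snd ` S"
  have cR: "card R = Suc m" using sub(2) csnd finS Suc(2) by (simp add: R_def card_Diff_subset)
  let ?E = "\<lambda>S. {U \<in> placements n (grid n). S \<subseteq> U}"
  have new: "(i, j) \<notin> S" for j using i(2) by force
  have "?E S = (\<Union>j\<in>R. ?E (insert (i, j) S))"
  proof (intro equalityI subsetI)
    fix U assume U: "U \<in> ?E S"
    then have na: "nonattacking U" and UG: "U \<subseteq> grid n" and cU: "card U = n" "S \<subseteq> U"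
      by (auto simp: placements_def)
    have "card (fst ` U) = n" using cU by (simp add: card_image nonattacking_inj[OF na])
    moreover have "fst ` U \<subseteq> {1..n}" using UG by (auto simp: grid_def)
    ultimately have "fst ` U = {1..n}" by (intro card_subset_eq) auto
    then obtain j where j: "(i, j) \<in> U" using i(1) by force
    have "j \<in> {1..n}" using j UG by (auto simp: grid_def)
    moreover have "j \<notin> snd ` S"
    proof
      assume "j \<in> snd ` S"
      then obtain i' where "(i', j) \<in> S" by force
      then show False using na j cU(2) new by (force simp: nonattacking_def)
    qed
    ultimately show "U \<in> (\<Union>j\<in>R. ?E (insert (i, j) S))" using U j by (auto simp: R_def)
  qed auto
  also have "card \<dots> = (\<Sum>j\<in>R. card (?E (insert (i, j) S)))"
  proof (rule card_UN_disjoint)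
    show "finite R" by (simp add: R_def)
    show "\<forall>j\<in>R. finite (?E (insert (i, j) S))" using finite_placements[OF fin] by simp
    show "\<forall>j\<in>R. \<forall>j'\<in>R. j \<noteq> j' \<longrightarrow> ?E (insert (i, j) S) \<inter> ?E (insert (i, j') S) = {}"
      by (fastforce simp: placements_def nonattacking_def)
  qed
  also have "\<dots> = (\<Sum>j\<in>R. fact m)"
  proof (rule sum.cong)
    fix j assume j: "j \<in> R"
    have "m = n - card (insert (i, j) S)" using Suc(2) finS new by simp
    moreover have "insert (i, j) S \<subseteq> grid n" using j i Suc(3) by (auto simp: R_def grid_def)
    moreover have "nonattacking (insert (i, j) S)"
      using j i Suc(4) by (simp add: nonattacking_insert[OF new] R_def)
    ultimately show "card (?E (insert (i, j) S)) = fact m" using Suc(1) by metis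
  qed simp
  finally show ?case using cR Suc(2)[symmetric] by simp
qed

text \<open>Double counting of the pairs of a full placement and j of its rooks on
  \<open>B\<close>.\<close>

lemma hit_rook_identity:
  assumes "B \<subseteq> grid n"
  shows "(\<Sum>k\<le>n. hit_number n k B * (k choose j)) = rook_number j B * fact (n - j)"
proof -
  let ?P = "placements n (grid n)"
  have fin: "finite (grid n)" by (simp add: grid_def)
  note finP = finite_placements[OF fin, of n]
  have finB: "finite B" by (rule finite_subset[OF assms fin])
  have finU: "finite U" if "U \<in> ?P" for U
    using that by (intro finite_subset[OF _ fin]) (auto simp: placements_def)
  have "(\<Sum>k\<le>n. hit_number n k B * (k choose j)) =
      (\<Sum>k\<le>n. \<Sum>U\<in>{U\<in>?P. card (U \<inter> B) = k}. (card (U \<inter> B) choose j))"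
    by (rule sum.cong) (auto simp: hit_number_def placements_def conj_assoc)
  also have "\<dots> = (\<Sum>U\<in>?P. (card (U \<inter> B) choose j))"
  proof (rule sum.group)
    show "(\<lambda>U. card (U \<inter> B)) ` ?P \<subseteq> {..n}"
    proof (rule image_subsetI)
      fix U assume "U \<in> ?P"
      then show "card (U \<inter> B) \<in> {..n}"
        using card_mono[OF finU, of U "U \<inter> B"] by (auto simp: placements_def)
    qed
  qed (use finP in auto)
  also have "\<dots> = (\<Sum>U\<in>?P. card {S. S \<subseteq> U \<inter> B \<and> card S = j})"
    by (intro sum.cong refl n_subsets[symmetric] finite_Int disjI1 finU)
  also have "\<dots> = card (SIGMA U:?P. {S. S \<subseteq> U \<inter> B \<and> card S = j})"
    using finP finU by (intro card_SigmaI[symmetric]) auto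
  also have "\<dots> = card (SIGMA S:placements j B. {U \<in> ?P. S \<subseteq> U})"
  proof (rule bij_betw_same_card[OF bij_betw_byWitness[where f = prod.swap and f' = prod.swap]])
    show "prod.swap ` (SIGMA U:?P. {S. S \<subseteq> U \<inter> B \<and> card S = j}) \<subseteq>
        (SIGMA S:placements j B. {U \<in> ?P. S \<subseteq> U})"
      by (auto simp: placements_def intro: nonattacking_subset)
  qed (auto simp: placements_def)
  also have "\<dots> = (\<Sum>S\<in>placements j B. card {U \<in> ?P. S \<subseteq> U})"
    using finP finite_placements[OF finB] by (intro card_SigmaI) auto
  also have "\<dots> = (\<Sum>S\<in>placements j B. fact (n - j))"
  proof (rule sum.cong[OF refl])
    fix S assume "S \<in> placements j B"
    then have "S \<subseteq> grid n" "nonattacking S" "card S = j"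
      using assms by (auto simp: placements_def)
    then show "card {U \<in> ?P. S \<subseteq> U} = fact (n - j)" using card_extensions by metis
  qed
  finally show ?thesis by (simp add: rook_number_placements)
qed

text \<open>Vandermonde's convolution expands each binomial in the basis \<open>x gchoose j\<close>,
  and the coefficients are the sums of \<open>hit_rook_identity\<close> at n - j.\<close>

lemma hit_sum_eq_rook_sum:
  fixes x :: "'a::field_char_0"
  assumes "B \<subseteq> grid n"
  shows "(\<Sum>k=0..n. of_nat (hit_number n k B) * ((x + of_nat k) gchoose n)) =
    (\<Sum>k=0..n. of_nat (rook_number (n - k) B) * (x gchoose k) * fact k)"
proof -
  have "(x + of_nat k) gchoose n = (\<Sum>j\<le>n. (x gchoose j) * of_nat (k choose (n - j)))" for k
    by (simp add: gbinomial_Vandermonde[symmetric] binomial_gbinomial atMost_atLeast0)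
  then have "(\<Sum>k=0..n. of_nat (hit_number n k B) * ((x + of_nat k) gchoose n)) =
      (\<Sum>k\<le>n. \<Sum>j\<le>n. of_nat (hit_number n k B) * ((x gchoose j) * of_nat (k choose (n - j))))"
    by (simp add: sum_distrib_left atMost_atLeast0)
  also have "\<dots> = (\<Sum>j\<le>n. (x gchoose j) * of_nat (\<Sum>k\<le>n. hit_number n k B * (k choose (n - j))))"
    by (subst sum.swap) (simp add: sum_distrib_left algebra_simps)
  also have "\<dots> = (\<Sum>j\<le>n. of_nat (rook_number (n - j) B) * (x gchoose j) * fact j)"
    by (rule sum.cong) (auto simp: hit_rook_identity[OF assms] algebra_simps)
  finally show ?thesis by (simp add: atMost_atLeast0)
qed

text \<open>Both boards of the theorem have this shape. The flat columns contribute x + h - 1, ...,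
  x, a rising factorial read backwards, and each column of the staircase contributes x.\<close>

lemma rook_sum_step_board:
  fixes x :: "'a::field_char_0"
  assumes "h \<le> n" and flat: "\<And>i. 1 \<le> i \<Longrightarrow> i \<le> h \<Longrightarrow> e i = h - 1"
    and stairs: "\<And>i. h < i \<Longrightarrow> i \<le> n \<Longrightarrow> e i = i - 1"
  shows "(\<Sum>k=0..n. of_nat (rook_number (n - k) (ferrers_board n e)) * (x gchoose k) * fact k) =
    pochhammer x h * x ^ (n - h)"
proof -
  have e: "e i = (if i \<le> h then h - 1 else i - 1)" if "1 \<le> i" "i \<le> n" for i
    using that flat[of i] stairs[of i] by auto
  have "(\<Sum>k=0..n. of_nat (rook_number (n - k) (ferrers_board n e)) * (x gchoose k) * fact k) =
      (\<Prod>i=1..n. x + of_nat (e i) - of_nat (i - 1))"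
  proof (rule rook_sum_ferrers_board)
    show "e i \<le> e j" if "1 \<le> i" "i \<le> j" "j \<le> n" for i j
      using that e[of i] e[of j] by auto
    show "e i \<le> n" if "1 \<le> i" "i \<le> n" for i
      using that e[of i] assms(1) by auto
  qed
  also have "{1..n} = {1..h} \<union> {h<..n}" using assms(1) by auto
  also have "(\<Prod>i\<in>{1..h} \<union> {h<..n}. x + of_nat (e i) - of_nat (i - 1)) =
      (\<Prod>i=1..h. x + of_nat (e i) - of_nat (i - 1)) * (\<Prod>i\<in>{h<..n}. x + of_nat (e i) - of_nat (i - 1))"
    by (rule prod.union_disjoint) auto
  also have "(\<Prod>i=1..h. x + of_nat (e i) - of_nat (i - 1)) = (\<Prod>i=0..<h. x + of_nat i)"
  proof (rule prod.reindex_bij_witness[of _ "\<lambda>i. h - i" "\<lambda>i. h - i"])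
    fix i assume "i \<in> {1..h}"
    then have "e i = (h - i) + (i - 1)" using flat[of i] by auto
    then show "x + of_nat (h - i) = x + of_nat (e i) - of_nat (i - 1)" by simp
  qed auto
  also have "\<dots> = pochhammer x h" by (simp add: pochhammer_prod)
  also have "(\<Prod>i\<in>{h<..n}. x + of_nat (e i) - of_nat (i - 1)) = (\<Prod>i\<in>{h<..n}. x)"
    by (intro prod.cong refl) (auto simp: stairs)
  finally show ?thesis by simp
qed

text \<open>Polynomials are ordered by the sign of the leading coefficient, and fractions
  accordingly.\<close>

lemma alpha_pos: "alpha > 0"
  by (simp add: alpha_def to_fract_def zero_less_Fract_iff less_poly_def pos_poly_def)

theorem proposition3p10:
  fixes n l :: nat and \<mu> :: "nat list" and c d :: "nat \<Rightarrow> nat"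
    and J :: "nat list \<Rightarrow> rat poly fract mps"
  assumes "n \<ge> 1" and "l \<le> n - 1"
    and "\<mu> = (n - l) # replicate l 1"
    and "jack_family (1 / alpha) J"
    and "\<And>i. 1 \<le> i \<Longrightarrow> i \<le> n - l - 1 \<Longrightarrow> c i = n - l - 2"
    and "\<And>i. 0 \<le> i \<Longrightarrow> i \<le> l \<Longrightarrow> c (n - l + i) = n - l - 1 + i"
    and "\<And>i. 1 \<le> i \<Longrightarrow> i \<le> n - l \<Longrightarrow> d i = n - l - 1"
    and "\<And>i. 1 \<le> i \<Longrightarrow> i \<le> l \<Longrightarrow> d (n - l + i) = n - l - 1 + i"
  shows "hall_inner (jack_tilde J \<mu>) (schur \<mu>) =
      (\<Sum>k=0..n. of_nat (l * fact l * hit_number n k (ferrers_board n c)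
          + fact l * hit_number n k (ferrers_board n d)) * ((alpha + of_nat k) gchoose n))
    \<and> (\<Sum>k=0..n. of_nat (l * fact l * hit_number n k (ferrers_board n c)
          + fact l * hit_number n k (ferrers_board n d)) * ((alpha + of_nat k) gchoose n)) =
      (\<Sum>k=0..n. of_nat (l * fact l * rook_number (n - k) (ferrers_board n c)
          + fact l * rook_number (n - k) (ferrers_board n d)) * (alpha gchoose k) * fact k)"
proof -
  let ?C = "ferrers_board n c" and ?D = "ferrers_board n d"
  let ?hit = "\<lambda>B. \<Sum>k=0..n. of_nat (hit_number n k B) * ((alpha + of_nat k) gchoose n)"
  let ?rook = "\<lambda>B. \<Sum>k=0..n. of_nat (rook_number (n - k) B) * (alpha gchoose k) * fact k"
  let ?H = "\<Sum>k=0..n. of_nat (l * fact l * hit_number n k ?C + fact l * hit_number n k ?D) *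
      ((alpha + of_nat k) gchoose n)"
  let ?R = "\<Sum>k=0..n. of_nat (l * fact l * rook_number (n - k) ?C + fact l * rook_number (n - k) ?D) *
      (alpha gchoose k) * fact k"
  \<comment> \<open>The flat part has m columns on the board of \<open>c\<close> and m + 1 on that
    of \<open>d\<close>; m = 0 occurs when l = n - 1.\<close>
  define m where "m = n - l - 1"
  have ln: "l < n" and n: "n = Suc (m + l)" using assms(1,2) by (auto simp: m_def)
  have sub: "ferrers_board n b \<subseteq> grid n" for b by (auto simp: ferrers_board_def)
  have "?H = of_nat (l * fact l) * ?hit ?C + of_nat (fact l) * ?hit ?D"
    unfolding sum_distrib_left sum.distrib[symmetric] of_nat_add of_nat_mult
    by (intro sum.cong refl) (simp add: distrib_right mult.assoc)
  also have "\<dots> = of_nat (l * fact l) * ?rook ?C + of_nat (fact l) * ?rook ?D"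
    by (simp only: hit_sum_eq_rook_sum[OF sub])
  finally have H: "?H = of_nat (l * fact l) * ?rook ?C + of_nat (fact l) * ?rook ?D" .
  have R: "?R = of_nat (l * fact l) * ?rook ?C + of_nat (fact l) * ?rook ?D"
    unfolding sum_distrib_left sum.distrib[symmetric] of_nat_add of_nat_mult
    by (intro sum.cong refl) (simp add: distrib_right mult.assoc)
  have C: "?rook ?C = pochhammer alpha m * alpha ^ (n - m)"
  proof (rule rook_sum_step_board)
    show "c i = m - 1" if "1 \<le> i" "i \<le> m" for i
      using assms(5)[of i] that by (simp add: m_def)
    show "c i = i - 1" if "m < i" "i \<le> n" for i
      using assms(6)[of "i - (n - l)"] that n by simp
  qed (simp add: n)
  have D: "?rook ?D = pochhammer alpha (Suc m) * alpha ^ (n - Suc m)"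
  proof (rule rook_sum_step_board)
    show "d i = Suc m - 1" if "1 \<le> i" "i \<le> Suc m" for i
      using assms(7)[of i] that n by simp
    show "d i = i - 1" if "Suc m < i" "i \<le> n" for i
      using assms(8)[of "i - (n - l)"] that n by simp
  qed (simp add: n)
  have \<mu>: "\<mu> = hook n l" using assms(3) by (simp add: hook_def)
  note part = hook_partitions[OF ln, folded \<mu>]
  have p: "is_partition \<mu>" "sum_list \<mu> = n" using part by (auto simp: partitions_def)
  have "hall_inner (jack_tilde J \<mu>) (schur \<mu>) = mps_coeff (jack_tilde J \<mu>) (partition_monomial \<mu>)"
  proof (rule hall_inner_schur[OF _ part])
    show "jack_tilde J \<mu> \<in> sym_homog n"
      unfolding jack_tilde_def
      by (rule mps.subspace_scale[OF sym_homog_subspace jack_family_sym_homog[OF assms(4) part]])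
    fix \<kappa> assume \<kappa>: "\<kappa> \<in> partitions n" "mps_coeff (jack_tilde J \<mu>) (partition_monomial \<kappa>) \<noteq> 0"
    then have "is_partition \<kappa>" "mps_coeff (J \<mu>) (partition_monomial \<kappa>) \<noteq> 0"
      by (auto simp: partitions_def jack_tilde_def mps_scale.rep_eq)
    then show "sum_mset (partition_monomial \<mu>) \<le> sum_mset (partition_monomial \<kappa>)"
      by (intro dominated_by_sum_mset jack_family_coeff[OF assms(4) p(1)])
  qed
  also have "\<dots> = alpha ^ n * mps_coeff (J (hook n l)) (partition_monomial (hook n l))"
    using p(2) by (simp add: jack_tilde_def mps_scale.rep_eq \<mu>)
  also have "\<dots> = alpha ^ l * fact l * (of_nat n + (alpha - 1) * of_nat (Suc l)) * pochhammer alpha (n - Suc l)"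
    using alpha_pos by (intro jack_hook_coeff[OF assms(4) _ _ ln]) simp_all
  also have "\<dots> = of_nat (l * fact l) * ?rook ?C + of_nat (fact l) * ?rook ?D"
  proof -
    \<comment> \<open>As n = m + l + 1, the linear factor is l \<alpha> + (\<alpha> + m). Its first
      term gives the board of \<open>c\<close>; the second extends the rising factorial by one
      factor and gives the board of \<open>d\<close>.\<close>
    have "alpha ^ l * fact l * (of_nat n + (alpha - 1) * of_nat (Suc l)) * pochhammer alpha (n - Suc l) =
        of_nat (l * fact l) * (pochhammer alpha m * alpha ^ (n - m)) +
        of_nat (fact l) * (pochhammer alpha (Suc m) * alpha ^ (n - Suc m))"
      unfolding n by (simp add: pochhammer_Suc algebra_simps)
    then show ?thesis by (simp only: C D)
  qed
  finally show ?thesis unfolding H R by simp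
qed

end
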